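(* Suppose there exists a clustering algorithm $\hat z$ (mapping the data $X\in\mathbb{R}^{p\times n}$ to $\hat z(X)\in\{-1,1\}^n$) with runtime $O(r_n)$ such that for some misclustering tolerance $0\le\delta<1/2$ and some error probability $0\le\alpha\le1$, $$\sup_{(\theta,z)\in\mathcal{P}_\Delta}\mathbb{P}_{(\theta,z)}\left(\ell(\hat z,z)>\delta\right)\le\alpha,$$ for some $$\Delta>2\sqrt6\,(1-2\delta)^{-1}\sqrt{1+\epsilon^{-2}}\,\sqrt{s\log(ep/s)/n},$$ where $\epsilon\in(0,1]$. Then there exists a test $t_n:\mathbb{R}^{pn}\to\{0,1\}$ with runtime $O(r_n+pn)$ and error probability satisfying $$\mathbb{E}_0[t_n]+\sup_{((1-\epsilon^2)\theta,z)\in\mathcal{P}_\Delta}\mathbb{E}_{(\theta,z)}[1-t_n]\le\alpha+s/p .$$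
   Context: Model: $X_i=z_i\theta+\varepsilon_i\in\mathbb{R}^p$, $i=1,\dots,n$, with $\varepsilon_i$ i.i.d. $\mathcal{N}(0,I_p)$, $z\in\{-1,1\}^n$, $\|\theta\|_0\le s$ ($\|\theta\|_0$ is the number of nonzero entries), and data matrix $X=[X_1,\dots,X_n]$. $\mathbb{P}_{(\theta,z)}$ and $\mathbb{E}_{(\theta,z)}$ denote probability and expectation when the data are drawn from this model with parameters $(\theta,z)$; when $\theta=0$ one writes $\mathbb{E}_0$ (then $z$ is immaterial). The parameters $p,s,\Delta$ may depend on $n$. The parameter set is $$\mathcal{P}_\Delta=\{(\theta,z): z\in\{-1,1\}^n,\ \|\theta\|_0\le s,\ \|\theta\|\ge\Delta,\ \theta\in\mathbb{R}^p\},$$ with $\|\cdot\|$ the Euclidean norm, and the misclustering error is $$\ell(\hat z,z)=\min_{\pi\in\{-1,1\}}\frac1n\sum_{i=1}^n\mathbf{1}(\pi\hat z_i\ne z_i).$$ The supremum in the conclusion is over all $(\theta,z)$ with $((1-\epsilon^2)\theta,z)\in\mathcal{P}_\Delta$ (a supremum over the empty set, which occurs for $\epsilon=1$, is $0$). The algorithm and the test may use internal randomness independent of the data (including drawing standard Gaussian variables); probabilities and expectations are then also over this randomness. *)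

theory Defs
  imports "HOL-Probability.Probability" "HOL-Library.Landau_Symbols"
begin

section \<open>Gaussian clustering model\<close>

text \<open>
  A vector in \<open>R^p\<close> is a function \<open>nat \<Rightarrow> real\<close> of which only the coordinates \<open>j < p\<close> are used.
  A data set is a function \<open>X\<close> with \<open>X i j\<close> the \<open>j\<close>-th coordinate of the observation \<open>X_i\<close>,
  where \<open>i < n\<close> and \<open>j < p\<close>; both indices start at 0.
\<close>

definition std_gaussian :: "real measure" where
  "std_gaussian = density lborel (\<lambda>x. ennreal (std_normal_density x))"

definition gaussian_noise :: "nat \<Rightarrow> nat \<Rightarrow> (nat \<Rightarrow> nat \<Rightarrow> real) measure" where
  "gaussian_noise n p = PiM {..<n} (\<lambda>_. PiM {..<p} (\<lambda>_. std_gaussian))"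

definition cluster_model ::
    "nat \<Rightarrow> nat \<Rightarrow> (nat \<Rightarrow> real) \<Rightarrow> (nat \<Rightarrow> real) \<Rightarrow> (nat \<Rightarrow> nat \<Rightarrow> real) measure" where
  "cluster_model n p \<theta> z =
     distr (gaussian_noise n p) (PiM {..<n} (\<lambda>_. PiM {..<p} (\<lambda>_. borel)))
       (\<lambda>noise. \<lambda>i\<in>{..<n}. \<lambda>j\<in>{..<p}. z i * \<theta> j + noise i j)"

definition l0_norm :: "nat \<Rightarrow> (nat \<Rightarrow> real) \<Rightarrow> nat" where
  "l0_norm p \<theta> = card {j. j < p \<and> \<theta> j \<noteq> 0}"

definition param_set ::
    "nat \<Rightarrow> nat \<Rightarrow> nat \<Rightarrow> real \<Rightarrow> ((nat \<Rightarrow> real) \<times> (nat \<Rightarrow> real)) set" where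
  "param_set n p s \<Delta> =
     {(\<theta>, z). z \<in> {..<n} \<rightarrow> {-1, 1} \<and> l0_norm p \<theta> \<le> s \<and> L2_set \<theta> {..<p} \<ge> \<Delta>}"

definition misclust :: "nat \<Rightarrow> (nat \<Rightarrow> real) \<Rightarrow> (nat \<Rightarrow> real) \<Rightarrow> real" where
  "misclust n zh z =
     (MIN \<pi>\<in>{-1, 1}. 1 / real n * (\<Sum>i<n. of_bool (\<pi> * zh i \<noteq> z i)))"

section \<open>Randomized real random access machine\<close>

text \<open>
  The model of computation is a unit-cost real RAM with structured control flow. The memory has
  countably many arrays of natural numbers and countably many arrays of reals, each with indirect
  addressing by natural numbers; a scalar is cell 0 of an array. There is no instruction turning
  a real into a natural number. Randomness comes from a stream of standard Gaussian variables and
  a stream of variables uniform on \<open>[0,1]\<close>, each consumed from the front.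
  A program is a fixed finite text, so its expressions have bounded size and charging one time
  unit for each elementary command, expressions included, affects running times only by a
  constant factor.
\<close>

datatype iexp =
    IConst nat
  | IRead nat iexp  \<comment> \<open>array name, index\<close>
  | IAdd iexp iexp
  | ISub iexp iexp
  | IMul iexp iexp

datatype rexp =
    RConst real
  | ROf iexp
  | RRead nat iexp  \<comment> \<open>array name, index\<close>
  | RAdd rexp rexp
  | RSub rexp rexp
  | RMul rexp rexp
  | RDiv rexp rexp
  | RSqrt rexp
  | RExp rexp
  | RLn rexp

datatype bexp =
    ILess iexp iexp
  | RLess rexp rexp
  | Not bexp
  | And bexp bexp

datatype com =
    Skip
  | IAssign nat iexp iexp  \<comment> \<open>array name, index, new value\<close>
  | RAssign nat iexp rexp
  | DrawGauss nat iexp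
  | DrawUnif nat iexp
  | Seq com com
  | If bexp com com
  | While bexp com

type_synonym imem = "nat \<Rightarrow> nat \<Rightarrow> nat"
type_synonym rmem = "nat \<Rightarrow> nat \<Rightarrow> real"
type_synonym tape = "real stream \<times> real stream"
type_synonym state = "imem \<times> rmem \<times> tape"

fun ival :: "iexp \<Rightarrow> imem \<Rightarrow> nat" where
  "ival (IConst k) m = k"
| "ival (IRead a e) m = m a (ival e m)"
| "ival (IAdd e f) m = ival e m + ival f m"
| "ival (ISub e f) m = ival e m - ival f m"
| "ival (IMul e f) m = ival e m * ival f m"

fun rval :: "rexp \<Rightarrow> imem \<Rightarrow> rmem \<Rightarrow> real" where
  "rval (RConst x) m v = x"
| "rval (ROf e) m v = real (ival e m)"
| "rval (RRead a e) m v = v a (ival e m)"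
| "rval (RAdd e f) m v = rval e m v + rval f m v"
| "rval (RSub e f) m v = rval e m v - rval f m v"
| "rval (RMul e f) m v = rval e m v * rval f m v"
| "rval (RDiv e f) m v = rval e m v / rval f m v"
| "rval (RSqrt e) m v = sqrt (rval e m v)"
| "rval (RExp e) m v = exp (rval e m v)"
| "rval (RLn e) m v = ln (rval e m v)"

fun bval :: "bexp \<Rightarrow> imem \<Rightarrow> rmem \<Rightarrow> bool" where
  "bval (ILess e f) m v \<longleftrightarrow> ival e m < ival f m"
| "bval (RLess e f) m v \<longleftrightarrow> rval e m v < rval f m v"
| "bval (Not b) m v \<longleftrightarrow> \<not> bval b m v"
| "bval (And b c) m v \<longleftrightarrow> bval b m v \<and> bval c m v"

definition store :: "(nat \<Rightarrow> nat \<Rightarrow> 'a) \<Rightarrow> nat \<Rightarrow> nat \<Rightarrow> 'a \<Rightarrow> nat \<Rightarrow> nat \<Rightarrow> 'a" where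
  "store m a k x = m(a := (m a)(k := x))"

text \<open>\<open>exec c \<sigma> t \<sigma>'\<close>: started in \<open>\<sigma>\<close>, the program \<open>c\<close> halts after \<open>t\<close> steps in state \<open>\<sigma>'\<close>.\<close>

inductive exec :: "com \<Rightarrow> state \<Rightarrow> nat \<Rightarrow> state \<Rightarrow> bool" where
  Skip: "exec Skip \<sigma> 1 \<sigma>"
| IAssign: "exec (IAssign a e f) (m, v, \<omega>) 1 (store m a (ival e m) (ival f m), v, \<omega>)"
| RAssign: "exec (RAssign a e f) (m, v, \<omega>) 1 (m, store v a (ival e m) (rval f m v), \<omega>)"
| DrawGauss: "exec (DrawGauss a e) (m, v, g, u) 1 (m, store v a (ival e m) (shd g), stl g, u)"
| DrawUnif: "exec (DrawUnif a e) (m, v, g, u) 1 (m, store v a (ival e m) (shd u), g, stl u)"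
| Seq: "exec c \<sigma> t \<sigma>' \<Longrightarrow> exec d \<sigma>' t' \<sigma>'' \<Longrightarrow> exec (Seq c d) \<sigma> (t + t') \<sigma>''"
| IfTrue: "bval b m v \<Longrightarrow> exec c (m, v, \<omega>) t \<sigma>' \<Longrightarrow> exec (If b c d) (m, v, \<omega>) (Suc t) \<sigma>'"
| IfFalse: "\<not> bval b m v \<Longrightarrow> exec d (m, v, \<omega>) t \<sigma>' \<Longrightarrow> exec (If b c d) (m, v, \<omega>) (Suc t) \<sigma>'"
| WhileFalse: "\<not> bval b m v \<Longrightarrow> exec (While b c) (m, v, \<omega>) 1 (m, v, \<omega>)"
| WhileTrue: "bval b m v \<Longrightarrow> exec c (m, v, \<omega>) t \<sigma>' \<Longrightarrow> exec (While b c) \<sigma>' t' \<sigma>'' \<Longrightarrow>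
    exec (While b c) (m, v, \<omega>) (Suc (t + t')) \<sigma>''"

inductive_cases exec_SkipE: "exec Skip \<sigma> t \<sigma>'"
inductive_cases exec_IAssignE: "exec (IAssign a e f) \<sigma> t \<sigma>'"
inductive_cases exec_RAssignE: "exec (RAssign a e f) \<sigma> t \<sigma>'"
inductive_cases exec_DrawGaussE: "exec (DrawGauss a e) \<sigma> t \<sigma>'"
inductive_cases exec_DrawUnifE: "exec (DrawUnif a e) \<sigma> t \<sigma>'"
inductive_cases exec_SeqE: "exec (Seq c d) \<sigma> t \<sigma>'"
inductive_cases exec_IfE: "exec (If b c d) \<sigma> t \<sigma>'"
inductive_cases exec_WhileE: "exec (While b c) \<sigma> t \<sigma>'"

lemma exec_deterministic:
  "exec c \<sigma> t \<sigma>' \<Longrightarrow> exec c \<sigma> t' \<sigma>'' \<Longrightarrow> t' = t \<and> \<sigma>'' = \<sigma>'"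
proof (induction arbitrary: t' \<sigma>'' rule: exec.induct)
  case (Skip \<sigma>)
  then show ?case by (rule exec_SkipE) simp
next
  case (IAssign a e f m v \<omega>)
  then show ?case by (rule exec_IAssignE) simp
next
  case (RAssign a e f m v \<omega>)
  then show ?case by (rule exec_RAssignE) simp
next
  case (DrawGauss a e m v g u)
  then show ?case by (rule exec_DrawGaussE) simp
next
  case (DrawUnif a e m v g u)
  then show ?case by (rule exec_DrawUnifE) simp
next
  case (Seq c \<sigma> t \<sigma>' d t1 \<sigma>1)
  from Seq.prems show ?case
  proof (rule exec_SeqE)
    fix t2 \<sigma>2 t3
    assume t': "t' = t2 + t3" and c: "exec c \<sigma> t2 \<sigma>2" and d: "exec d \<sigma>2 t3 \<sigma>''"
    have eq: "t2 = t \<and> \<sigma>2 = \<sigma>'" by (rule Seq.IH(1)[OF c])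
    from d have d': "exec d \<sigma>' t3 \<sigma>''" unfolding eq[THEN conjunct2] .
    have "t3 = t1" "\<sigma>'' = \<sigma>1" using Seq.IH(2)[OF d'] by blast+
    with eq t' show ?thesis by blast
  qed
next
  case (IfTrue b m v c \<omega> t \<sigma>' d)
  from IfTrue.prems show ?case
  proof (rule exec_IfE)
    fix m' v' \<omega>' t2
    assume eqs: "(m, v, \<omega>) = (m', v', \<omega>')" and t': "t' = Suc t2"
      and c: "exec c (m', v', \<omega>') t2 \<sigma>''"
    from c have "exec c (m, v, \<omega>) t2 \<sigma>''" unfolding eqs .
    from IfTrue.IH[OF this] t' show ?thesis by blast
  qed (use IfTrue.hyps(1) in blast)
next
  case (IfFalse b m v d \<omega> t \<sigma>' c)
  from IfFalse.prems show ?case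
  proof (rule exec_IfE)
    fix m' v' \<omega>' t2
    assume eqs: "(m, v, \<omega>) = (m', v', \<omega>')" and t': "t' = Suc t2"
      and d: "exec d (m', v', \<omega>') t2 \<sigma>''"
    from d have "exec d (m, v, \<omega>) t2 \<sigma>''" unfolding eqs .
    from IfFalse.IH[OF this] t' show ?thesis by blast
  qed (use IfFalse.hyps(1) in blast)
next
  case (WhileFalse b m v c \<omega>)
  from WhileFalse.prems show ?case
    by (rule exec_WhileE) (use WhileFalse.hyps in simp_all)
next
  case (WhileTrue b m v c \<omega> t \<sigma>' t1 \<sigma>1)
  from WhileTrue.prems show ?case
  proof (rule exec_WhileE)
    fix m' v' \<omega>' t2 \<sigma>2 t3
    assume eqs: "(m, v, \<omega>) = (m', v', \<omega>')" and t': "t' = Suc (t2 + t3)"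
      and c: "exec c (m', v', \<omega>') t2 \<sigma>2" and w: "exec (While b c) \<sigma>2 t3 \<sigma>''"
    from c have "exec c (m, v, \<omega>) t2 \<sigma>2" unfolding eqs .
    from WhileTrue.IH(1)[OF this] have eq: "t2 = t \<and> \<sigma>2 = \<sigma>'" .
    from w have w': "exec (While b c) \<sigma>' t3 \<sigma>''" unfolding eq[THEN conjunct2] .
    have "t3 = t1" "\<sigma>'' = \<sigma>1" using WhileTrue.IH(2)[OF w'] by blast+
    with eq t' show ?thesis by blast
  qed (use WhileTrue.hyps(1) in blast)
qed

definition randomness :: "tape measure" where
  "randomness = stream_space std_gaussian \<Otimes>\<^sub>M stream_space (uniform_measure lborel {0..1})"

text \<open>
  Input convention: cells 0, 1, 2 of natural number array 0 hold \<open>n\<close>, \<open>p\<close>, \<open>s\<close>; cell \<open>i * p + j\<close>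
  of real array 0 holds \<open>X i j\<close>; cell 0 of real array 1 holds \<open>\<Delta>\<close>; everything else is zero.
\<close>

definition init_state ::
    "nat \<Rightarrow> nat \<Rightarrow> nat \<Rightarrow> real \<Rightarrow> (nat \<Rightarrow> nat \<Rightarrow> real) \<Rightarrow> tape \<Rightarrow> state" where
  "init_state n p s \<Delta> X \<omega> =
     ((\<lambda>a k. if a = 0 \<and> k = 0 then n else if a = 0 \<and> k = 1 then p
             else if a = 0 \<and> k = 2 then s else 0),
      (\<lambda>a k. if a = 0 \<and> k < n * p then X (k div p) (k mod p)
             else if a = 1 \<and> k = 0 then \<Delta> else 0),
      \<omega>)"

text \<open>The output is read from natural number array 1 of the final state.\<close>

definition out_cell ::
    "com \<Rightarrow> nat \<Rightarrow> nat \<Rightarrow> nat \<Rightarrow> real \<Rightarrow> (nat \<Rightarrow> nat \<Rightarrow> real) \<Rightarrow> tape \<Rightarrow> nat \<Rightarrow> nat" where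
  "out_cell c n p s \<Delta> X \<omega> k =
     fst (THE \<sigma>. \<exists>t. exec c (init_state n p s \<Delta> X \<omega>) t \<sigma>) 1 k"

definition label_output ::
    "com \<Rightarrow> nat \<Rightarrow> nat \<Rightarrow> nat \<Rightarrow> real \<Rightarrow> (nat \<Rightarrow> nat \<Rightarrow> real) \<Rightarrow> tape \<Rightarrow> nat \<Rightarrow> real" where
  "label_output c n p s \<Delta> X \<omega> i = (if out_cell c n p s \<Delta> X \<omega> i = 0 then -1 else 1)"

definition test_output ::
    "com \<Rightarrow> nat \<Rightarrow> nat \<Rightarrow> nat \<Rightarrow> real \<Rightarrow> (nat \<Rightarrow> nat \<Rightarrow> real) \<Rightarrow> tape \<Rightarrow> real" where
  "test_output c n p s \<Delta> X \<omega> = (if out_cell c n p s \<Delta> X \<omega> 0 = 0 then 0 else 1)"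

text \<open>
  Running time \<open>O(r_n)\<close> along parameter sequences \<open>p\<close>, \<open>s\<close>, \<open>\<Delta>\<close>, in the worst case over the data
  and the random tape.
\<close>

definition has_runtime ::
    "com \<Rightarrow> (nat \<Rightarrow> nat) \<Rightarrow> (nat \<Rightarrow> nat) \<Rightarrow> (nat \<Rightarrow> real) \<Rightarrow> (nat \<Rightarrow> real) \<Rightarrow> bool" where
  "has_runtime c p s \<Delta> r \<longleftrightarrow>
     (\<exists>T :: nat \<Rightarrow> nat.
        (\<forall>n\<ge>1. \<forall>X \<omega>. \<exists>t\<le>T n. \<exists>\<sigma>. exec c (init_state n (p n) (s n) (\<Delta> n) X \<omega>) t \<sigma>) \<and>
        (\<lambda>n. real (T n)) \<in> O(r))"

text \<open>
  Joint law of the data and the independent internal randomness. Probabilities and expectations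
  under it are taken in \<open>ennreal\<close>, where the supremum of the empty set is 0.
\<close>

definition joint_law ::
    "nat \<Rightarrow> nat \<Rightarrow> (nat \<Rightarrow> real) \<Rightarrow> (nat \<Rightarrow> real) \<Rightarrow> ((nat \<Rightarrow> nat \<Rightarrow> real) \<times> tape) measure" where
  "joint_law n p \<theta> z = cluster_model n p \<theta> z \<Otimes>\<^sub>M randomness"

end

theory Submission
  imports Defs
begin

text \<open>
  A clustering algorithm turns into a test by sample splitting. With fresh Gaussian noise \<open>W\<close>, and
  with \<open>a = 1 / sqrt (1 + \<epsilon>\<^sup>2)\<close> and \<open>b = \<epsilon> / sqrt (1 + \<epsilon>\<^sup>2)\<close>, the data sets \<open>a X + b W\<close> and
  \<open>b X - a W\<close> are independent and follow the model with centres \<open>a \<theta>\<close> and \<open>b \<theta>\<close>, because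
  \<open>(a, b; b, -a)\<close> is orthogonal and the Gaussian distribution is invariant under orthogonal maps
  (\<open>distr_gaussian_orthogonal\<close>, \<open>nn_integral_sample_split\<close>). As \<open>a \<ge> 1 - \<epsilon>\<^sup>2\<close>, the algorithm finds labels
  \<open>\<eta>\<close> in the first half that are accurate with probability at least \<open>1 - \<alpha>\<close>. They are independent of
  the second half \<open>Y\<close>, and the averages \<open>U\<^sub>j = (\<Sum>i. \<eta> i * Y i j) / sqrt n\<close> are independent Gaussian
  variables of variance 1. Their means vanish for \<open>\<theta> = 0\<close>. For accurate labels the vector of means
  is sparse, and the lower bound on \<open>\<Delta>\<close> makes its squared length at least \<open>24 T\<close>
  for \<open>T = s ln (e p / s)\<close>.

  To tell the two cases apart in time \<open>O(p n)\<close>, the test compares the product over \<open>j\<close> of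
  \<open>1 + s / (e p) * exp (U\<^sub>j\<^sup>2 / 4)\<close> with \<open>exp (2 T)\<close>. Under the null hypothesis the product has
  expectation at most \<open>exp T\<close> (\<open>type_I_error\<close>). Under the alternative it is at least
  \<open>exp (V\<^sup>2 / 4 - T)\<close>, where \<open>V\<close> is the projection of \<open>U\<close> on the direction of its mean, and
  \<open>V\<^sup>2 > 12 T\<close> up to probability \<open>exp (- T)\<close> (\<open>type_II_error\<close>). Both errors together are at most
  \<open>2 exp (- T) \<le> s / p\<close> when \<open>s < p\<close>; otherwise \<open>s / p \<ge> 1\<close> and the test may always reject.

  On the side of computation, the program of the algorithm runs as a subroutine whose input has been
  overwritten by the first half of the data. It can neither see nor change arrays that it does not
  name, and these hold the data of the test (\<open>exec_graft\<close>, \<open>runs_test_com\<close>). Since a program with a time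
  bound is a composition of measurable steps (\<open>measurable_out_cell\<close>), the probabilities are those of
  measurable events.
\<close>

section \<open>Confining a program to part of the memory\<close>

text \<open>
  The arrays that a program can name all lie below a bound, which leaves the arrays above it free
  for a surrounding program to keep its own data across a call.
\<close>

primrec iexp_bound :: "iexp \<Rightarrow> nat" where
  "iexp_bound (IConst k) = 0"
| "iexp_bound (IRead a e) = max (Suc a) (iexp_bound e)"
| "iexp_bound (IAdd e f) = max (iexp_bound e) (iexp_bound f)"
| "iexp_bound (ISub e f) = max (iexp_bound e) (iexp_bound f)"
| "iexp_bound (IMul e f) = max (iexp_bound e) (iexp_bound f)"

primrec rexp_bound :: "rexp \<Rightarrow> nat" where
  "rexp_bound (RConst x) = 0"
| "rexp_bound (ROf e) = iexp_bound e"
| "rexp_bound (RRead a e) = max (Suc a) (iexp_bound e)"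
| "rexp_bound (RAdd e f) = max (rexp_bound e) (rexp_bound f)"
| "rexp_bound (RSub e f) = max (rexp_bound e) (rexp_bound f)"
| "rexp_bound (RMul e f) = max (rexp_bound e) (rexp_bound f)"
| "rexp_bound (RDiv e f) = max (rexp_bound e) (rexp_bound f)"
| "rexp_bound (RSqrt e) = rexp_bound e"
| "rexp_bound (RExp e) = rexp_bound e"
| "rexp_bound (RLn e) = rexp_bound e"

primrec bexp_bound :: "bexp \<Rightarrow> nat" where
  "bexp_bound (ILess e f) = max (iexp_bound e) (iexp_bound f)"
| "bexp_bound (RLess e f) = max (rexp_bound e) (rexp_bound f)"
| "bexp_bound (Not b) = bexp_bound b"
| "bexp_bound (And b c) = max (bexp_bound b) (bexp_bound c)"

primrec com_bound :: "com \<Rightarrow> nat" where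
  "com_bound Skip = 0"
| "com_bound (IAssign a e f) = max (Suc a) (max (iexp_bound e) (iexp_bound f))"
| "com_bound (RAssign a e f) = max (Suc a) (max (iexp_bound e) (rexp_bound f))"
| "com_bound (DrawGauss a e) = max (Suc a) (iexp_bound e)"
| "com_bound (DrawUnif a e) = max (Suc a) (iexp_bound e)"
| "com_bound (Seq c d) = max (com_bound c) (com_bound d)"
| "com_bound (If b c d) = max (bexp_bound b) (max (com_bound c) (com_bound d))"
| "com_bound (While b c) = max (bexp_bound b) (com_bound c)"

definition graft :: "nat \<Rightarrow> (nat \<Rightarrow> 'a) \<Rightarrow> (nat \<Rightarrow> 'a) \<Rightarrow> nat \<Rightarrow> 'a" where
  "graft N m m' a = (if a < N then m a else m' a)"

definition graft_state :: "nat \<Rightarrow> imem \<Rightarrow> rmem \<Rightarrow> state \<Rightarrow> state" where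
  "graft_state N m' v' = (\<lambda>(m, v, \<omega>). (graft N m m', graft N v v', \<omega>))"

lemma ival_graft: "iexp_bound e \<le> N \<Longrightarrow> ival e (graft N m m') = ival e m"
  by (induction e) (auto simp: graft_def)

lemma rval_graft:
  "rexp_bound e \<le> N \<Longrightarrow> rval e (graft N m m') (graft N v v') = rval e m v"
  by (induction e) (auto simp: graft_def ival_graft)

lemma bval_graft:
  "bexp_bound b \<le> N \<Longrightarrow> bval b (graft N m m') (graft N v v') = bval b m v"
  by (induction b) (auto simp: ival_graft rval_graft)

lemma graft_store: "a < N \<Longrightarrow> graft N (store m a k x) m' = store (graft N m m') a k x"
  by (auto simp: graft_def store_def fun_eq_iff)

text \<open>
  No address of the program reaches the arrays above the bound, so replacing their contents commutes
  with every step. A program called from another one therefore runs as if it were alone.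
\<close>

lemma exec_graft:
  assumes "exec c \<sigma> t \<sigma>'" "com_bound c \<le> N"
  shows "exec c (graft_state N m' v' \<sigma>) t (graft_state N m' v' \<sigma>')"
  using assms
proof (induction rule: exec.induct)
  case (Skip \<sigma>)
  show ?case by (rule exec.Skip)
next
  case (IAssign a e f m v \<omega>)
  then show ?case
    using exec.IAssign[of a e f "graft N m m'" "graft N v v'" \<omega>]
    by (simp add: graft_state_def ival_graft graft_store)
next
  case (RAssign a e f m v \<omega>)
  then show ?case
    using exec.RAssign[of a e f "graft N m m'" "graft N v v'" \<omega>]
    by (simp add: graft_state_def ival_graft rval_graft graft_store)
next
  case (DrawGauss a e m v g u)
  then show ?case
    using exec.DrawGauss[of a e "graft N m m'" "graft N v v'" g u]
    by (simp add: graft_state_def ival_graft graft_store)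
next
  case (DrawUnif a e m v g u)
  then show ?case
    using exec.DrawUnif[of a e "graft N m m'" "graft N v v'" g u]
    by (simp add: graft_state_def ival_graft graft_store)
next
  case (Seq c \<sigma> t \<sigma>' d t' \<sigma>'')
  then show ?case by (auto intro: exec.Seq)
next
  case (IfTrue b m v c \<omega> t \<sigma>' d)
  then show ?case by (auto simp: graft_state_def bval_graft intro!: exec.IfTrue)
next
  case (IfFalse b m v d \<omega> t \<sigma>' c)
  then show ?case by (auto simp: graft_state_def bval_graft intro!: exec.IfFalse)
next
  case (WhileFalse b m v c \<omega>)
  then show ?case
    using exec.WhileFalse[of b "graft N m m'" "graft N v v'" c \<omega>]
    by (simp add: graft_state_def bval_graft)
next
  case (WhileTrue b m v c \<omega> t \<sigma>' t' \<sigma>'')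
  then show ?case
    unfolding graft_state_def prod.case
    by (intro exec.WhileTrue) (auto simp: bval_graft)
qed

section \<open>Outputs of terminating programs are measurable\<close>

text \<open>
  A set that is not measurable has \<open>emeasure\<close> 0, so the hypothesis on the error probability of the
  clustering algorithm carries information only because its labels depend measurably on the data
  and the random tape.

  Running every loop for a fixed number of rounds turns a program into a total function of its
  initial state, built from measurable pieces by composition and case distinction. Rounds
  after the loop condition has failed change nothing, so on runs of bounded length this function
  is the semantics.
\<close>

primrec unroll :: "nat \<Rightarrow> com \<Rightarrow> state \<Rightarrow> state" where
  "unroll k Skip = (\<lambda>\<sigma>. \<sigma>)"
| "unroll k (IAssign a e f) = (\<lambda>(m, v, \<omega>). (store m a (ival e m) (ival f m), v, \<omega>))"
| "unroll k (RAssign a e f) = (\<lambda>(m, v, \<omega>). (m, store v a (ival e m) (rval f m v), \<omega>))"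
| "unroll k (DrawGauss a e) = (\<lambda>(m, v, g, u). (m, store v a (ival e m) (shd g), stl g, u))"
| "unroll k (DrawUnif a e) = (\<lambda>(m, v, g, u). (m, store v a (ival e m) (shd u), g, stl u))"
| "unroll k (Seq c d) = unroll k d \<circ> unroll k c"
| "unroll k (If b c d) =
     (\<lambda>\<sigma>. if bval b (fst \<sigma>) (fst (snd \<sigma>)) then unroll k c \<sigma> else unroll k d \<sigma>)"
| "unroll k (While b c) =
     (\<lambda>\<sigma>. if bval b (fst \<sigma>) (fst (snd \<sigma>)) then unroll k c \<sigma> else \<sigma>) ^^ k"

lemma unroll_exec:
  assumes "exec c \<sigma> t \<sigma>'" "t \<le> k"
  shows "unroll k c \<sigma> = \<sigma>'"
proof -
  \<comment> \<open>The number of rounds of the outermost loop has to vary independently of the number of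
    rounds within its body, since each round uses up one of the former only.\<close>
  define round where
    "round b d = (\<lambda>\<sigma>. if bval b (fst \<sigma>) (fst (snd \<sigma>)) then unroll k d \<sigma> else \<sigma>)" for b d
  have "unroll k c \<sigma> = \<sigma>' \<and> (\<forall>b d j. c = While b d \<longrightarrow> t \<le> j \<longrightarrow> (round b d ^^ j) \<sigma> = \<sigma>')"
    using assms
  proof (induction rule: exec.induct)
    case (WhileFalse b m v c \<omega>)
    then have "round b c (m, v, \<omega>) = (m, v, \<omega>)"
      by (simp add: round_def)
    then have "(round b c ^^ j) (m, v, \<omega>) = (m, v, \<omega>)" for j
      by (induction j) auto
    then show ?case by (simp add: round_def)
  next
    case (WhileTrue b m v c \<omega> t \<sigma>' t' \<sigma>'')
    have "(round b c ^^ j) (m, v, \<omega>) = \<sigma>''" if j: "Suc (t + t') \<le> j" for j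
    proof -
      obtain i where i: "j = Suc i"
        using j by (cases j) auto
      have "round b c (m, v, \<omega>) = \<sigma>'"
        using WhileTrue by (simp add: round_def)
      moreover have "(round b c ^^ i) \<sigma>' = \<sigma>''"
        using WhileTrue i j by simp
      ultimately show ?thesis
        unfolding i funpow_Suc_right by simp
    qed
    then show ?case
      using WhileTrue.prems by (simp add: round_def)
  qed auto
  then show ?thesis by simp
qed

definition imem_space :: "imem measure" where
  "imem_space = PiM UNIV (\<lambda>_. PiM UNIV (\<lambda>_. count_space UNIV))"

definition rmem_space :: "rmem measure" where
  "rmem_space = PiM UNIV (\<lambda>_. PiM UNIV (\<lambda>_. borel))"

definition tape_space :: "tape measure" where
  "tape_space = stream_space borel \<Otimes>\<^sub>M stream_space borel"

definition state_space :: "state measure" where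
  "state_space = imem_space \<Otimes>\<^sub>M rmem_space \<Otimes>\<^sub>M tape_space"

lemma measurable_imem_cell:
  "(\<lambda>m. m a k) \<in> measurable imem_space (count_space UNIV)"
  unfolding imem_space_def
  using measurable_compose[OF measurable_component_singleton[of a UNIV "\<lambda>_. PiM UNIV (\<lambda>_. count_space UNIV)"]
      measurable_component_singleton[of k UNIV]] by simp

lemma measurable_rmem_cell:
  "(\<lambda>v. v a k) \<in> measurable rmem_space borel"
  unfolding rmem_space_def
  using measurable_compose[OF measurable_component_singleton[of a UNIV "\<lambda>_. PiM UNIV (\<lambda>_. borel)"]
      measurable_component_singleton[of k UNIV]] by simp

lemma measurable_imemI:
  assumes "\<And>a k. (\<lambda>w. f w a k) \<in> measurable M (count_space UNIV)"
  shows "f \<in> measurable M imem_space"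
  unfolding imem_space_def
  by (rule measurable_PiM_single', rule measurable_PiM_single')
     (auto simp: space_PiM assms)

lemma measurable_rmemI:
  assumes "\<And>a k. (\<lambda>w. f w a k) \<in> measurable M borel"
  shows "f \<in> measurable M rmem_space"
  unfolding rmem_space_def
  by (rule measurable_PiM_single', rule measurable_PiM_single')
     (auto simp: space_PiM assms)

lemma measurable_ival: "ival e \<in> measurable imem_space (count_space UNIV)"
proof (induction e)
  case (IRead a e)
  \<comment> \<open>Indirect addressing is harmless because an address takes countably many values.\<close>
  have "(\<lambda>m. (\<lambda>k m. m a k) (ival e m) m) \<in> measurable imem_space (count_space UNIV)"
    by (rule measurable_compose_countable[OF measurable_imem_cell IRead])
  then show ?case by simp
next
  case (IConst k)
  show ?case by (simp add: ival.simps[abs_def])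
next
  case (IAdd e f)
  note [measurable] = IAdd
  have "(\<lambda>m. ival e m + ival f m) \<in> measurable imem_space (count_space UNIV)" by measurable
  then show ?case by (simp add: ival.simps[abs_def])
next
  case (ISub e f)
  note [measurable] = ISub
  have "(\<lambda>m. ival e m - ival f m) \<in> measurable imem_space (count_space UNIV)" by measurable
  then show ?case by (simp add: ival.simps[abs_def])
next
  case (IMul e f)
  note [measurable] = IMul
  have "(\<lambda>m. ival e m * ival f m) \<in> measurable imem_space (count_space UNIV)" by measurable
  then show ?case by (simp add: ival.simps[abs_def])
qed

lemma measurable_rval:
  "(\<lambda>x. rval e (fst x) (snd x)) \<in> borel_measurable (imem_space \<Otimes>\<^sub>M rmem_space)"
proof (induction e)
  case (RRead a e)
  note [measurable] = measurable_ival[of e]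
  have "(\<lambda>x. (\<lambda>k x. snd x a k) (ival e (fst x)) x)
      \<in> borel_measurable (imem_space \<Otimes>\<^sub>M rmem_space)"
    by (rule measurable_compose_countable, rule measurable_compose[OF measurable_snd measurable_rmem_cell])
       measurable
  then show ?case by simp
next
  case (ROf e)
  note [measurable] = measurable_ival[of e]
  show ?case unfolding rval.simps by measurable
qed simp_all

lemma measurable_bval:
  "Measurable.pred (imem_space \<Otimes>\<^sub>M rmem_space) (\<lambda>x. bval b (fst x) (snd x))"
proof (induction b)
  case (ILess e f)
  note [measurable] = measurable_ival[of e] measurable_ival[of f]
  have "Measurable.pred (imem_space \<Otimes>\<^sub>M rmem_space)
      (\<lambda>x. real (ival e (fst x)) < real (ival f (fst x)))"
    by measurable
  then show ?case by simp
next
  case (RLess e f)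
  note [measurable] = measurable_rval[of e] measurable_rval[of f]
  show ?case by simp
qed simp_all

lemma measurable_istore:
  assumes [measurable]: "f \<in> measurable M imem_space" "e \<in> measurable M (count_space UNIV)"
    "x \<in> measurable M (count_space UNIV)"
  shows "(\<lambda>w. store (f w) a (e w) (x w)) \<in> measurable M imem_space"
proof (rule measurable_imemI)
  fix b k
  have [measurable]: "(\<lambda>w. f w b k) \<in> measurable M (count_space UNIV)"
    by (rule measurable_compose[OF assms(1)]) (rule measurable_imem_cell)
  have "(\<lambda>w. if b = a \<and> k = e w then x w else f w b k) \<in> measurable M (count_space UNIV)"
    by measurable
  also have "(\<lambda>w. if b = a \<and> k = e w then x w else f w b k) = (\<lambda>w. store (f w) a (e w) (x w) b k)"
    by (auto simp: store_def fun_eq_iff)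
  finally show "(\<lambda>w. store (f w) a (e w) (x w) b k) \<in> measurable M (count_space UNIV)" .
qed

lemma measurable_rstore:
  assumes [measurable]: "f \<in> measurable M rmem_space" "e \<in> measurable M (count_space UNIV)"
    "x \<in> borel_measurable M"
  shows "(\<lambda>w. store (f w) a (e w) (x w)) \<in> measurable M rmem_space"
proof (rule measurable_rmemI)
  fix b k
  have [measurable]: "(\<lambda>w. f w b k) \<in> borel_measurable M"
    by (rule measurable_compose[OF assms(1)]) (rule measurable_rmem_cell)
  have "(\<lambda>w. if b = a \<and> k = e w then x w else f w b k) \<in> borel_measurable M"
    by measurable
  also have "(\<lambda>w. if b = a \<and> k = e w then x w else f w b k) = (\<lambda>w. store (f w) a (e w) (x w) b k)"
    by (auto simp: store_def fun_eq_iff)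
  finally show "(\<lambda>w. store (f w) a (e w) (x w) b k) \<in> borel_measurable M" .
qed

lemma measurable_unroll: "unroll k c \<in> measurable state_space state_space"
proof (induction c)
  case Skip
  show ?case by simp
next
  case (IAssign a e f)
  note [measurable] = measurable_ival[of e] measurable_ival[of f]
  show ?case
    unfolding unroll.simps state_space_def split_beta'
    by (intro measurable_Pair measurable_istore) measurable
next
  case (RAssign a e f)
  note [measurable] = measurable_ival[of e]
  have [measurable]: "(\<lambda>x. rval f (fst x) (fst (snd x)))
      \<in> borel_measurable (imem_space \<Otimes>\<^sub>M rmem_space \<Otimes>\<^sub>M tape_space)"
    by (rule measurable_compose[where f = "\<lambda>x. (fst x, fst (snd x))", OF _ measurable_rval, simplified])
       measurable
  show ?case
    unfolding unroll.simps state_space_def split_beta'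
    by (intro measurable_Pair measurable_rstore) measurable
next
  case (DrawGauss a e)
  note [measurable] = measurable_ival[of e]
  show ?case
    unfolding unroll.simps state_space_def tape_space_def split_beta'
    by (intro measurable_Pair measurable_rstore) measurable
next
  case (DrawUnif a e)
  note [measurable] = measurable_ival[of e]
  show ?case
    unfolding unroll.simps state_space_def tape_space_def split_beta'
    by (intro measurable_Pair measurable_rstore) measurable
next
  case (Seq c d)
  then show ?case by (auto intro: measurable_comp)
next
  case (If b c d)
  note [measurable] = If
  have [measurable]: "Measurable.pred state_space (\<lambda>x. bval b (fst x) (fst (snd x)))"
    unfolding state_space_def
    by (rule measurable_compose[where f = "\<lambda>x. (fst x, fst (snd x))", OF _ measurable_bval, simplified])
       measurable
  show ?case by simp
next
  case (While b c)
  note [measurable] = While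
  have [measurable]: "Measurable.pred state_space (\<lambda>x. bval b (fst x) (fst (snd x)))"
    unfolding state_space_def
    by (rule measurable_compose[where f = "\<lambda>x. (fst x, fst (snd x))", OF _ measurable_bval, simplified])
       measurable
  have "(\<lambda>\<sigma>. if bval b (fst \<sigma>) (fst (snd \<sigma>)) then unroll k c \<sigma> else \<sigma>)
      \<in> measurable state_space state_space"
    by measurable
  then show ?case
    unfolding unroll.simps by (rule measurable_compose_n)
qed

definition data_space :: "nat \<Rightarrow> nat \<Rightarrow> (nat \<Rightarrow> nat \<Rightarrow> real) measure" where
  "data_space n p = PiM {..<n} (\<lambda>_. PiM {..<p} (\<lambda>_. borel))"

lemma measurable_data_entry:
  "i < n \<Longrightarrow> j < p \<Longrightarrow> (\<lambda>X. X i j) \<in> borel_measurable (data_space n p)"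
  unfolding data_space_def
  using measurable_compose[OF measurable_component_singleton[of i "{..<n}" "\<lambda>_. PiM {..<p} (\<lambda>_. borel)"]
      measurable_component_singleton[of j "{..<p}"]] by simp

lemma measurable_init_state:
  "(\<lambda>(X, \<omega>). init_state n p s \<Delta> X \<omega>) \<in> measurable (data_space n p \<Otimes>\<^sub>M tape_space) state_space"
proof -
  have [measurable]:
    "(\<lambda>x. (\<lambda>a k. if a = 0 \<and> k < n * p then fst x (k div p) (k mod p)
             else if a = 1 \<and> k = 0 then \<Delta> else 0))
      \<in> measurable (data_space n p \<Otimes>\<^sub>M tape_space) rmem_space"
  proof (rule measurable_rmemI)
    fix a k :: nat
    show "(\<lambda>x. if a = 0 \<and> k < n * p then fst x (k div p) (k mod p)
             else if a = 1 \<and> k = 0 then \<Delta> else 0)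
      \<in> borel_measurable (data_space n p \<Otimes>\<^sub>M tape_space)"
    proof (cases "a = 0 \<and> k < n * p")
      case True
      then have "k div p < n" "k mod p < p"
        by (auto simp: less_mult_imp_div_less intro!: mod_less_divisor Nat.gr0I)
      then show ?thesis
        using True by (simp add: measurable_compose[OF measurable_fst measurable_data_entry])
    qed auto
  qed
  show ?thesis
    unfolding init_state_def state_space_def split_beta' by measurable (auto simp: imem_space_def space_PiM)
qed

lemma out_cell_exec:
  assumes "exec c (init_state n p s \<Delta> X \<omega>) t \<sigma>"
  shows "out_cell c n p s \<Delta> X \<omega> k = fst \<sigma> 1 k"
proof -
  have "(THE \<sigma>. \<exists>t. exec c (init_state n p s \<Delta> X \<omega>) t \<sigma>) = \<sigma>"
    using assms exec_deterministic[OF assms] by (intro the_equality) blast+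
  then show ?thesis by (simp add: out_cell_def)
qed

lemma measurable_out_cell:
  assumes "\<And>X \<omega>. \<exists>t\<le>T. \<exists>\<sigma>. exec c (init_state n p s \<Delta> X \<omega>) t \<sigma>"
  shows "(\<lambda>(X, \<omega>). out_cell c n p s \<Delta> X \<omega> k)
    \<in> measurable (data_space n p \<Otimes>\<^sub>M tape_space) (count_space UNIV)"
proof -
  have eq: "out_cell c n p s \<Delta> X \<omega> k = fst (unroll T c (init_state n p s \<Delta> X \<omega>)) 1 k" for X \<omega>
    using assms[of X \<omega>] unroll_exec out_cell_exec by metis
  note [measurable] = measurable_unroll measurable_init_state
  have [measurable]: "(\<lambda>\<sigma>. fst \<sigma> 1 k) \<in> measurable state_space (count_space UNIV)"
    unfolding state_space_def by (rule measurable_compose[OF measurable_fst measurable_imem_cell])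
  have "(\<lambda>x. fst (unroll T c ((\<lambda>(X, \<omega>). init_state n p s \<Delta> X \<omega>) x)) 1 k)
      \<in> measurable (data_space n p \<Otimes>\<^sub>M tape_space) (count_space UNIV)"
    by measurable
  then show ?thesis by (simp add: eq split_beta')
qed

section \<open>The test as a program\<close>

definition runs :: "com \<Rightarrow> state \<Rightarrow> nat \<Rightarrow> (state \<Rightarrow> bool) \<Rightarrow> bool" where
  "runs c \<sigma> T Q \<longleftrightarrow> (\<exists>t\<le>T. \<exists>\<sigma>'. exec c \<sigma> t \<sigma>' \<and> Q \<sigma>')"

lemma runs_mono: "runs c \<sigma> T P \<Longrightarrow> T \<le> T' \<Longrightarrow> (\<And>\<sigma>. P \<sigma> \<Longrightarrow> Q \<sigma>) \<Longrightarrow> runs c \<sigma> T' Q"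
  unfolding runs_def by (meson order_trans)

lemma runs_Seq:
  assumes "runs c \<sigma> T P" "\<And>\<sigma>'. P \<sigma>' \<Longrightarrow> runs d \<sigma>' T' Q"
  shows "runs (Seq c d) \<sigma> (T + T') Q"
proof -
  obtain t \<sigma>' where 1: "t \<le> T" "exec c \<sigma> t \<sigma>'" "P \<sigma>'"
    using assms(1) by (auto simp: runs_def)
  obtain t' \<sigma>'' where 2: "t' \<le> T'" "exec d \<sigma>' t' \<sigma>''" "Q \<sigma>''"
    using assms(2)[OF 1(3)] by (auto simp: runs_def)
  have "exec (Seq c d) \<sigma> (t + t') \<sigma>''"
    using 1 2 by (intro exec.Seq)
  then show ?thesis
    using 1 2 unfolding runs_def by (meson add_mono)
qed

lemma runs_IAssign:
  "Q (store m a (ival e m) (ival f m), v, \<omega>) \<Longrightarrow> runs (IAssign a e f) (m, v, \<omega>) (Suc 0) Q"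
  unfolding runs_def using exec.IAssign[of a e f m v \<omega>, unfolded One_nat_def] by blast

lemma runs_RAssign:
  "Q (m, store v a (ival e m) (rval f m v), \<omega>) \<Longrightarrow> runs (RAssign a e f) (m, v, \<omega>) (Suc 0) Q"
  unfolding runs_def using exec.RAssign[of a e f m v \<omega>, unfolded One_nat_def] by blast

lemma runs_DrawGauss:
  "Q (m, store v a (ival e m) (shd g), stl g, u) \<Longrightarrow> runs (DrawGauss a e) (m, v, g, u) (Suc 0) Q"
  unfolding runs_def using exec.DrawGauss[of a e m v g u, unfolded One_nat_def] by blast

lemma runs_Seq_IAssign:
  "runs d (store m a (ival e m) (ival f m), v, \<omega>) T Q \<Longrightarrow>
    runs (Seq (IAssign a e f) d) (m, v, \<omega>) (Suc T) Q"
  using runs_Seq[OF runs_IAssign, of "\<lambda>\<sigma>. \<sigma> = (store m a (ival e m) (ival f m), v, \<omega>)" m a e f v \<omega> d T Q]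
  by simp

lemma runs_Seq_RAssign:
  "runs d (m, store v a (ival e m) (rval f m v), \<omega>) T Q \<Longrightarrow>
    runs (Seq (RAssign a e f) d) (m, v, \<omega>) (Suc T) Q"
  using runs_Seq[OF runs_RAssign, of "\<lambda>\<sigma>. \<sigma> = (m, store v a (ival e m) (rval f m v), \<omega>)" m v a e f \<omega> d T Q]
  by simp

lemma runs_Seq_DrawGauss:
  "runs d (m, store v a (ival e m) (shd g), stl g, u) T Q \<Longrightarrow>
    runs (Seq (DrawGauss a e) d) (m, v, g, u) (Suc T) Q"
  using runs_Seq[OF runs_DrawGauss, of "\<lambda>\<sigma>. \<sigma> = (m, store v a (ival e m) (shd g), stl g, u)" m v a e g u d T Q]
  by simp

lemma runs_If:
  assumes "bval b m v \<Longrightarrow> runs c (m, v, \<omega>) T Q" "\<not> bval b m v \<Longrightarrow> runs d (m, v, \<omega>) T Q"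
  shows "runs (If b c d) (m, v, \<omega>) (Suc T) Q"
proof (cases "bval b m v")
  case True
  then obtain t \<sigma>' where "t \<le> T" "exec c (m, v, \<omega>) t \<sigma>'" "Q \<sigma>'"
    using assms(1) by (auto simp: runs_def)
  then show ?thesis
    unfolding runs_def
    by (intro exI[of _ "Suc t"] exI[of _ \<sigma>'] conjI exec.IfTrue[OF True]) simp_all
next
  case False
  then obtain t \<sigma>' where "t \<le> T" "exec d (m, v, \<omega>) t \<sigma>'" "Q \<sigma>'"
    using assms(2) by (auto simp: runs_def)
  then show ?thesis
    unfolding runs_def
    by (intro exI[of _ "Suc t"] exI[of _ \<sigma>'] conjI exec.IfFalse[OF False]) simp_all
qed

lemma store_apply: "store m a k x c l = (if c = a \<and> l = k then x else m c l)"
  by (simp add: store_def)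

lemma store_other: "c \<noteq> a \<Longrightarrow> store m a k x c = m c"
  by (simp add: store_def)

lemma runs_for:
  assumes step: "\<And>k m v \<omega>. k < M \<Longrightarrow> Inv k (m, v, \<omega>) \<Longrightarrow>
      bval b m v \<and> runs c (m, v, \<omega>) T (Inv (Suc k))"
    and exit: "\<And>m v \<omega>. Inv M (m, v, \<omega>) \<Longrightarrow> \<not> bval b m v"
    and init: "Inv 0 \<sigma>"
  shows "runs (While b c) \<sigma> (M * Suc T + 1) (Inv M)"
proof -
  have "runs (While b c) \<sigma> (d * Suc T + 1) (Inv M)" if "Inv k \<sigma>" "k + d = M" for k d \<sigma>
    using that
  proof (induction d arbitrary: k \<sigma>)
    case 0
    obtain m v \<omega> where \<sigma>: "\<sigma> = (m, v, \<omega>)" by (cases \<sigma>)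
    then have "\<not> bval b m v"
      using 0 exit by simp
    then show ?case
      unfolding runs_def \<sigma> using 0 \<sigma>
      by (intro exI[of _ 1] exI[of _ "(m, v, \<omega>)"] conjI exec.WhileFalse) simp_all
  next
    case (Suc d)
    obtain m v \<omega> where \<sigma>: "\<sigma> = (m, v, \<omega>)" by (cases \<sigma>)
    with step[of k m v \<omega>] Suc.prems have b: "bval b m v"
      and body: "runs c (m, v, \<omega>) T (Inv (Suc k))" by auto
    obtain t \<sigma>' where t: "t \<le> T" "exec c (m, v, \<omega>) t \<sigma>'" "Inv (Suc k) \<sigma>'"
      using body by (auto simp: runs_def)
    have "Suc k + d = M"
      using Suc.prems by simp
    then obtain t' \<sigma>'' where t': "t' \<le> d * Suc T + 1" "exec (While b c) \<sigma>' t' \<sigma>''" "Inv M \<sigma>''"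
      using Suc.IH[OF t(3)] by (auto simp: runs_def)
    have "Suc (t + t') \<le> Suc d * Suc T + 1"
      using t(1) t'(1) by simp
    then show ?case
      unfolding runs_def \<sigma>
      by (intro exI[of _ "Suc (t + t')"] exI[of _ \<sigma>''] conjI exec.WhileTrue[OF b t(2) t'(2)] t'(3))
  qed
  from this[of 0 \<sigma> M] init show ?thesis by simp
qed

text \<open>
  All arrays from \<open>N\<close> on belong to the test: natural number array \<open>N\<close> holds copies of
  \<open>n\<close>, \<open>p\<close>, \<open>s\<close> and two counters, real array \<open>N\<close> the second half of the split data, and real
  array \<open>N + 1\<close> an auxiliary scalar followed by the value of the test statistic. The first half
  of the split data overwrites the input, as this is where the clustering algorithm expects it.
\<close>

abbreviation (input) int_reg :: "nat \<Rightarrow> nat \<Rightarrow> iexp" where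
  "int_reg N k \<equiv> IRead N (IConst k)"

abbreviation (input) real_reg :: "nat \<Rightarrow> nat \<Rightarrow> rexp" where
  "real_reg N k \<equiv> RRead (Suc N) (IConst k)"

definition split_step :: "nat \<Rightarrow> real \<Rightarrow> real \<Rightarrow> com" where
  "split_step N a b =
     Seq (DrawGauss (Suc N) (IConst 0))
      (Seq (RAssign N (int_reg N 3)
             (RSub (RMul (RConst b) (RRead 0 (int_reg N 3))) (RMul (RConst a) (real_reg N 0))))
      (Seq (RAssign 0 (int_reg N 3)
             (RAdd (RMul (RConst a) (RRead 0 (int_reg N 3))) (RMul (RConst b) (real_reg N 0))))
           (IAssign N (IConst 3) (IAdd (int_reg N 3) (IConst 1)))))"

definition split_com :: "nat \<Rightarrow> real \<Rightarrow> real \<Rightarrow> com" where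
  "split_com N a b =
     Seq (IAssign N (IConst 0) (IRead 0 (IConst 0)))
    (Seq (IAssign N (IConst 1) (IRead 0 (IConst 1)))
    (Seq (IAssign N (IConst 2) (IRead 0 (IConst 2)))
    (Seq (IAssign N (IConst 3) (IConst 0))
    (While (ILess (int_reg N 3) (IMul (int_reg N 0) (int_reg N 1)))
      (split_step N a b)))))"

text \<open>
  Truncated subtraction turns a label cell \<open>k\<close> into \<open>1 - (1 - k)\<close>, which is 0 for \<open>k = 0\<close> and 1
  otherwise, so that no branching on the label is required.
\<close>

definition column_step :: "nat \<Rightarrow> com" where
  "column_step N =
     Seq (RAssign (Suc N) (IConst 0)
             (RAdd (real_reg N 0)
               (RMul
                 (RSub (RMul (RConst 2)
                         (ROf (ISub (IConst 1) (ISub (IConst 1) (IRead 1 (int_reg N 3))))))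
                       (RConst 1))
                 (RRead N (IAdd (IMul (int_reg N 3) (int_reg N 1)) (int_reg N 4))))))
           (IAssign N (IConst 3) (IAdd (int_reg N 3) (IConst 1)))"

definition column_com :: "nat \<Rightarrow> com" where
  "column_com N =
     While (ILess (int_reg N 3) (int_reg N 0))
      (column_step N)"

definition factor_step :: "nat \<Rightarrow> com" where
  "factor_step N =
     Seq (RAssign (Suc N) (IConst 1)
             (RMul (real_reg N 1)
               (RAdd (RConst 1)
                 (RMul (RDiv (ROf (int_reg N 2)) (RMul (RConst (exp 1)) (ROf (int_reg N 1))))
                   (RExp (RDiv (RMul (real_reg N 0) (real_reg N 0))
                               (RMul (RConst 4) (ROf (int_reg N 0)))))))))
           (IAssign N (IConst 4) (IAdd (int_reg N 4) (IConst 1)))"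

definition statistic_step :: "nat \<Rightarrow> com" where
  "statistic_step N =
     Seq (IAssign N (IConst 3) (IConst 0))
      (Seq (RAssign (Suc N) (IConst 0) (RConst 0))
      (Seq (column_com N)
      (factor_step N)))"

definition statistic_com :: "nat \<Rightarrow> com" where
  "statistic_com N =
     Seq (IAssign N (IConst 4) (IConst 0))
    (Seq (RAssign (Suc N) (IConst 1) (RConst 1))
    (While (ILess (int_reg N 4) (int_reg N 1))
      (statistic_step N)))"

definition decide_com :: "nat \<Rightarrow> com" where
  "decide_com N =
     If (And (ILess (int_reg N 2) (int_reg N 1))
             (Not (RLess
               (RExp (RMul (RConst 2)
                 (RMul (ROf (int_reg N 2))
                   (RLn (RDiv (RMul (RConst (exp 1)) (ROf (int_reg N 1))) (ROf (int_reg N 2)))))))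
               (real_reg N 1))))
        (IAssign 1 (IConst 0) (IConst 0))
        (IAssign 1 (IConst 0) (IConst 1))"

definition test_com :: "nat \<Rightarrow> real \<Rightarrow> real \<Rightarrow> com \<Rightarrow> com" where
  "test_com N a b zhat =
     Seq (split_com N a b) (Seq zhat (Seq (statistic_com N) (decide_com N)))"

text \<open>
  With \<open>U\<^sub>j = (\<Sum>i. \<eta> i * Y i j) / sqrt n\<close> the factor of coordinate \<open>j\<close> is
  \<open>1 + exp (U\<^sub>j\<^sup>2 / 4 - ln (e p / s))\<close>. Its logarithm is close to 0 while \<open>U\<^sub>j\<^sup>2\<close> is well below
  \<open>4 ln (e p / s)\<close> and close to \<open>U\<^sub>j\<^sup>2 / 4 - ln (e p / s)\<close> well above, so the logarithm of the product is
  a smooth form of the penalised sum of the large \<open>U\<^sub>j\<^sup>2\<close>. In contrast to the sum of the \<open>s\<close> largest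
  \<open>U\<^sub>j\<^sup>2\<close>, the product needs no sorting and factors under the expectation.
\<close>

definition mixture_statistic ::
    "nat \<Rightarrow> nat \<Rightarrow> nat \<Rightarrow> (nat \<Rightarrow> real) \<Rightarrow> (nat \<Rightarrow> nat \<Rightarrow> real) \<Rightarrow> real" where
  "mixture_statistic n p s \<eta> Y =
     (\<Prod>j<p. 1 + real s / (exp 1 * real p) * exp ((\<Sum>i<n. \<eta> i * Y i j)\<^sup>2 / (4 * real n)))"

text \<open>
  For \<open>p \<le> s\<close> the admissible error \<open>s / p\<close> is at least 1, and a test that always rejects has total
  error at most 1.
\<close>

definition rejects :: "nat \<Rightarrow> nat \<Rightarrow> nat \<Rightarrow> (nat \<Rightarrow> real) \<Rightarrow> (nat \<Rightarrow> nat \<Rightarrow> real) \<Rightarrow> bool" where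
  "rejects n p s \<eta> Y \<longleftrightarrow>
     p \<le> s \<or> exp (2 * (real s * ln (exp 1 * real p / real s))) < mixture_statistic n p s \<eta> Y"

definition label_of :: "nat \<Rightarrow> real" where
  "label_of k = (if k = 0 then -1 else 1)"

lemma runs_split_com:
  assumes "2 \<le> N"
  shows "runs (split_com N a b) (init_state n p s \<Delta> X (g, u)) (4 + (n * p * 5 + 1))
    (\<lambda>\<sigma>. \<exists>m v. \<sigma> = graft_state N m v
            (init_state n p s \<Delta> (\<lambda>i j. a * X i j + b * g !! (i * p + j)) (sdrop (n * p) g, u)) \<and>
          m N 0 = n \<and> m N 1 = p \<and> m N 2 = s \<and>
          (\<forall>l<n * p. v N l = b * X (l div p) (l mod p) - a * g !! l))"
proof -
  define Inv where "Inv k = (\<lambda>(m :: imem, v :: rmem, \<omega>).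
     m N 0 = n \<and> m N 1 = p \<and> m N 2 = s \<and> m N 3 = k \<and>
     (\<forall>c<N. \<forall>l. m c l = fst (init_state n p s \<Delta> X (g, u)) c l) \<and>
     (\<forall>c<N. \<forall>l. v c l =
        (if c = 0 \<and> l < k then a * X (l div p) (l mod p) + b * g !! l
         else fst (snd (init_state n p s \<Delta> X (g, u))) c l)) \<and>
     (\<forall>l<k. v N l = b * X (l div p) (l mod p) - a * g !! l) \<and> \<omega> = (sdrop k g, u))" for k
  have loop: "runs (While (ILess (int_reg N 3) (IMul (int_reg N 0) (int_reg N 1)))
      (split_step N a b)) \<sigma> (n * p * Suc 4 + 1) (Inv (n * p))"
    if "Inv 0 \<sigma>" for \<sigma>
  proof (rule runs_for[where Inv = Inv])
    fix k m v \<omega> assume k: "k < n * p" and inv: "Inv k (m, v, \<omega>)"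
    have \<omega>: "\<omega> = (sdrop k g, u)"
      and reg: "m N 3 = k" "m N 0 = n" "m N (Suc 0) = p" "m N 2 = s"
      and frame: "\<forall>c<N. \<forall>l. m c l = fst (init_state n p s \<Delta> X (g, u)) c l"
      and first: "\<forall>c<N. \<forall>l. v c l =
        (if c = 0 \<and> l < k then a * X (l div p) (l mod p) + b * g !! l
         else fst (snd (init_state n p s \<Delta> X (g, u))) c l)"
      and second: "\<forall>l<k. v N l = b * X (l div p) (l mod p) - a * g !! l"
      using inv by (simp_all add: Inv_def)
    have X: "v 0 k = X (k div p) (k mod p)"
      using inv k assms by (auto simp: Inv_def init_state_def)
    have four: "(4::nat) = Suc (Suc (Suc (Suc 0)))" by simp
    show "bval (ILess (int_reg N 3) (IMul (int_reg N 0) (int_reg N 1))) m v \<and>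
      runs (split_step N a b) (m, v, \<omega>) 4 (Inv (Suc k))"
      unfolding \<omega> four split_step_def
    proof (intro conjI runs_Seq_DrawGauss runs_Seq_RAssign runs_IAssign, goal_cases)
      case 1
      then show ?case using reg k by simp
    next
      case 2
      define w where "w = g !! k"
      define x where "x = X (k div p) (k mod p)"
      have "Inv (Suc k) (store m N 3 (Suc k),
        store (store (store v (Suc N) 0 w) N k (b * x - a * w)) 0 k (a * x + b * w), sdrop (Suc k) g, u)"
        unfolding Inv_def prod.case
      proof (intro conjI allI impI, goal_cases)
        case (5 c l)
        then show ?case using frame by (simp add: store_apply)
      next
        case (6 c l)
        then show ?case
          using first[rule_format, of c l]
          by (cases "c = 0 \<and> l < k") (auto simp: store_apply w_def x_def less_Suc_eq)
      next
        case (7 l)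
        then show ?case
          using second[rule_format, of l] assms
          by (cases "l = k") (simp_all add: store_apply w_def x_def less_Suc_eq)
      qed (use reg assms in \<open>simp_all add: store_apply\<close>)
      note inv' = this
      have vals: "shd (sdrop k g) = w" "stl (sdrop k g) = sdrop (Suc k) g" "v 0 k = x"
        by (simp_all add: w_def x_def X)
      show ?case
        using assms inv' by (simp add: reg store_apply vals del: sdrop.simps sdrop_simps)
    qed
  qed (use that in \<open>auto simp: Inv_def\<close>)
  have start: "runs (split_com N a b) (init_state n p s \<Delta> X (g, u))
     (Suc (Suc (Suc (Suc (n * p * Suc 4 + 1))))) (Inv (n * p))"
    unfolding split_com_def init_state_def
    by (intro runs_Seq_IAssign loop) (use assms in \<open>auto simp: Inv_def store_apply init_state_def\<close>)
  show ?thesis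
  proof (rule runs_mono[OF start])
    fix \<sigma> assume "Inv (n * p) \<sigma>"
    moreover obtain m v \<omega> where \<sigma>: "\<sigma> = (m, v, \<omega>)" by (cases \<sigma>)
    ultimately have inv: "Inv (n * p) (m, v, \<omega>)" by simp
    have "\<sigma> = graft_state N m v
            (init_state n p s \<Delta> (\<lambda>i j. a * X i j + b * g !! (i * p + j)) (sdrop (n * p) g, u))"
      using inv unfolding \<sigma> Inv_def
      by (auto simp: graft_state_def init_state_def graft_def fun_eq_iff)
    then show "\<exists>m v. \<sigma> = graft_state N m v
            (init_state n p s \<Delta> (\<lambda>i j. a * X i j + b * g !! (i * p + j)) (sdrop (n * p) g, u)) \<and>
          m N 0 = n \<and> m N 1 = p \<and> m N 2 = s \<and>
          (\<forall>l<n * p. v N l = b * X (l div p) (l mod p) - a * g !! l)"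
      using inv unfolding Inv_def by auto
  qed simp
qed

lemma runs_column_com:
  assumes "2 \<le> N" and state: "m N 0 = n" "m N 1 = p" "m N 3 = 0" "m N 4 = j" "v (Suc N) 0 = 0"
  shows "runs (column_com N) (m, v, \<omega>) (n * 3 + 1)
    (\<lambda>(m', v', \<omega>'). (\<forall>c l. (c, l) \<noteq> (N, 3) \<longrightarrow> m' c l = m c l) \<and>
       (\<forall>c l. (c, l) \<noteq> (Suc N, 0) \<longrightarrow> v' c l = v c l) \<and>
       v' (Suc N) 0 = (\<Sum>i<n. label_of (m 1 i) * v N (i * p + j)))"
proof -
  define Inv where "Inv k = (\<lambda>(m' :: imem, v' :: rmem, \<omega>' :: tape).
     (\<forall>c l. (c, l) \<noteq> (N, 3) \<longrightarrow> m' c l = m c l) \<and> m' N 3 = k \<and>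
     (\<forall>c l. (c, l) \<noteq> (Suc N, 0) \<longrightarrow> v' c l = v c l) \<and>
     v' (Suc N) 0 = (\<Sum>i<k. label_of (m 1 i) * v N (i * p + j)))" for k
  have "runs (column_com N) (m, v, \<omega>) (n * Suc 2 + 1) (Inv n)"
    unfolding column_com_def
  proof (rule runs_for[where Inv = Inv])
    fix k m' v' \<omega>' assume k: "k < n" and inv: "Inv k (m', v', \<omega>')"
    have reg: "m' N 3 = k" "m' N 0 = n" "m' N (Suc 0) = p" "m' N 4 = j" "m' (Suc 0) k = m (Suc 0) k"
      using inv state assms(1) by (auto simp: Inv_def)
    have label: "1 - 2 * real (Suc 0 - l) = label_of l" for l
      by (cases l) (auto simp: label_of_def)
    show "bval (ILess (int_reg N 3) (int_reg N 0)) m' v' \<and>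
      runs (column_step N) (m', v', \<omega>') 2 (Inv (Suc k))"
      unfolding numeral_2_eq_2 column_step_def
    proof (intro conjI runs_Seq_RAssign runs_IAssign, goal_cases)
      case 1
      then show ?case using reg k by simp
    next
      case 2
      have "v' N (k * p + j) = v N (k * p + j)"
        using inv by (auto simp: Inv_def)
      then show ?case
        using inv reg unfolding Inv_def
        by (auto simp: store_apply label)
    qed
  next
    fix m' v' \<omega>' assume "Inv n (m', v', \<omega>')"
    then show "\<not> bval (ILess (int_reg N 3) (int_reg N 0)) m' v'"
      using state by (auto simp: Inv_def)
  qed (use state in \<open>auto simp: Inv_def\<close>)
  then show ?thesis
    by (rule runs_mono) (auto simp: Inv_def)
qed

lemma runs_statistic_com:
  assumes "2 \<le> N" and state: "m N 0 = n" "m N 1 = p" "m N 2 = s"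
    and data: "\<And>i j. i < n \<Longrightarrow> j < p \<Longrightarrow> v N (i * p + j) = Y i j"
  shows "runs (statistic_com N) (m, v, \<omega>) (2 + (p * (n * 3 + 6) + 1))
    (\<lambda>(m' :: imem, v' :: rmem, \<omega>' :: tape). m' N 0 = n \<and> m' N 1 = p \<and> m' N 2 = s \<and>
       v' (Suc N) 1 = mixture_statistic n p s (\<lambda>i. label_of (m 1 i)) Y)"
proof -
  define F where
    "F j = 1 + real s / (exp 1 * real p) * exp ((\<Sum>i<n. label_of (m 1 i) * Y i j)\<^sup>2 / (4 * real n))" for j
  define Inv where "Inv k = (\<lambda>(m' :: imem, v' :: rmem, \<omega>' :: tape).
     m' N 0 = n \<and> m' N 1 = p \<and> m' N 2 = s \<and> m' N 4 = k \<and> m' 1 = m 1 \<and> v' N = v N \<and>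
     v' (Suc N) 1 = (\<Prod>j<k. F j))" for k
  have loop: "runs (While (ILess (int_reg N 4) (int_reg N 1))
      (statistic_step N))
      \<sigma> (p * Suc (Suc (Suc ((n * 3 + 1) + Suc (Suc 0)))) + 1) (Inv p)" if "Inv 0 \<sigma>" for \<sigma>
  proof (rule runs_for[where Inv = Inv])
    fix k m1 v1 \<omega>1 assume k: "k < p" and inv: "Inv k (m1, v1, \<omega>1)"
    have labels: "m1 (Suc 0) = m (Suc 0)" and Y: "v1 N = v N"
      using inv by (auto simp: Inv_def)
    have sum: "(\<Sum>i<n. label_of (m (Suc 0) i) * v N (i * p + k)) = (\<Sum>i<n. label_of (m 1 i) * Y i k)"
      using k data by (intro sum.cong) auto
    define m2 v2 where "m2 = store m1 N 3 0" and "v2 = store v1 (Suc N) 0 (0::real)"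
    have "runs (column_com N) (m2, v2, \<omega>1) (n * 3 + 1)
      (\<lambda>(m', v', \<omega>'). (\<forall>c l. (c, l) \<noteq> (N, 3) \<longrightarrow> m' c l = m2 c l) \<and>
       (\<forall>c l. (c, l) \<noteq> (Suc N, 0) \<longrightarrow> v' c l = v2 c l) \<and>
       v' (Suc N) 0 = (\<Sum>i<n. label_of (m2 1 i) * v2 N (i * p + k)))"
      using inv assms(1)
      by (intro runs_column_com) (auto simp: m2_def v2_def store_apply store_other Inv_def)
    then have column: "runs (column_com N) (m2, v2, \<omega>1) (n * 3 + 1)
      (\<lambda>(m' :: imem, v' :: rmem, \<omega>' :: tape). m' N 0 = n \<and> m' N 1 = p \<and> m' N 2 = s \<and> m' N 4 = k \<and> m' 1 = m 1 \<and>
        v' N = v N \<and> v' (Suc N) 1 = (\<Prod>j<k. F j) \<and>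
        v' (Suc N) 0 = (\<Sum>i<n. label_of (m 1 i) * Y i k))"
      by (rule runs_mono)
         (use inv assms(1) in \<open>auto simp: m2_def v2_def store_apply store_other Inv_def labels Y sum fun_eq_iff\<close>)
    show "bval (ILess (int_reg N 4) (int_reg N 1)) m1 v1 \<and>
      runs (statistic_step N) (m1, v1, \<omega>1)
        (Suc (Suc ((n * 3 + 1) + Suc (Suc 0)))) (Inv (Suc k))"
      unfolding statistic_step_def
    proof (intro conjI runs_Seq_IAssign runs_Seq_RAssign, goal_cases)
      case 1
      then show ?case using inv k by (auto simp: Inv_def)
    next
      case 2
      show ?case
      proof (rule runs_Seq)
        show "runs (column_com N) (store m1 N (ival (IConst 3) m1) (ival (IConst 0) m1),
           store v1 (Suc N) (ival (IConst 0) (store m1 N (ival (IConst 3) m1) (ival (IConst 0) m1)))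
             (rval (RConst 0) (store m1 N (ival (IConst 3) m1) (ival (IConst 0) m1)) v1), \<omega>1) (n * 3 + 1)
          (\<lambda>(m' :: imem, v' :: rmem, \<omega>' :: tape). m' N 0 = n \<and> m' N 1 = p \<and> m' N 2 = s \<and> m' N 4 = k \<and> m' 1 = m 1 \<and>
            v' N = v N \<and> v' (Suc N) 1 = (\<Prod>j<k. F j) \<and>
            v' (Suc N) 0 = (\<Sum>i<n. label_of (m 1 i) * Y i k))"
          using column by (simp add: m2_def v2_def)
      next
        fix \<sigma>'
        assume "(\<lambda>(m' :: imem, v' :: rmem, \<omega>' :: tape). m' N 0 = n \<and> m' N 1 = p \<and> m' N 2 = s \<and> m' N 4 = k \<and> m' 1 = m 1 \<and>
            v' N = v N \<and> v' (Suc N) 1 = (\<Prod>j<k. F j) \<and>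
            v' (Suc N) 0 = (\<Sum>i<n. label_of (m 1 i) * Y i k)) \<sigma>'"
        moreover obtain m' v' \<omega>' where \<sigma>': "\<sigma>' = (m', v', \<omega>')" by (cases \<sigma>')
        ultimately show "runs (factor_step N) \<sigma>' (Suc (Suc 0)) (Inv (Suc k))"
          unfolding \<sigma>' factor_step_def using assms(1)
          by (intro runs_Seq_RAssign runs_IAssign)
             (auto simp: Inv_def store_apply store_other F_def power2_eq_square)
      qed
    qed
  qed (use that in \<open>auto simp: Inv_def\<close>)
  have "runs (statistic_com N) (m, v, \<omega>)
      (Suc (Suc (p * Suc (Suc (Suc ((n * 3 + 1) + Suc (Suc 0)))) + 1))) (Inv p)"
    unfolding statistic_com_def
    by (intro runs_Seq_IAssign runs_Seq_RAssign loop)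
       (use assms(1) state in \<open>auto simp: Inv_def store_apply store_other\<close>)
  moreover have "Suc (Suc (p * Suc (Suc (Suc ((n * 3 + 1) + Suc (Suc 0)))) + 1)) = 2 + (p * (n * 3 + 6) + 1)"
    by (simp add: distrib_left mult.commute)
  ultimately show ?thesis
    by (simp only:) (erule runs_mono, auto simp: Inv_def F_def mixture_statistic_def)
qed

lemma runs_decide_com:
  assumes "m N 0 = n" "m N 1 = p" "m N 2 = s" "v (Suc N) 1 = mixture_statistic n p s \<eta> Y"
  shows "runs (decide_com N) (m, v, \<omega>) 2 (\<lambda>\<sigma>. fst \<sigma> 1 0 = (if rejects n p s \<eta> Y then 1 else 0))"
proof -
  have "runs (decide_com N) (m, v, \<omega>) (Suc (Suc 0))
    (\<lambda>\<sigma>. fst \<sigma> 1 0 = (if rejects n p s \<eta> Y then 1 else 0))"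
    unfolding decide_com_def
  proof (rule runs_If; rule runs_IAssign)
  qed (use assms in \<open>auto simp: store_apply rejects_def not_le\<close>)
  then show ?thesis by (simp add: numeral_2_eq_2)
qed

lemma runs_test_com:
  assumes N: "2 \<le> N" "com_bound zhat \<le> N"
    and zhat: "exec zhat (init_state n p s \<Delta> (\<lambda>i j. a * X i j + b * g !! (i * p + j))
      (sdrop (n * p) g, u)) t \<sigma>"
  shows "runs (test_com N a b zhat) (init_state n p s \<Delta> X (g, u))
    (8 * (n * p) + 6 * p + 10 + t)
    (\<lambda>\<sigma>'. fst \<sigma>' 1 0 = (if rejects n p s (\<lambda>i. label_of (fst \<sigma> 1 i))
       (\<lambda>i j. b * X i j - a * g !! (i * p + j)) then 1 else 0))"
    (is "runs _ _ _ ?Q")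
proof -
  have "runs (test_com N a b zhat) (init_state n p s \<Delta> X (g, u))
    ((4 + (n * p * 5 + 1)) + (t + ((2 + (p * (n * 3 + 6) + 1)) + 2))) ?Q"
    unfolding test_com_def
  proof (rule runs_Seq[OF runs_split_com[OF N(1)]])
    fix \<sigma>1
    assume "\<exists>m v. \<sigma>1 = graft_state N m v
            (init_state n p s \<Delta> (\<lambda>i j. a * X i j + b * g !! (i * p + j)) (sdrop (n * p) g, u)) \<and>
          m N 0 = n \<and> m N 1 = p \<and> m N 2 = s \<and>
          (\<forall>l<n * p. v N l = b * X (l div p) (l mod p) - a * g !! l)"
    then obtain m v where \<sigma>1: "\<sigma>1 = graft_state N m v
            (init_state n p s \<Delta> (\<lambda>i j. a * X i j + b * g !! (i * p + j)) (sdrop (n * p) g, u))"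
      and reg: "m N 0 = n" "m N 1 = p" "m N 2 = s"
      and data: "\<And>l. l < n * p \<Longrightarrow> v N l = b * X (l div p) (l mod p) - a * g !! l"
      by auto
    have entry: "v N (i * p + j) = b * X i j - a * g !! (i * p + j)" if "i < n" "j < p" for i j
    proof -
      have "i * p + j < Suc i * p" using that by simp
      also have "\<dots> \<le> n * p" using that by (intro mult_le_mono1) simp
      finally show ?thesis using that by (subst data) auto
    qed
    have "runs zhat \<sigma>1 t (\<lambda>\<sigma>'. \<sigma>' = graft_state N m v \<sigma>)"
      unfolding runs_def \<sigma>1 using exec_graft[OF zhat N(2)] by blast
    then show "runs (Seq zhat (Seq (statistic_com N) (decide_com N))) \<sigma>1
      (t + ((2 + (p * (n * 3 + 6) + 1)) + 2)) ?Q"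
    proof (rule runs_Seq)
      fix \<sigma>2 assume \<sigma>2: "\<sigma>2 = graft_state N m v \<sigma>"
      obtain m' v' \<omega>' where \<sigma>: "\<sigma> = (m', v', \<omega>')" by (cases \<sigma>)
      have "\<sigma>2 = (graft N m' m, graft N v' v, \<omega>')"
        unfolding \<sigma>2 \<sigma> graft_state_def by simp
      moreover have "runs (Seq (statistic_com N) (decide_com N))
        (graft N m' m, graft N v' v, \<omega>') ((2 + (p * (n * 3 + 6) + 1)) + 2) ?Q"
      proof (rule runs_Seq[OF runs_statistic_com[where n = n and p = p and s = s
              and Y = "\<lambda>i j. b * X i j - a * g !! (i * p + j)"]])
        fix \<sigma>3
        assume "(\<lambda>(m1 :: imem, v1 :: rmem, \<omega>1 :: tape). m1 N 0 = n \<and> m1 N 1 = p \<and> m1 N 2 = s \<and>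
          v1 (Suc N) 1 = mixture_statistic n p s (\<lambda>i. label_of (graft N m' m 1 i))
            (\<lambda>i j. b * X i j - a * g !! (i * p + j))) \<sigma>3"
        moreover have "graft N m' m 1 = fst \<sigma> 1"
          using N by (simp add: graft_def \<sigma>)
        moreover obtain m1 v1 \<omega>1 where \<sigma>3: "\<sigma>3 = (m1, v1, \<omega>1)" by (cases \<sigma>3)
        ultimately show "runs (decide_com N) \<sigma>3 2 ?Q"
          unfolding \<sigma>3 by (intro runs_decide_com) simp_all
      qed (use N reg entry in \<open>auto simp: graft_def\<close>)
      ultimately show "runs (Seq (statistic_com N) (decide_com N)) \<sigma>2
        ((2 + (p * (n * 3 + 6) + 1)) + 2) ?Q" by simp
    qed
  qed
  then show ?thesis
    by (rule runs_mono) (auto simp: algebra_simps)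
qed

section \<open>Splitting Gaussian data into two independent halves\<close>

lemma sets_std_gaussian[measurable_cong, simp]: "sets std_gaussian = sets borel"
  by (simp add: std_gaussian_def)

lemma space_std_gaussian[simp]: "space std_gaussian = UNIV"
  by (simp add: std_gaussian_def)

lemma prob_space_std_gaussian: "prob_space std_gaussian"
  unfolding std_gaussian_def by (intro prob_space_normal_density) simp

lemma nn_integral_std_gaussian:
  "f \<in> borel_measurable borel \<Longrightarrow>
    (\<integral>\<^sup>+x. f x \<partial>std_gaussian) = (\<integral>\<^sup>+x. ennreal (std_normal_density x) * f x \<partial>lborel)"
  unfolding std_gaussian_def by (simp add: nn_integral_density)

interpretation gauss: prob_space std_gaussian
  by (rule prob_space_std_gaussian)

lemma product_sigma_finite_const: "prob_space M \<Longrightarrow> product_sigma_finite (\<lambda>_. M)"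
  by (intro product_sigma_finite.intro prob_space_imp_sigma_finite)

text \<open>
  The substitutions \<open>w = (u - a x) / b\<close> and \<open>x = a u + b v\<close> turn the integral over \<open>(x, w)\<close> into
  one over the coordinates \<open>(u, v)\<close> after the orthogonal map, and the density depends on
  \<open>x\<^sup>2 + w\<^sup>2 = u\<^sup>2 + v\<^sup>2\<close> only.
\<close>

lemma distr_gaussian_orthogonal:
  fixes a b :: real
  assumes ab: "a\<^sup>2 + b\<^sup>2 = 1" "b \<noteq> 0"
  shows "distr (std_gaussian \<Otimes>\<^sub>M std_gaussian) (std_gaussian \<Otimes>\<^sub>M std_gaussian)
    (\<lambda>(x, w). (a * x + b * w, b * x - a * w)) = std_gaussian \<Otimes>\<^sub>M std_gaussian"
    (is "distr ?G ?G ?rot = ?G")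
proof (rule measure_eqI)
  let ?\<phi> = "\<lambda>x. ennreal (std_normal_density x)"
  fix A assume "A \<in> sets (distr ?G ?G ?rot)"
  then have A[measurable]: "A \<in> sets (borel \<Otimes>\<^sub>M borel)" and A': "A \<in> sets ?G"
    by (simp_all cong: sets_pair_measure_cong)
  have rot: "?rot \<in> measurable ?G ?G"
    unfolding split_beta' by measurable
  have scale: "ennreal \<bar>b\<bar> * (ennreal \<bar>1 / b\<bar> * c) = c" for c
    using ab(2) by (simp flip: mult.assoc ennreal_mult)
  have density: "?\<phi> (a * u + b * v) * ?\<phi> (b * u - a * v) = ?\<phi> u * ?\<phi> v" for u v
  proof -
    have "(a * u + b * v)\<^sup>2 + (b * u - a * v)\<^sup>2 = (a\<^sup>2 + b\<^sup>2) * (u\<^sup>2 + v\<^sup>2)"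
      by (simp add: power2_eq_square algebra_simps)
    then have "- (a * u + b * v)\<^sup>2 / 2 + - (b * u - a * v)\<^sup>2 / 2 = - u\<^sup>2 / 2 + - v\<^sup>2 / 2"
      using ab(1) by (simp add: field_simps)
    then have "exp (- (a * u + b * v)\<^sup>2 / 2) * exp (- (b * u - a * v)\<^sup>2 / 2)
      = exp (- u\<^sup>2 / 2) * exp (- v\<^sup>2 / 2)"
      unfolding mult_exp_exp by simp
    then show ?thesis
      by (simp add: std_normal_density_def field_simps flip: ennreal_mult)
  qed
  have "emeasure (distr ?G ?G ?rot) A = (\<integral>\<^sup>+z. indicator A z \<partial>distr ?G ?G ?rot)"
    using A' by (subst nn_integral_indicator) simp_all
  also have "\<dots> = (\<integral>\<^sup>+z. indicator A (a * fst z + b * snd z, b * fst z - a * snd z) \<partial>?G)"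
    using rot A' by (subst nn_integral_distr) (simp_all add: split_beta')
  also have "\<dots> = (\<integral>\<^sup>+x. \<integral>\<^sup>+w. indicator A (a * x + b * w, b * x - a * w)
      \<partial>std_gaussian \<partial>std_gaussian)"
    by (subst gauss.nn_integral_fst[symmetric]) simp_all
  also have "\<dots> = (\<integral>\<^sup>+x. \<integral>\<^sup>+w. ?\<phi> x * (?\<phi> w * indicator A (a * x + b * w, b * x - a * w))
      \<partial>lborel \<partial>lborel)"
    by (simp add: nn_integral_std_gaussian nn_integral_cmult)
  also have "\<dots> = (\<integral>\<^sup>+x. \<integral>\<^sup>+u. ennreal \<bar>1 / b\<bar> *
      (?\<phi> x * (?\<phi> ((u - a * x) / b) * indicator A (u, (x - a * u) / b))) \<partial>lborel \<partial>lborel)"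
  proof (rule nn_integral_cong)
    fix x
    have w: "a * x + b * (- a * x / b + 1 / b * u) = u"
      "b * x - a * (- a * x / b + 1 / b * u) = (x - a * u) / b"
      "- a * x / b + 1 / b * u = (u - a * x) / b" for u
    proof -
      have "b * x = (a\<^sup>2 + b\<^sup>2) * x / b - a * a * x / b"
        using ab(2) by (simp add: field_simps power2_eq_square)
      then show "b * x - a * (- a * x / b + 1 / b * u) = (x - a * u) / b"
        using ab by (simp add: field_simps)
    qed (use ab(2) in \<open>auto simp: field_simps\<close>)
    have "(\<integral>\<^sup>+w. ?\<phi> x * (?\<phi> w * indicator A (a * x + b * w, b * x - a * w)) \<partial>lborel)
      = ennreal \<bar>1 / b\<bar> * (\<integral>\<^sup>+u. ?\<phi> x * (?\<phi> (- a * x / b + 1 / b * u) *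
          indicator A (a * x + b * (- a * x / b + 1 / b * u), b * x - a * (- a * x / b + 1 / b * u))) \<partial>lborel)"
      using ab(2) by (intro nn_integral_real_affine) auto
    also have "\<dots> = (\<integral>\<^sup>+u. ennreal \<bar>1 / b\<bar> *
        (?\<phi> x * (?\<phi> ((u - a * x) / b) * indicator A (u, (x - a * u) / b))) \<partial>lborel)"
      unfolding w(1,2) unfolding w(3) by (rule nn_integral_cmult[symmetric]) measurable
    finally show "(\<integral>\<^sup>+w. ?\<phi> x * (?\<phi> w * indicator A (a * x + b * w, b * x - a * w)) \<partial>lborel)
      = (\<integral>\<^sup>+u. ennreal \<bar>1 / b\<bar> *
        (?\<phi> x * (?\<phi> ((u - a * x) / b) * indicator A (u, (x - a * u) / b))) \<partial>lborel)" .
  qed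
  also have "\<dots> = (\<integral>\<^sup>+u. \<integral>\<^sup>+x. ennreal \<bar>1 / b\<bar> *
      (?\<phi> x * (?\<phi> ((u - a * x) / b) * indicator A (u, (x - a * u) / b))) \<partial>lborel \<partial>lborel)"
    by (rule lborel_pair.Fubini') measurable
  also have "\<dots> = (\<integral>\<^sup>+u. \<integral>\<^sup>+v. ?\<phi> u * (?\<phi> v * indicator A (u, v)) \<partial>lborel \<partial>lborel)"
  proof (rule nn_integral_cong)
    fix u
    have v: "(a * u + b * v - a * u) / b = v" "(u - a * (a * u + b * v)) / b = b * u - a * v" for v
    proof -
      have "u = (a\<^sup>2 + b\<^sup>2) * u"
        using ab by simp
      then show "(u - a * (a * u + b * v)) / b = b * u - a * v"
        using ab(2) by (simp add: field_simps power2_eq_square)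
    qed (use ab(2) in auto)
    have "(\<integral>\<^sup>+x. ennreal \<bar>1 / b\<bar> *
      (?\<phi> x * (?\<phi> ((u - a * x) / b) * indicator A (u, (x - a * u) / b))) \<partial>lborel)
      = ennreal \<bar>b\<bar> * (\<integral>\<^sup>+v. ennreal \<bar>1 / b\<bar> *
         (?\<phi> (a * u + b * v) * (?\<phi> ((u - a * (a * u + b * v)) / b) *
           indicator A (u, (a * u + b * v - a * u) / b))) \<partial>lborel)"
      using ab(2) by (intro nn_integral_real_affine) auto
    also have "\<dots> = (\<integral>\<^sup>+v. ennreal \<bar>b\<bar> * (ennreal \<bar>1 / b\<bar> *
         (?\<phi> (a * u + b * v) * (?\<phi> (b * u - a * v) * indicator A (u, v)))) \<partial>lborel)"
      unfolding v by (rule nn_integral_cmult[symmetric]) measurable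
    also have "\<dots> = (\<integral>\<^sup>+v. ?\<phi> u * (?\<phi> v * indicator A (u, v)) \<partial>lborel)"
      unfolding scale unfolding mult.assoc[symmetric] density ..
    finally show "(\<integral>\<^sup>+x. ennreal \<bar>1 / b\<bar> *
      (?\<phi> x * (?\<phi> ((u - a * x) / b) * indicator A (u, (x - a * u) / b))) \<partial>lborel)
      = (\<integral>\<^sup>+v. ?\<phi> u * (?\<phi> v * indicator A (u, v)) \<partial>lborel)" .
  qed
  also have "\<dots> = (\<integral>\<^sup>+u. \<integral>\<^sup>+v. indicator A (u, v) \<partial>std_gaussian \<partial>std_gaussian)"
    by (simp add: nn_integral_std_gaussian nn_integral_cmult)
  also have "\<dots> = emeasure ?G A"
    using A' by (subst gauss.emeasure_pair_measure) simp_all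
  finally show "emeasure (distr ?G ?G ?rot) A = emeasure ?G A" .
qed simp

definition zip_PiM :: "'i set \<Rightarrow> ('i \<Rightarrow> 'a) \<times> ('i \<Rightarrow> 'b) \<Rightarrow> 'i \<Rightarrow> 'a \<times> 'b" where
  "zip_PiM I = (\<lambda>(x, y). \<lambda>i\<in>I. (x i, y i))"

definition unzip_PiM :: "'i set \<Rightarrow> ('i \<Rightarrow> 'a \<times> 'b) \<Rightarrow> ('i \<Rightarrow> 'a) \<times> ('i \<Rightarrow> 'b)" where
  "unzip_PiM I q = (\<lambda>i\<in>I. fst (q i), \<lambda>i\<in>I. snd (q i))"

lemma measurable_zip_PiM[measurable]:
  "zip_PiM I \<in> measurable (PiM I (\<lambda>_. M) \<Otimes>\<^sub>M PiM I (\<lambda>_. N)) (PiM I (\<lambda>_. M \<Otimes>\<^sub>M N))"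
  unfolding zip_PiM_def split_beta' by measurable

lemma measurable_unzip_PiM[measurable]:
  "unzip_PiM I \<in> measurable (PiM I (\<lambda>_. M \<Otimes>\<^sub>M N)) (PiM I (\<lambda>_. M) \<Otimes>\<^sub>M PiM I (\<lambda>_. N))"
  unfolding unzip_PiM_def[abs_def] by measurable

text \<open>
  Both measures agree on boxes, where by Fubini's theorem the integral over the two vectors is a
  product of integrals over the pairs of coordinates.
\<close>

lemma distr_zip_PiM:
  assumes "finite I" "prob_space M" "prob_space N"
  shows "distr (PiM I (\<lambda>_. M) \<Otimes>\<^sub>M PiM I (\<lambda>_. N)) (PiM I (\<lambda>_. M \<Otimes>\<^sub>M N)) (zip_PiM I)
    = PiM I (\<lambda>_. M \<Otimes>\<^sub>M N)" (is "distr ?P ?Q _ = _")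
proof -
  interpret M: product_sigma_finite "\<lambda>_. M" using assms(2) by (rule product_sigma_finite_const)
  interpret N: product_sigma_finite "\<lambda>_. N" using assms(3) by (rule product_sigma_finite_const)
  interpret M': prob_space M by fact
  interpret N': prob_space N by fact
  interpret MN: pair_prob_space M N ..
  interpret P: product_sigma_finite "\<lambda>_. M \<Otimes>\<^sub>M N"
    by (rule product_sigma_finite_const) (rule MN.prob_space_axioms)
  have PN: "prob_space (PiM I (\<lambda>_. N))"
    by (rule prob_space_PiM) (rule assms(3))
  show ?thesis
  proof (rule P.PiM_eqI)
    fix A assume A: "\<And>i. i \<in> I \<Longrightarrow> A i \<in> sets (M \<Otimes>\<^sub>M N)"
    have box: "Pi\<^sub>E I A \<in> sets ?Q"
      using A assms(1) by (auto intro!: sets_PiM_I_finite)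
    have prod_indicator: "indicator (Pi\<^sub>E I A) (zip_PiM I (x, y)) = (\<Prod>i\<in>I. indicator (A i) (x i, y i) :: ennreal)"
      for x y
    proof (cases "\<forall>i\<in>I. (x i, y i) \<in> A i")
      case True
      then have "zip_PiM I (x, y) \<in> Pi\<^sub>E I A"
        by (auto simp: zip_PiM_def)
      then show ?thesis using True by simp
    next
      case False
      then have "zip_PiM I (x, y) \<notin> Pi\<^sub>E I A"
        by (auto simp: zip_PiM_def PiE_iff)
      moreover have "(\<Prod>i\<in>I. indicator (A i) (x i, y i) :: ennreal) = 0"
        using False assms(1) by (intro prod_zero) (auto simp: indicator_def)
      ultimately show ?thesis by simp
    qed
    have slice: "indicator (A i) \<in> borel_measurable (M \<Otimes>\<^sub>M N)" if "i \<in> I" for i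
      using A[OF that] by simp
    have "emeasure (distr ?P ?Q (zip_PiM I)) (Pi\<^sub>E I A)
      = (\<integral>\<^sup>+z. indicator (Pi\<^sub>E I A) z \<partial>distr ?P ?Q (zip_PiM I))"
      using box by (subst nn_integral_indicator) simp_all
    also have "\<dots> = (\<integral>\<^sup>+z. indicator (Pi\<^sub>E I A) (zip_PiM I z) \<partial>?P)"
      using box by (subst nn_integral_distr) simp_all
    also have "\<dots> = (\<integral>\<^sup>+x. \<integral>\<^sup>+y. indicator (Pi\<^sub>E I A) (zip_PiM I (x, y)) \<partial>PiM I (\<lambda>_. N) \<partial>PiM I (\<lambda>_. M))"
      by (rule sigma_finite_measure.nn_integral_fst
              [OF prob_space_imp_sigma_finite[OF PN], symmetric])
         (rule measurable_compose[OF measurable_zip_PiM borel_measurable_indicator[OF box]])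
    also have "\<dots> = (\<integral>\<^sup>+x. (\<Prod>i\<in>I. \<integral>\<^sup>+y. indicator (A i) (x i, y) \<partial>N) \<partial>PiM I (\<lambda>_. M))"
    proof (rule nn_integral_cong)
      fix x assume x: "x \<in> space (PiM I (\<lambda>_. M))"
      have "(\<lambda>y. indicator (A i) (x i, y) :: ennreal) \<in> borel_measurable N" if "i \<in> I" for i
      proof -
        have "x i \<in> space M" using x that by (auto simp: space_PiM)
        then show ?thesis
          by (intro measurable_compose[OF measurable_Pair1' slice[OF that]])
      qed
      then show "(\<integral>\<^sup>+y. indicator (Pi\<^sub>E I A) (zip_PiM I (x, y)) \<partial>PiM I (\<lambda>_. N))
        = (\<Prod>i\<in>I. \<integral>\<^sup>+y. indicator (A i) (x i, y) \<partial>N)"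
        unfolding prod_indicator using assms(1)
        by (intro N.product_nn_integral_prod) auto
    qed
    also have "\<dots> = (\<Prod>i\<in>I. \<integral>\<^sup>+x. \<integral>\<^sup>+y. indicator (A i) (x, y) \<partial>N \<partial>M)"
      using assms(1) slice
      by (intro M.product_nn_integral_prod
          sigma_finite_measure.borel_measurable_nn_integral_fst[OF prob_space_imp_sigma_finite])
         (auto intro: assms(3))
    also have "\<dots> = (\<Prod>i\<in>I. emeasure (M \<Otimes>\<^sub>M N) (A i))"
      using A
      by (intro prod.cong sigma_finite_measure.emeasure_pair_measure
          [OF prob_space_imp_sigma_finite[OF assms(3)], symmetric]) auto
    finally show "emeasure (distr ?P ?Q (zip_PiM I)) (Pi\<^sub>E I A)
      = (\<Prod>i\<in>I. emeasure (M \<Otimes>\<^sub>M N) (A i))" .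
  qed (use assms(1) in auto)
qed

text \<open>
  Zipping the two vectors gives a vector of independent pairs, on which the map acts pair by pair
  and preserves the law of each of them. Unzipping leads back to two independent vectors.
\<close>

lemma distr_coordinatewise:
  assumes "finite I" "prob_space M"
    and f: "f \<in> measurable (M \<Otimes>\<^sub>M M) (M \<Otimes>\<^sub>M M)" "distr (M \<Otimes>\<^sub>M M) (M \<Otimes>\<^sub>M M) f = M \<Otimes>\<^sub>M M"
  shows "distr (PiM I (\<lambda>_. M) \<Otimes>\<^sub>M PiM I (\<lambda>_. M)) (PiM I (\<lambda>_. M) \<Otimes>\<^sub>M PiM I (\<lambda>_. M))
      (\<lambda>(x, y). (\<lambda>i\<in>I. fst (f (x i, y i)), \<lambda>i\<in>I. snd (f (x i, y i))))
    = PiM I (\<lambda>_. M) \<Otimes>\<^sub>M PiM I (\<lambda>_. M)" (is "distr ?P ?P ?F = ?P")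
proof -
  let ?Q = "PiM I (\<lambda>_. M \<Otimes>\<^sub>M M)"
  interpret M: prob_space M by fact
  interpret MM: pair_prob_space M M ..
  note [measurable] = f(1)
  have map_f: "compose I f \<in> measurable ?Q ?Q"
    unfolding compose_def by measurable
  have zip: "distr ?P ?Q (zip_PiM I) = ?Q"
    by (rule distr_zip_PiM) fact+
  have map: "distr ?Q ?Q (compose I f) = ?Q"
    using distr_PiM_finite_prob_space'[of I "\<lambda>_. M \<Otimes>\<^sub>M M" "\<lambda>_. M \<Otimes>\<^sub>M M" f] assms(1) f
      MM.prob_space_axioms by simp
  have unzip: "distr ?Q ?P (unzip_PiM I) = ?P"
  proof -
    have "distr ?Q ?P (unzip_PiM I) = distr (distr ?P ?Q (zip_PiM I)) ?P (unzip_PiM I)"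
      unfolding zip ..
    also have "\<dots> = distr ?P ?P (unzip_PiM I \<circ> zip_PiM I)"
      by (rule distr_distr) simp_all
    also have "\<dots> = distr ?P ?P (\<lambda>x. x)"
      by (rule distr_cong)
         (auto simp: space_pair_measure space_PiM unzip_PiM_def zip_PiM_def fun_eq_iff PiE_def extensional_def)
    finally show ?thesis by simp
  qed
  have "distr ?P ?P ?F = distr ?P ?P (unzip_PiM I \<circ> (compose I f \<circ> zip_PiM I))"
    by (rule distr_cong) (auto simp: unzip_PiM_def zip_PiM_def compose_def fun_eq_iff)
  also have "\<dots> = distr (distr ?P ?Q (compose I f \<circ> zip_PiM I)) ?P (unzip_PiM I)"
    using map_f by (intro distr_distr[symmetric]) (auto intro: measurable_comp)
  also have "distr ?P ?Q (compose I f \<circ> zip_PiM I) = distr (distr ?P ?Q (zip_PiM I)) ?Q (compose I f)"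
    using map_f by (intro distr_distr[symmetric]) auto
  finally show ?thesis
    unfolding zip map unzip .
qed

lemma prob_space_gaussian_noise: "prob_space (gaussian_noise n p)"
  unfolding gaussian_noise_def by (intro prob_space_PiM prob_space_std_gaussian)

lemma sets_gaussian_noise[measurable_cong]: "sets (gaussian_noise n p) = sets (data_space n p)"
  unfolding gaussian_noise_def data_space_def by (intro sets_PiM_cong) auto

lemma distr_noise_orthogonal:
  fixes a b :: real
  assumes "a\<^sup>2 + b\<^sup>2 = 1" "b \<noteq> 0"
  shows "distr (gaussian_noise n p \<Otimes>\<^sub>M gaussian_noise n p) (gaussian_noise n p \<Otimes>\<^sub>M gaussian_noise n p)
      (\<lambda>(x, w). (\<lambda>i\<in>{..<n}. \<lambda>j\<in>{..<p}. a * x i j + b * w i j,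
                \<lambda>i\<in>{..<n}. \<lambda>j\<in>{..<p}. b * x i j - a * w i j))
    = gaussian_noise n p \<Otimes>\<^sub>M gaussian_noise n p"
proof -
  let ?R = "PiM {..<p} (\<lambda>_. std_gaussian)"
  let ?f = "\<lambda>(x, w). (\<lambda>j\<in>{..<p}. a * x j + b * w j, \<lambda>j\<in>{..<p}. b * x j - a * w j)"
  have rot: "(\<lambda>(x, w). (a * x + b * w, b * x - a * w))
      \<in> measurable (std_gaussian \<Otimes>\<^sub>M std_gaussian) (std_gaussian \<Otimes>\<^sub>M std_gaussian)"
    unfolding split_beta' by measurable
  have "distr (?R \<Otimes>\<^sub>M ?R) (?R \<Otimes>\<^sub>M ?R) ?f = ?R \<Otimes>\<^sub>M ?R"
    using distr_coordinatewise[OF _ prob_space_std_gaussian rot distr_gaussian_orthogonal[OF assms],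
        of "{..<p}"] by simp
  moreover have "?f \<in> measurable (?R \<Otimes>\<^sub>M ?R) (?R \<Otimes>\<^sub>M ?R)"
    unfolding split_beta' by measurable
  moreover have "prob_space ?R"
    by (intro prob_space_PiM prob_space_std_gaussian)
  ultimately show ?thesis
    using distr_coordinatewise[of "{..<n}" ?R ?f] unfolding gaussian_noise_def by simp
qed

text \<open>
  Splitting off single numbers gives a row of independent numbers from the tape, and splitting off
  rows gives a noise matrix. In the induction one more head is split off from the tail, which is
  independent of the heads so far and distributed like the whole.
\<close>

lemma nn_integral_split_off:
  assumes "prob_space M" "prob_space S"
    and [measurable]: "h \<in> measurable S M" "\<tau> \<in> measurable S S"
    and split: "\<And>F :: _ \<Rightarrow> ennreal. F \<in> borel_measurable (M \<Otimes>\<^sub>M S) \<Longrightarrow>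
      (\<integral>\<^sup>+x. F (h x, \<tau> x) \<partial>S) = (\<integral>\<^sup>+y. \<integral>\<^sup>+x. F (y, x) \<partial>S \<partial>M)"
    and F: "F \<in> borel_measurable (PiM {..<n} (\<lambda>_. M) \<Otimes>\<^sub>M S)"
  shows "(\<integral>\<^sup>+x. F (\<lambda>i\<in>{..<n}. h ((\<tau> ^^ i) x), (\<tau> ^^ n) x) \<partial>S)
    = (\<integral>\<^sup>+y. \<integral>\<^sup>+x. F (y, x) \<partial>S \<partial>PiM {..<n} (\<lambda>_. M))"
  using F
proof (induction n arbitrary: F)
  case 0
  interpret M: product_sigma_finite "\<lambda>_. M" using assms(1) by (rule product_sigma_finite_const)
  show ?case
    by (simp add: M.nn_integral_empty restrict_def)
next
  case (Suc n)
  interpret M: product_sigma_finite "\<lambda>_. M" using assms(1) by (rule product_sigma_finite_const)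
  interpret S: prob_space S by fact
  note F[measurable] = Suc.prems
  have step: "(\<lambda>x. ((fst x)(n := h (snd x)), \<tau> (snd x)))
      \<in> measurable (PiM {..<n} (\<lambda>_. M) \<Otimes>\<^sub>M S) (PiM {..<Suc n} (\<lambda>_. M) \<Otimes>\<^sub>M S)"
    unfolding lessThan_Suc by (intro measurable_Pair measurable_fun_upd[where J = "{..<n}"]) auto
  have upd: "(\<lambda>z. y(n := z)) \<in> measurable M (PiM {..<Suc n} (\<lambda>_. M))"
    if "y \<in> space (PiM {..<n} (\<lambda>_. M))" for y
    unfolding lessThan_Suc using that by (intro measurable_component_update) auto
  have restrict: "(\<lambda>i\<in>{..<Suc n}. h ((\<tau> ^^ i) x)) = (\<lambda>i\<in>{..<n}. h ((\<tau> ^^ i) x))(n := h ((\<tau> ^^ n) x))" for x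
    by (auto simp: fun_eq_iff)
  have "(\<integral>\<^sup>+x. F (\<lambda>i\<in>{..<Suc n}. h ((\<tau> ^^ i) x), (\<tau> ^^ Suc n) x) \<partial>S)
    = (\<integral>\<^sup>+y. \<integral>\<^sup>+x. F (y(n := h x), \<tau> x) \<partial>S \<partial>PiM {..<n} (\<lambda>_. M))"
    unfolding restrict
    using Suc.IH[OF measurable_compose[OF step F]]
    by (simp only: fst_conv snd_conv funpow.simps comp_apply)
  also have "\<dots> = (\<integral>\<^sup>+y. \<integral>\<^sup>+z. \<integral>\<^sup>+x. F (y(n := z), x) \<partial>S \<partial>M \<partial>PiM {..<n} (\<lambda>_. M))"
  proof (rule nn_integral_cong)
    fix y assume y: "y \<in> space (PiM {..<n} (\<lambda>_. M))"
    have "(\<lambda>x. (y(n := fst x), snd x)) \<in> measurable (M \<Otimes>\<^sub>M S) (PiM {..<Suc n} (\<lambda>_. M) \<Otimes>\<^sub>M S)"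
      by (intro measurable_Pair measurable_compose[OF measurable_fst upd[OF y]] measurable_snd)
    from split[OF measurable_compose[OF this F]]
    show "(\<integral>\<^sup>+x. F (y(n := h x), \<tau> x) \<partial>S) = (\<integral>\<^sup>+z. \<integral>\<^sup>+x. F (y(n := z), x) \<partial>S \<partial>M)"
      by simp
  qed
  also have "\<dots> = (\<integral>\<^sup>+y. \<integral>\<^sup>+x. F (y, x) \<partial>S \<partial>PiM {..<Suc n} (\<lambda>_. M))"
    unfolding lessThan_Suc
    by (rule M.product_nn_integral_insert[symmetric])
       (use F in \<open>auto simp: lessThan_Suc intro!: S.borel_measurable_nn_integral_fst\<close>)
  finally show ?case .
qed

lemma nn_integral_gaussian_stream:
  fixes F :: "_ \<Rightarrow> ennreal"
  assumes F: "F \<in> borel_measurable (gaussian_noise n p \<Otimes>\<^sub>M stream_space std_gaussian)"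
  shows "(\<integral>\<^sup>+g. F (\<lambda>i\<in>{..<n}. \<lambda>j\<in>{..<p}. g !! (i * p + j), sdrop (n * p) g) \<partial>stream_space std_gaussian)
    = (\<integral>\<^sup>+w. \<integral>\<^sup>+g. F (w, g) \<partial>stream_space std_gaussian \<partial>gaussian_noise n p)"
proof -
  let ?S = "stream_space std_gaussian" and ?R = "PiM {..<p} (\<lambda>_. std_gaussian)"
  have S: "prob_space ?S"
    by (rule gauss.prob_space_stream_space)
  have R: "prob_space ?R"
    by (intro prob_space_PiM prob_space_std_gaussian)
  have funpow_stl: "(stl ^^ k) g = sdrop k g" for k and g :: "real stream"
    by (induction k arbitrary: g) (simp_all add: funpow_swap1)
  have sdrop_funpow: "(sdrop p ^^ i) g = sdrop (i * p) g" for i and g :: "real stream"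
    by (induction i) (simp_all add: sdrop_add add.commute)
  have one: "(\<integral>\<^sup>+x. F (shd x, stl x) \<partial>?S) = (\<integral>\<^sup>+y. \<integral>\<^sup>+x. F (y, x) \<partial>?S \<partial>std_gaussian)"
    if [measurable]: "F \<in> borel_measurable (std_gaussian \<Otimes>\<^sub>M ?S)" for F :: "_ \<Rightarrow> ennreal"
    by (subst gauss.nn_integral_stream_space) simp_all
  have row: "(\<integral>\<^sup>+x. F (\<lambda>j\<in>{..<p}. x !! j, sdrop p x) \<partial>?S) = (\<integral>\<^sup>+y. \<integral>\<^sup>+x. F (y, x) \<partial>?S \<partial>?R)"
    if "F \<in> borel_measurable (?R \<Otimes>\<^sub>M ?S)" for F :: "_ \<Rightarrow> ennreal"
    using nn_integral_split_off[OF prob_space_std_gaussian S measurable_shd measurable_stl one that]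
    unfolding funpow_stl by simp
  have "(\<integral>\<^sup>+g. F (\<lambda>i\<in>{..<n}. \<lambda>j\<in>{..<p}. (sdrop p ^^ i) g !! j, (sdrop p ^^ n) g) \<partial>?S)
    = (\<integral>\<^sup>+w. \<integral>\<^sup>+g. F (w, g) \<partial>?S \<partial>PiM {..<n} (\<lambda>_. ?R))"
  proof (rule nn_integral_split_off[OF R S _ _ row])
    show "(\<lambda>g. \<lambda>j\<in>{..<p}. g !! j) \<in> measurable ?S ?R"
      by measurable
  qed (use F in \<open>simp_all add: gaussian_noise_def measurable_sdrop\<close>)
  then show ?thesis
    by (simp add: sdrop_funpow sdrop_snth gaussian_noise_def add.commute)
qed

definition first_half :: "nat \<Rightarrow> nat \<Rightarrow> real \<Rightarrow> real \<Rightarrow> (nat \<Rightarrow> nat \<Rightarrow> real) \<Rightarrow> real stream \<Rightarrow> nat \<Rightarrow> nat \<Rightarrow> real"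
  where "first_half n p a b X g = (\<lambda>i\<in>{..<n}. \<lambda>j\<in>{..<p}. a * X i j + b * g !! (i * p + j))"

definition second_half :: "nat \<Rightarrow> nat \<Rightarrow> real \<Rightarrow> real \<Rightarrow> (nat \<Rightarrow> nat \<Rightarrow> real) \<Rightarrow> real stream \<Rightarrow> nat \<Rightarrow> nat \<Rightarrow> real"
  where "second_half n p a b X g = (\<lambda>i\<in>{..<n}. \<lambda>j\<in>{..<p}. b * X i j - a * g !! (i * p + j))"

lemma measurable_dataI:
  assumes "\<And>i j. i < n \<Longrightarrow> j < p \<Longrightarrow> (\<lambda>w. f w i j) \<in> borel_measurable M"
  shows "(\<lambda>w. \<lambda>i\<in>{..<n}. \<lambda>j\<in>{..<p}. f w i j) \<in> measurable M (data_space n p)"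
  unfolding data_space_def
  by (rule measurable_restrict, rule measurable_restrict) (use assms in auto)

lemma measurable_entry:
  "f \<in> measurable M (data_space n p) \<Longrightarrow> i < n \<Longrightarrow> j < p \<Longrightarrow> (\<lambda>w. f w i j) \<in> borel_measurable M"
  by (rule measurable_compose[OF _ measurable_data_entry])

lemma prob_space_uniform: "prob_space (uniform_measure lborel {0..1::real})"
  by (rule prob_space_uniform_measure) simp_all

interpretation unif: prob_space "uniform_measure lborel {0..1::real}"
  by (rule prob_space_uniform)

lemma prob_space_randomness: "prob_space randomness"
proof -
  interpret S: prob_space "stream_space std_gaussian" by (rule gauss.prob_space_stream_space)
  interpret U: prob_space "stream_space (uniform_measure lborel {0..1::real})"
    by (rule unif.prob_space_stream_space)
  interpret SU: pair_prob_space "stream_space std_gaussian"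
    "stream_space (uniform_measure lborel {0..1::real})" ..
  show ?thesis unfolding randomness_def by (rule SU.prob_space_axioms)
qed

lemma sets_randomness[measurable_cong]: "sets randomness = sets tape_space"
  unfolding randomness_def tape_space_def
  by (intro sets_pair_measure_cong sets_stream_space_cong) auto

lemma measurable_shift_noise:
  "(\<lambda>N. \<lambda>i\<in>{..<n}. \<lambda>j\<in>{..<p}. z i * \<theta> j + N i j)
    \<in> measurable (gaussian_noise n p) (data_space n p)"
proof (rule measurable_dataI)
  fix i j assume "i < n" "j < p"
  then have "(\<lambda>N. N i j) \<in> borel_measurable (gaussian_noise n p)"
    unfolding measurable_cong_sets[OF sets_gaussian_noise refl] by (rule measurable_data_entry)
  then show "(\<lambda>N. z i * \<theta> j + N i j) \<in> borel_measurable (gaussian_noise n p)"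
    by measurable
qed

lemma cluster_model_eq:
  "cluster_model n p \<theta> z = distr (gaussian_noise n p) (data_space n p)
    (\<lambda>N. \<lambda>i\<in>{..<n}. \<lambda>j\<in>{..<p}. z i * \<theta> j + N i j)"
  by (simp add: cluster_model_def data_space_def)

lemma sets_cluster_model[measurable_cong]: "sets (cluster_model n p \<theta> z) = sets (data_space n p)"
  by (simp add: cluster_model_eq)

lemma prob_space_cluster_model: "prob_space (cluster_model n p \<theta> z)"
  unfolding cluster_model_eq
  by (rule prob_space.prob_space_distr[OF prob_space_gaussian_noise measurable_shift_noise])

lemma nn_integral_cluster_model:
  "f \<in> borel_measurable (data_space n p) \<Longrightarrow> (\<integral>\<^sup>+Y. f Y \<partial>cluster_model n p \<theta> z)
    = (\<integral>\<^sup>+N. f (\<lambda>i\<in>{..<n}. \<lambda>j\<in>{..<p}. z i * \<theta> j + N i j) \<partial>gaussian_noise n p)"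
  unfolding cluster_model_eq by (simp add: nn_integral_distr measurable_shift_noise)

lemma sets_joint_law[measurable_cong]:
  "sets (joint_law n p \<theta> z) = sets (data_space n p \<Otimes>\<^sub>M tape_space)"
  unfolding joint_law_def by (intro sets_pair_measure_cong sets_cluster_model sets_randomness)

lemma prob_space_joint_law: "prob_space (joint_law n p \<theta> z)"
proof -
  interpret C: prob_space "cluster_model n p \<theta> z" by (rule prob_space_cluster_model)
  interpret R: prob_space randomness by (rule prob_space_randomness)
  interpret CR: pair_prob_space "cluster_model n p \<theta> z" randomness ..
  show ?thesis unfolding joint_law_def by (rule CR.prob_space_axioms)
qed

lemma nn_integral_iterated:
  "prob_space N \<Longrightarrow> f \<in> borel_measurable (M \<Otimes>\<^sub>M N) \<Longrightarrow>
    (\<integral>\<^sup>+x. \<integral>\<^sup>+y. f (x, y) \<partial>N \<partial>M) = (\<integral>\<^sup>+z. f z \<partial>(M \<Otimes>\<^sub>M N))"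
  by (rule sigma_finite_measure.nn_integral_fst[OF prob_space_imp_sigma_finite])

lemma nn_integral_joint_law:
  assumes "f \<in> borel_measurable (data_space n p \<Otimes>\<^sub>M tape_space)"
  shows "(\<integral>\<^sup>+x. f x \<partial>joint_law n p \<theta> z) = (\<integral>\<^sup>+X. \<integral>\<^sup>+\<omega>. f (X, \<omega>) \<partial>randomness \<partial>cluster_model n p \<theta> z)"
  unfolding joint_law_def
  by (rule nn_integral_iterated[OF prob_space_randomness, symmetric]) (use assms in measurable)

text \<open>
  Adding to the data, and subtracting from it, suitable multiples of fresh Gaussian noise gives
  two independent data sets from the same model. The noise of the data and the fresh noise are
  mixed by an orthogonal map, so the two halves have independent standard Gaussian noise, and their
  centres are \<open>a \<theta>\<close> and \<open>b \<theta>\<close>. What remains of the tape is as good as new.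
\<close>

lemma nn_integral_sample_split:
  fixes F :: "_ \<Rightarrow> ennreal"
  assumes ab: "a\<^sup>2 + b\<^sup>2 = 1" "b \<noteq> 0"
    and F: "F \<in> borel_measurable ((data_space n p \<Otimes>\<^sub>M tape_space) \<Otimes>\<^sub>M data_space n p)"
  shows "(\<integral>\<^sup>+(X, g, u). F ((first_half n p a b X g, (sdrop (n * p) g, u)), second_half n p a b X g)
      \<partial>joint_law n p \<theta> z)
    = (\<integral>\<^sup>+x. \<integral>\<^sup>+Y. F (x, Y) \<partial>cluster_model n p (\<lambda>j. b * \<theta> j) z \<partial>joint_law n p (\<lambda>j. a * \<theta> j) z)"
proof -
  let ?N = "gaussian_noise n p" and ?D = "data_space n p"
  let ?S = "stream_space std_gaussian" and ?U = "stream_space (uniform_measure lborel {0..1::real})"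
  define shift where "shift c N = (\<lambda>i\<in>{..<n}. \<lambda>j\<in>{..<p}. z i * (c * \<theta> j) + N i j)"
    for c and N :: "nat \<Rightarrow> nat \<Rightarrow> real"
  define fst_rot where "fst_rot x = (\<lambda>i\<in>{..<n}. \<lambda>j\<in>{..<p}. a * fst x i j + b * snd x i j)"
    for x :: "(nat \<Rightarrow> nat \<Rightarrow> real) \<times> (nat \<Rightarrow> nat \<Rightarrow> real)"
  define snd_rot where "snd_rot x = (\<lambda>i\<in>{..<n}. \<lambda>j\<in>{..<p}. b * fst x i j - a * snd x i j)"
    for x :: "(nat \<Rightarrow> nat \<Rightarrow> real) \<times> (nat \<Rightarrow> nat \<Rightarrow> real)"
  define K where "K x = (\<integral>\<^sup>+\<omega>. F ((shift a (fst x), \<omega>), shift b (snd x)) \<partial>randomness)"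
    for x :: "(nat \<Rightarrow> nat \<Rightarrow> real) \<times> (nat \<Rightarrow> nat \<Rightarrow> real)"
  note [measurable] = F
  have shift_N[measurable]: "shift c \<in> measurable ?N ?D" for c
    unfolding shift_def by (rule measurable_shift_noise)
  have shift_D[measurable]: "shift c \<in> measurable ?D ?D" for c
    using measurable_shift_noise[where n = n and p = p and z = z and \<theta> = "\<lambda>j. c * \<theta> j"] unfolding shift_def
    by (simp cong: measurable_cong_sets add: sets_gaussian_noise)
  have entries: "(\<lambda>x. fst x i j) \<in> borel_measurable (?N \<Otimes>\<^sub>M ?N)" "(\<lambda>x. snd x i j) \<in> borel_measurable (?N \<Otimes>\<^sub>M ?N)"
    if "i < n" "j < p" for i j
    using that by (auto intro!: measurable_entry[where n = n and p = p])
  have rot: "fst_rot \<in> measurable (?N \<Otimes>\<^sub>M ?N) ?N" "snd_rot \<in> measurable (?N \<Otimes>\<^sub>M ?N) ?N"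
    unfolding fst_rot_def snd_rot_def measurable_cong_sets[OF refl sets_gaussian_noise]
    by (rule measurable_dataI; use entries in measurable)+
  note [measurable] = rot
  interpret R: prob_space randomness by (rule prob_space_randomness)
  interpret N: prob_space ?N by (rule prob_space_gaussian_noise)
  interpret S: prob_space ?S by (rule gauss.prob_space_stream_space)
  have U: "prob_space ?U" by (rule unif.prob_space_stream_space)
  interpret U: prob_space ?U by (rule U)
  have sets_S: "sets ?S = sets (stream_space borel)" and sets_U: "sets ?U = sets (stream_space borel)"
    by (rule sets_stream_space_cong, simp)+
  have tape_sets[measurable_cong]: "sets tape_space = sets (?S \<Otimes>\<^sub>M ?U)"
    unfolding tape_space_def using sets_S sets_U by (intro sets_pair_measure_cong) auto
  have slice: "(\<lambda>\<omega>. F ((shift a A, \<omega>), shift b B)) \<in> borel_measurable tape_space"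
    if "A \<in> space ?N" "B \<in> space ?N" for A B
  proof -
    have "shift a A \<in> space ?D" "shift b B \<in> space ?D"
      using that by (auto intro: measurable_space[of _ ?N])
    then have [measurable]: "(\<lambda>_. shift a A) \<in> measurable tape_space ?D" "(\<lambda>_. shift b B) \<in> measurable tape_space ?D"
      by simp_all
    show ?thesis by measurable
  qed
  have K[measurable]: "K \<in> borel_measurable (?N \<Otimes>\<^sub>M ?N)"
    unfolding K_def by measurable
  have "(\<integral>\<^sup>+(X, g, u). F ((first_half n p a b X g, (sdrop (n * p) g, u)), second_half n p a b X g)
      \<partial>joint_law n p \<theta> z)
    = (\<integral>\<^sup>+N. \<integral>\<^sup>+g. \<integral>\<^sup>+u. F ((first_half n p a b (shift 1 N) g, (sdrop (n * p) g, u)),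
        second_half n p a b (shift 1 N) g) \<partial>?U \<partial>?S \<partial>?N)"
  proof -
    let ?f = "\<lambda>x. F ((first_half n p a b (fst x) (fst (snd x)), (sdrop (n * p) (fst (snd x)), snd (snd x))),
      second_half n p a b (fst x) (fst (snd x)))"
    have cell: "(\<lambda>x. fst x i j) \<in> borel_measurable (?D \<Otimes>\<^sub>M tape_space)"
      "(\<lambda>x. fst (snd x) !! k) \<in> borel_measurable (?D \<Otimes>\<^sub>M tape_space)"
      if "i < n" "j < p" for i j k
      using that unfolding tape_space_def by (auto intro!: measurable_entry[where n = n and p = p])
    have [measurable]: "(\<lambda>x. first_half n p a b (fst x) (fst (snd x))) \<in> measurable (?D \<Otimes>\<^sub>M tape_space) ?D"
      "(\<lambda>x. second_half n p a b (fst x) (fst (snd x))) \<in> measurable (?D \<Otimes>\<^sub>M tape_space) ?D"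
      unfolding first_half_def second_half_def
      by (rule measurable_dataI; use cell in measurable)+
    have [measurable]: "(\<lambda>x. (sdrop (n * p) (fst (snd x)), snd (snd x)))
        \<in> measurable (?D \<Otimes>\<^sub>M tape_space) tape_space"
      unfolding tape_space_def by measurable
    have f[measurable]: "?f \<in> borel_measurable (?D \<Otimes>\<^sub>M tape_space)"
      by measurable
    have "(\<integral>\<^sup>+x. ?f x \<partial>joint_law n p \<theta> z)
      = (\<integral>\<^sup>+N. \<integral>\<^sup>+\<omega>. ?f (shift 1 N, \<omega>) \<partial>randomness \<partial>?N)"
      unfolding nn_integral_joint_law[OF f]
      by (subst nn_integral_cluster_model) (simp_all add: shift_def)
    also have "\<dots> = (\<integral>\<^sup>+N. \<integral>\<^sup>+g. \<integral>\<^sup>+u. ?f (shift 1 N, (g, u)) \<partial>?U \<partial>?S \<partial>?N)"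
    proof (rule nn_integral_cong)
      fix N assume "N \<in> space ?N"
      then have "shift 1 N \<in> space ?D"
        by (rule measurable_space[rotated]) measurable
      then have [measurable]: "(\<lambda>\<omega>. ?f (shift 1 N, \<omega>)) \<in> borel_measurable (?S \<Otimes>\<^sub>M ?U)"
        using measurable_compose[OF measurable_Pair1' f] by (simp add: tape_sets cong: measurable_cong_sets)
      show "(\<integral>\<^sup>+\<omega>. ?f (shift 1 N, \<omega>) \<partial>randomness) = (\<integral>\<^sup>+g. \<integral>\<^sup>+u. ?f (shift 1 N, (g, u)) \<partial>?U \<partial>?S)"
        unfolding randomness_def
        by (rule nn_integral_iterated[OF U, symmetric]) measurable
    qed
    finally show ?thesis
      by (simp add: split_beta')
  qed
  also have "\<dots> = (\<integral>\<^sup>+N. \<integral>\<^sup>+W. \<integral>\<^sup>+g. \<integral>\<^sup>+u. F ((shift a (fst_rot (N, W)), (g, u)), shift b (snd_rot (N, W)))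
      \<partial>?U \<partial>?S \<partial>?N \<partial>?N)"
  proof (rule nn_integral_cong)
    fix N assume N: "N \<in> space ?N"
    have halves: "first_half n p a b (shift 1 N) g
        = shift a (fst_rot (N, \<lambda>i\<in>{..<n}. \<lambda>j\<in>{..<p}. g !! (i * p + j)))"
      "second_half n p a b (shift 1 N) g
        = shift b (snd_rot (N, \<lambda>i\<in>{..<n}. \<lambda>j\<in>{..<p}. g !! (i * p + j)))" for g
      by (auto simp: first_half_def second_half_def shift_def fst_rot_def snd_rot_def fun_eq_iff algebra_simps)
    have pair: "(\<lambda>W. (N, W)) \<in> measurable ?N (?N \<Otimes>\<^sub>M ?N)"
      by (rule measurable_Pair1'[OF N])
    have row: "(\<lambda>W. shift a (fst_rot (N, W))) \<in> measurable ?N ?D" "(\<lambda>W. shift b (snd_rot (N, W))) \<in> measurable ?N ?D"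
      using measurable_compose[OF measurable_compose[OF pair rot(1)] shift_N]
        measurable_compose[OF measurable_compose[OF pair rot(2)] shift_N] by simp_all
    have "(\<lambda>x. ((shift a (fst_rot (N, fst (fst x))), (snd (fst x), snd x)), shift b (snd_rot (N, fst (fst x)))))
      \<in> measurable ((?N \<Otimes>\<^sub>M ?S) \<Otimes>\<^sub>M ?U) ((?D \<Otimes>\<^sub>M tape_space) \<Otimes>\<^sub>M ?D)"
      unfolding measurable_cong_sets[OF refl sets_pair_measure_cong[OF sets_pair_measure_cong[OF refl tape_sets] refl]]
      by (intro measurable_Pair measurable_compose[OF _ row(1)] measurable_compose[OF _ row(2)])
         measurable
    from sigma_finite_measure.borel_measurable_nn_integral_fst
        [OF prob_space_imp_sigma_finite[OF U] measurable_compose[OF this F]]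
    have "(\<lambda>x. \<integral>\<^sup>+u. F ((shift a (fst_rot (N, fst x)), (snd x, u)), shift b (snd_rot (N, fst x))) \<partial>?U)
      \<in> borel_measurable (?N \<Otimes>\<^sub>M ?S)"
      by simp
    from nn_integral_gaussian_stream[OF this]
    show "(\<integral>\<^sup>+g. \<integral>\<^sup>+u. F ((first_half n p a b (shift 1 N) g, (sdrop (n * p) g, u)),
        second_half n p a b (shift 1 N) g) \<partial>?U \<partial>?S)
      = (\<integral>\<^sup>+W. \<integral>\<^sup>+g. \<integral>\<^sup>+u. F ((shift a (fst_rot (N, W)), (g, u)), shift b (snd_rot (N, W)))
          \<partial>?U \<partial>?S \<partial>?N)"
      by (simp only: halves fst_conv snd_conv)
  qed
  also have "\<dots> = (\<integral>\<^sup>+N. \<integral>\<^sup>+W. K (fst_rot (N, W), snd_rot (N, W)) \<partial>?N \<partial>?N)"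
    unfolding K_def randomness_def fst_conv snd_conv
    by (intro nn_integral_cong nn_integral_iterated[OF U])
       (use slice rot in \<open>auto simp: tape_sets[symmetric] space_pair_measure intro!: slice measurable_space[OF rot(1)] measurable_space[OF rot(2)]\<close>)
  also have "\<dots> = (\<integral>\<^sup>+x. K (fst_rot x, snd_rot x) \<partial>(?N \<Otimes>\<^sub>M ?N))"
    by (rule nn_integral_iterated[OF prob_space_gaussian_noise]) measurable
  also have "\<dots> = (\<integral>\<^sup>+x. K x \<partial>distr (?N \<Otimes>\<^sub>M ?N) (?N \<Otimes>\<^sub>M ?N) (\<lambda>x. (fst_rot x, snd_rot x)))"
    by (rule nn_integral_distr[symmetric]) measurable
  also have "distr (?N \<Otimes>\<^sub>M ?N) (?N \<Otimes>\<^sub>M ?N) (\<lambda>x. (fst_rot x, snd_rot x)) = ?N \<Otimes>\<^sub>M ?N"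
    using distr_noise_orthogonal[OF ab, where n = n and p = p] unfolding fst_rot_def snd_rot_def split_beta' .
  also have "(\<integral>\<^sup>+x. K x \<partial>(?N \<Otimes>\<^sub>M ?N)) = (\<integral>\<^sup>+N1. \<integral>\<^sup>+N2. K (N1, N2) \<partial>?N \<partial>?N)"
    by (rule nn_integral_iterated[OF prob_space_gaussian_noise K, symmetric])
  also have "\<dots> = (\<integral>\<^sup>+N1. \<integral>\<^sup>+\<omega>. \<integral>\<^sup>+N2. F ((shift a N1, \<omega>), shift b N2) \<partial>?N \<partial>randomness \<partial>?N)"
  proof (rule nn_integral_cong)
    fix N1 assume N1: "N1 \<in> space ?N"
    interpret NR: pair_sigma_finite randomness ?N
      by (simp add: pair_sigma_finite_def prob_space_imp_sigma_finite prob_space_gaussian_noise prob_space_randomness)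
    have [measurable]: "(\<lambda>_. N1) \<in> measurable M ?N" for M :: "'z measure"
      using N1 by simp
    show "(\<integral>\<^sup>+N2. K (N1, N2) \<partial>?N) = (\<integral>\<^sup>+\<omega>. \<integral>\<^sup>+N2. F ((shift a N1, \<omega>), shift b N2) \<partial>?N \<partial>randomness)"
      unfolding K_def fst_conv snd_conv by (rule NR.Fubini') (use N1 in measurable)
  qed
  also have "\<dots> = (\<integral>\<^sup>+x. \<integral>\<^sup>+Y. F (x, Y) \<partial>cluster_model n p (\<lambda>j. b * \<theta> j) z \<partial>joint_law n p (\<lambda>j. a * \<theta> j) z)"
  proof -
    have cluster: "(\<lambda>x. \<integral>\<^sup>+Y. F (x, Y) \<partial>cluster_model n p (\<lambda>j. b * \<theta> j) z)
      \<in> borel_measurable (?D \<Otimes>\<^sub>M tape_space)"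
      by (rule sigma_finite_measure.borel_measurable_nn_integral_fst
          [OF prob_space_imp_sigma_finite[OF prob_space_cluster_model]]) measurable
    have "(\<integral>\<^sup>+x. \<integral>\<^sup>+Y. F (x, Y) \<partial>cluster_model n p (\<lambda>j. b * \<theta> j) z \<partial>joint_law n p (\<lambda>j. a * \<theta> j) z)
      = (\<integral>\<^sup>+N1. \<integral>\<^sup>+\<omega>. \<integral>\<^sup>+Y. F ((shift a N1, \<omega>), Y) \<partial>cluster_model n p (\<lambda>j. b * \<theta> j) z \<partial>randomness \<partial>?N)"
      unfolding nn_integral_joint_law[OF cluster]
      by (subst nn_integral_cluster_model) (use cluster in \<open>simp_all add: shift_def\<close>)
    also have "\<dots> = (\<integral>\<^sup>+N1. \<integral>\<^sup>+\<omega>. \<integral>\<^sup>+N2. F ((shift a N1, \<omega>), shift b N2) \<partial>?N \<partial>randomness \<partial>?N)"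
    proof (intro nn_integral_cong)
      fix N1 \<omega> assume "N1 \<in> space ?N" "\<omega> \<in> space randomness"
      moreover from this have "shift a N1 \<in> space ?D"
        by (auto intro: measurable_space[of _ ?N])
      ultimately have "(shift a N1, \<omega>) \<in> space (?D \<Otimes>\<^sub>M tape_space)"
        using sets_eq_imp_space_eq[OF sets_randomness] by (simp add: space_pair_measure)
      from measurable_compose[OF measurable_Pair1'[OF this] F]
      show "(\<integral>\<^sup>+Y. F ((shift a N1, \<omega>), Y) \<partial>cluster_model n p (\<lambda>j. b * \<theta> j) z)
        = (\<integral>\<^sup>+N2. F ((shift a N1, \<omega>), shift b N2) \<partial>?N)"
        by (simp add: nn_integral_cluster_model shift_def)
    qed
    finally show ?thesis by simp
  qed
  finally show ?thesis .
qed

section \<open>Error probabilities of the mixture test\<close>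

text \<open>
  This is the independence of the columns. Rows are added one at a time: the integral over a new row
  of independent entries factors over the columns.
\<close>

lemma nn_integral_columns:
  fixes f :: "'j \<Rightarrow> ('i \<Rightarrow> 'a) \<Rightarrow> ennreal"
  assumes "prob_space M" "finite I" "finite J"
    and "\<And>j. j \<in> J \<Longrightarrow> f j \<in> borel_measurable (PiM I (\<lambda>_. M))"
  shows "(\<integral>\<^sup>+x. (\<Prod>j\<in>J. f j (\<lambda>i\<in>I. x i j)) \<partial>PiM I (\<lambda>_. PiM J (\<lambda>_. M)))
    = (\<Prod>j\<in>J. \<integral>\<^sup>+w. f j w \<partial>PiM I (\<lambda>_. M))"
  using assms(2,4)
proof (induction I arbitrary: f)
  case empty
  interpret M: product_sigma_finite "\<lambda>_. M" using assms(1) by (rule product_sigma_finite_const)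
  interpret R: product_sigma_finite "\<lambda>_. PiM J (\<lambda>_. M)"
    by (intro product_sigma_finite_const prob_space_PiM assms(1))
  show ?case
    by (subst R.nn_integral_empty) (simp_all add: M.nn_integral_empty restrict_def)
next
  case (insert k I)
  interpret M: product_sigma_finite "\<lambda>_. M" using assms(1) by (rule product_sigma_finite_const)
  interpret R: product_sigma_finite "\<lambda>_. PiM J (\<lambda>_. M)"
    by (intro product_sigma_finite_const prob_space_PiM assms(1))
  have upd: "(\<lambda>x. (fst x)(k := snd x)) \<in> measurable (PiM I (\<lambda>_. M) \<Otimes>\<^sub>M M) (PiM (insert k I) (\<lambda>_. M))"
    using measurable_add_dim[where I = I and i = k and M = "\<lambda>_. M"] by (simp add: split_beta')
  have column: "(\<lambda>x. \<lambda>i\<in>insert k I. x i j) \<in> measurable (PiM (insert k I) (\<lambda>_. PiM J (\<lambda>_. M))) (PiM (insert k I) (\<lambda>_. M))"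
    if "j \<in> J" for j
    using that measurable_compose[OF measurable_component_singleton[of _ "insert k I" "\<lambda>_. PiM J (\<lambda>_. M)"]
        measurable_component_singleton[of j J "\<lambda>_. M"]]
    by (intro measurable_restrict) auto
  have restrict: "(\<lambda>i\<in>insert k I. (x(k := r)) i j) = (\<lambda>i\<in>I. x i j)(k := r j)" for x :: "'i \<Rightarrow> 'j \<Rightarrow> 'a" and r j
    by (auto simp: fun_eq_iff)
  have "(\<integral>\<^sup>+x. (\<Prod>j\<in>J. f j (\<lambda>i\<in>insert k I. x i j)) \<partial>PiM (insert k I) (\<lambda>_. PiM J (\<lambda>_. M)))
    = (\<integral>\<^sup>+x. \<integral>\<^sup>+r. (\<Prod>j\<in>J. f j (\<lambda>i\<in>insert k I. (x(k := r)) i j)) \<partial>PiM J (\<lambda>_. M) \<partial>PiM I (\<lambda>_. PiM J (\<lambda>_. M)))"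
    using insert.hyps insert.prems
    by (intro R.product_nn_integral_insert borel_measurable_prod_ennreal measurable_compose[OF column]) auto
  also have "\<dots> = (\<integral>\<^sup>+x. (\<Prod>j\<in>J. \<integral>\<^sup>+y. f j ((\<lambda>i\<in>I. x i j)(k := y)) \<partial>M) \<partial>PiM I (\<lambda>_. PiM J (\<lambda>_. M)))"
  proof (rule nn_integral_cong)
    fix x assume x: "x \<in> space (PiM I (\<lambda>_. PiM J (\<lambda>_. M)))"
    have "(\<lambda>y. f j ((\<lambda>i\<in>I. x i j)(k := y))) \<in> borel_measurable M" if "j \<in> J" for j
    proof -
      have "(\<lambda>i\<in>I. x i j) \<in> space (PiM I (\<lambda>_. M))"
        using x that by (auto simp: space_PiM)
      from measurable_compose[OF measurable_component_update[OF this insert.hyps(2)] insert.prems[OF that]]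
      show ?thesis .
    qed
    then show "(\<integral>\<^sup>+r. (\<Prod>j\<in>J. f j (\<lambda>i\<in>insert k I. (x(k := r)) i j)) \<partial>PiM J (\<lambda>_. M))
      = (\<Prod>j\<in>J. \<integral>\<^sup>+y. f j ((\<lambda>i\<in>I. x i j)(k := y)) \<partial>M)"
      unfolding restrict using assms(3)
      by (intro M.product_nn_integral_prod[where f = "\<lambda>j y. f j ((\<lambda>i\<in>I. x i j)(k := y))"]) auto
  qed
  also have "\<dots> = (\<Prod>j\<in>J. \<integral>\<^sup>+w. \<integral>\<^sup>+y. f j (w(k := y)) \<partial>M \<partial>PiM I (\<lambda>_. M))"
  proof (rule insert.IH)
    fix j assume "j \<in> J"
    then show "(\<lambda>w. \<integral>\<^sup>+y. f j (w(k := y)) \<partial>M) \<in> borel_measurable (PiM I (\<lambda>_. M))"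
      using sigma_finite_measure.borel_measurable_nn_integral_fst
          [OF prob_space_imp_sigma_finite[OF assms(1)] measurable_compose[OF upd insert.prems]]
      by (simp only: fst_conv snd_conv)
  qed
  also have "\<dots> = (\<Prod>j\<in>J. \<integral>\<^sup>+w. f j w \<partial>PiM (insert k I) (\<lambda>_. M))"
    using insert.hyps insert.prems
    by (intro prod.cong M.product_nn_integral_insert[symmetric]) auto
  finally show ?case .
qed

lemma nn_integral_normal_density: "0 < \<sigma> \<Longrightarrow> (\<integral>\<^sup>+x. ennreal (normal_density \<mu> \<sigma> x) \<partial>lborel) = 1"
  using prob_space.emeasure_space_1[OF prob_space_normal_density, of \<sigma> \<mu>]
  by (simp add: emeasure_density)

lemma gaussian_exp: "(\<integral>\<^sup>+x. ennreal (exp (t * x)) \<partial>std_gaussian) = ennreal (exp (t\<^sup>2 / 2))"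
proof -
  have "std_normal_density x * exp (t * x) = exp (t\<^sup>2 / 2) * normal_density t 1 x" for x
  proof -
    have "- x\<^sup>2 / 2 + t * x = t\<^sup>2 / 2 + - (x - t)\<^sup>2 / 2"
      by (simp add: power2_eq_square field_simps)
    then have "exp (- x\<^sup>2 / 2) * exp (t * x) = exp (t\<^sup>2 / 2) * exp (- (x - t)\<^sup>2 / 2)"
      unfolding mult_exp_exp by simp
    then show ?thesis by (simp add: normal_density_def)
  qed
  then have "(\<integral>\<^sup>+x. ennreal (exp (t * x)) \<partial>std_gaussian)
    = (\<integral>\<^sup>+x. ennreal (exp (t\<^sup>2 / 2)) * ennreal (normal_density t 1 x) \<partial>lborel)"
    by (simp add: nn_integral_std_gaussian flip: ennreal_mult)
  also have "\<dots> = ennreal (exp (t\<^sup>2 / 2))"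
    by (simp add: nn_integral_cmult nn_integral_normal_density)
  finally show ?thesis .
qed

lemma gaussian_exp_square: "(\<integral>\<^sup>+x. ennreal (exp (x\<^sup>2 / 4)) \<partial>std_gaussian) = ennreal (sqrt 2)"
proof -
  have "std_normal_density x * exp (x\<^sup>2 / 4) = sqrt 2 * normal_density 0 (sqrt 2) x" for x
  proof -
    have "- x\<^sup>2 / 2 + x\<^sup>2 / 4 = - x\<^sup>2 / 4"
      by simp
    then have "exp (- x\<^sup>2 / 2) * exp (x\<^sup>2 / 4) = exp (- x\<^sup>2 / 4)"
      unfolding mult_exp_exp by simp
    then show ?thesis by (simp add: normal_density_def real_sqrt_mult field_simps)
  qed
  then have "(\<integral>\<^sup>+x. ennreal (exp (x\<^sup>2 / 4)) \<partial>std_gaussian)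
    = (\<integral>\<^sup>+x. ennreal (sqrt 2) * ennreal (normal_density 0 (sqrt 2) x) \<partial>lborel)"
    by (simp add: nn_integral_std_gaussian flip: ennreal_mult)
  also have "\<dots> = ennreal (sqrt 2)"
    by (simp add: nn_integral_cmult nn_integral_normal_density)
  finally show ?thesis .
qed

lemma gaussian_exp_linear:
  assumes "finite I"
  shows "(\<integral>\<^sup>+x. ennreal (exp (\<Sum>i\<in>I. c i * x i)) \<partial>PiM I (\<lambda>_. std_gaussian))
    = ennreal (exp ((\<Sum>i\<in>I. (c i)\<^sup>2) / 2))"
proof -
  interpret G: product_sigma_finite "\<lambda>_. std_gaussian"
    by (rule product_sigma_finite_const) (rule prob_space_std_gaussian)
  have "(\<integral>\<^sup>+x. ennreal (exp (\<Sum>i\<in>I. c i * x i)) \<partial>PiM I (\<lambda>_. std_gaussian))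
    = (\<integral>\<^sup>+x. (\<Prod>i\<in>I. ennreal (exp (c i * x i))) \<partial>PiM I (\<lambda>_. std_gaussian))"
    using assms by (simp add: exp_sum prod_ennreal)
  also have "\<dots> = (\<Prod>i\<in>I. \<integral>\<^sup>+x. ennreal (exp (c i * x)) \<partial>std_gaussian)"
    using assms by (intro G.product_nn_integral_prod) auto
  also have "\<dots> = ennreal (exp ((\<Sum>i\<in>I. (c i)\<^sup>2) / 2))"
    using assms by (simp add: gaussian_exp prod_ennreal exp_sum sum_divide_distrib)
  finally show ?thesis .
qed

text \<open>
  The square in the exponent is linearised by an auxiliary Gaussian variable:
  \<open>exp (t\<^sup>2 / 4)\<close> is the expectation of \<open>exp (\<xi> t / sqrt 2)\<close>.
\<close>

lemma gaussian_exp_linear_square: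
  assumes "finite I" "(\<Sum>i\<in>I. (c i)\<^sup>2) = 1"
  shows "(\<integral>\<^sup>+x. ennreal (exp ((\<Sum>i\<in>I. c i * x i)\<^sup>2 / 4)) \<partial>PiM I (\<lambda>_. std_gaussian)) = ennreal (sqrt 2)"
proof -
  let ?P = "PiM I (\<lambda>_. std_gaussian)"
  have P: "prob_space ?P"
    by (intro prob_space_PiM prob_space_std_gaussian)
  interpret GP: pair_sigma_finite std_gaussian ?P
    by (simp add: pair_sigma_finite_def prob_space_imp_sigma_finite P prob_space_std_gaussian)
  have "(\<integral>\<^sup>+x. ennreal (exp ((\<Sum>i\<in>I. c i * x i)\<^sup>2 / 4)) \<partial>?P)
    = (\<integral>\<^sup>+x. \<integral>\<^sup>+\<xi>. ennreal (exp (\<Sum>i\<in>I. (\<xi> / sqrt 2 * c i) * x i)) \<partial>std_gaussian \<partial>?P)"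
  proof (rule nn_integral_cong)
    fix x
    have "(\<Sum>i\<in>I. (\<xi> / sqrt 2 * c i) * x i) = ((\<Sum>i\<in>I. c i * x i) / sqrt 2) * \<xi>" for \<xi>
      by (simp add: sum_distrib_left sum_divide_distrib sum_distrib_right algebra_simps)
    then show "ennreal (exp ((\<Sum>i\<in>I. c i * x i)\<^sup>2 / 4))
      = (\<integral>\<^sup>+\<xi>. ennreal (exp (\<Sum>i\<in>I. (\<xi> / sqrt 2 * c i) * x i)) \<partial>std_gaussian)"
      by (simp only: gaussian_exp) (simp add: power_divide)
  qed
  also have "\<dots> = (\<integral>\<^sup>+\<xi>. \<integral>\<^sup>+x. ennreal (exp (\<Sum>i\<in>I. (\<xi> / sqrt 2 * c i) * x i)) \<partial>?P \<partial>std_gaussian)"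
    by (rule GP.Fubini') measurable
  also have "\<dots> = (\<integral>\<^sup>+\<xi>. ennreal (exp (\<xi>\<^sup>2 / 4)) \<partial>std_gaussian)"
    unfolding gaussian_exp_linear[OF assms(1)]
    using assms(2) by (simp add: power_mult_distrib power_divide flip: sum_distrib_left sum_divide_distrib)
  finally show ?thesis
    by (simp add: gaussian_exp_square)
qed

definition log_sparsity :: "nat \<Rightarrow> nat \<Rightarrow> real" where
  "log_sparsity p s = real s * ln (exp 1 * real p / real s)"

lemma log_sparsity_ge:
  assumes "1 \<le> s" "s < p"
  shows "real s \<le> log_sparsity p s" "1 \<le> ln (exp 1 * real p / real s)"
proof -
  have "ln (exp 1) \<le> ln (exp 1 * real p / real s)"
    using assms by (intro ln_mono) (auto simp: field_simps)
  then show L: "1 \<le> ln (exp 1 * real p / real s)" by simp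
  show "real s \<le> log_sparsity p s"
    unfolding log_sparsity_def using mult_left_mono[OF L, of "real s"] by simp
qed

lemma exp_ln_sparsity:
  assumes "1 \<le> s" "s < p"
  shows "real s / (exp 1 * real p) = exp (- ln (exp 1 * real p / real s))"
  using assms by (simp add: exp_minus inverse_eq_divide)

lemma rejects_iff:
  "s < p \<Longrightarrow> rejects n p s \<eta> Y \<longleftrightarrow> exp (2 * log_sparsity p s) < mixture_statistic n p s \<eta> Y"
  by (simp add: rejects_def log_sparsity_def)

lemma measurable_mixture_statistic:
  assumes "\<And>i. i < n \<Longrightarrow> (\<lambda>w. \<eta> w i) \<in> borel_measurable M"
    and "\<And>i j. i < n \<Longrightarrow> j < p \<Longrightarrow> (\<lambda>w. Y w i j) \<in> borel_measurable M"
  shows "(\<lambda>w. mixture_statistic n p s (\<eta> w) (Y w)) \<in> borel_measurable M"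
proof -
  have "(\<lambda>w. \<Sum>i<n. \<eta> w i * Y w i j) \<in> borel_measurable M" if "j < p" for j
    using assms that by (intro borel_measurable_sum borel_measurable_times) auto
  then show ?thesis
    unfolding mixture_statistic_def
    by (intro borel_measurable_prod borel_measurable_add borel_measurable_times borel_measurable_const
        borel_measurable_exp[THEN measurable_compose[rotated]] borel_measurable_divide borel_measurable_power) auto
qed

lemma measurable_rejects:
  assumes "\<And>i. i < n \<Longrightarrow> (\<lambda>w. \<eta> w i) \<in> borel_measurable M"
    and "\<And>i j. i < n \<Longrightarrow> j < p \<Longrightarrow> (\<lambda>w. Y w i j) \<in> borel_measurable M"
  shows "Measurable.pred M (\<lambda>w. rejects n p s (\<eta> w) (Y w))"
proof -
  have [measurable]: "(\<lambda>w. mixture_statistic n p s (\<eta> w) (Y w)) \<in> borel_measurable M"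
    by (rule measurable_mixture_statistic; fact)
  show ?thesis unfolding rejects_def by measurable
qed

lemma mixture_statistic_restrict:
  "mixture_statistic n p s \<eta> (\<lambda>i\<in>{..<n}. \<lambda>j\<in>{..<p}. Y i j) = mixture_statistic n p s \<eta> Y"
  unfolding mixture_statistic_def by (intro prod.cong) auto

lemma rejects_restrict:
  "rejects n p s \<eta> (\<lambda>i\<in>{..<n}. \<lambda>j\<in>{..<p}. Y i j) = rejects n p s \<eta> Y"
  by (simp add: rejects_def mixture_statistic_restrict)

lemma measurable_noise_column:
  assumes "j < p"
  shows "(\<lambda>N. \<lambda>i\<in>{..<n}. N i j) \<in> measurable (gaussian_noise n p) (PiM {..<n} (\<lambda>_. std_gaussian))"
proof (rule measurable_restrict)
  fix i assume "i \<in> {..<n}"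
  then have "(\<lambda>N. N i j) \<in> borel_measurable (data_space n p)"
    using assms by (auto intro: measurable_data_entry)
  then show "(\<lambda>N. N i j) \<in> measurable (gaussian_noise n p) std_gaussian"
    by (simp cong: measurable_cong_sets add: sets_gaussian_noise)
qed

lemma sum_square_scaled_signs:
  fixes \<eta> :: "nat \<Rightarrow> real"
  assumes "1 \<le> n" "\<And>i. i < n \<Longrightarrow> (\<eta> i)\<^sup>2 = 1"
  shows "(\<Sum>i<n. (\<eta> i / sqrt (real n))\<^sup>2) = 1"
proof -
  have "(\<Sum>i<n. (\<eta> i / sqrt (real n))\<^sup>2) = (\<Sum>i<n. 1 / real n)"
    using assms by (intro sum.cong) (auto simp: power_divide)
  then show ?thesis using assms(1) by simp
qed

text \<open>
  Under the null hypothesis each factor of the statistic has expectation at most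
  \<open>exp (sqrt 2 s / (e p))\<close>, so the statistic has expectation at most \<open>exp s \<le> exp T\<close> for
  \<open>T = s ln (e p / s)\<close>, and Markov's inequality applies to the threshold \<open>exp (2 T)\<close>.
\<close>

lemma type_I_error:
  assumes n: "1 \<le> n" and s: "1 \<le> s" "s < p" and \<eta>: "\<And>i. i < n \<Longrightarrow> (\<eta> i)\<^sup>2 = 1"
  shows "(\<integral>\<^sup>+Y. ennreal (of_bool (rejects n p s \<eta> Y)) \<partial>cluster_model n p (\<lambda>_. 0) z)
    \<le> ennreal (exp (- log_sparsity p s))"
proof -
  define q where "q = real s / (exp 1 * real p)"
  define c where "c i = \<eta> i / sqrt (real n)" for i
  define f where "f w = ennreal (1 + q * exp ((\<Sum>i<n. c i * w i)\<^sup>2 / 4))" for w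
  let ?P = "PiM {..<n} (\<lambda>_. std_gaussian)"
  have q: "0 \<le> q" by (simp add: q_def)
  interpret P: prob_space ?P
    by (intro prob_space_PiM prob_space_std_gaussian)
  have c: "(\<Sum>i<n. (c i)\<^sup>2) = 1"
    unfolding c_def using n \<eta> by (rule sum_square_scaled_signs)
  have f: "f \<in> borel_measurable ?P"
    unfolding f_def by measurable
  have statistic: "ennreal (mixture_statistic n p s \<eta> (\<lambda>i\<in>{..<n}. \<lambda>j\<in>{..<p}. z i * 0 + N i j))
      = (\<Prod>j<p. f (\<lambda>i\<in>{..<n}. N i j))" for N
  proof -
    have "f (\<lambda>i\<in>{..<n}. N i j)
      = ennreal (1 + q * exp ((\<Sum>i<n. \<eta> i * N i j)\<^sup>2 / (4 * real n)))" for j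
    proof -
      have "(\<Sum>i<n. c i * (\<lambda>i\<in>{..<n}. N i j) i) = (\<Sum>i<n. \<eta> i * N i j) / sqrt (real n)"
        by (simp add: c_def sum_divide_distrib)
      then have "(\<Sum>i<n. c i * (\<lambda>i\<in>{..<n}. N i j) i)\<^sup>2 / 4 = (\<Sum>i<n. \<eta> i * N i j)\<^sup>2 / (4 * real n)"
        by (simp add: power_divide)
      then show ?thesis
        unfolding f_def by (simp only:)
    qed
    then have "(\<Prod>j<p. f (\<lambda>i\<in>{..<n}. N i j))
      = (\<Prod>j<p. ennreal (1 + q * exp ((\<Sum>i<n. \<eta> i * N i j)\<^sup>2 / (4 * real n))))"
      by (simp only:)
    also have "\<dots> = ennreal (\<Prod>j<p. 1 + q * exp ((\<Sum>i<n. \<eta> i * N i j)\<^sup>2 / (4 * real n)))"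
      using q by (intro prod_ennreal) simp
    finally have "(\<Prod>j<p. f (\<lambda>i\<in>{..<n}. N i j))
      = ennreal (\<Prod>j<p. 1 + q * exp ((\<Sum>i<n. \<eta> i * N i j)\<^sup>2 / (4 * real n)))" .
    then show ?thesis
      by (simp add: mixture_statistic_restrict mixture_statistic_def q_def)
  qed
  have "(\<integral>\<^sup>+w. f w \<partial>?P) = ennreal (1 + q * sqrt 2)"
  proof -
    have "(\<integral>\<^sup>+w. f w \<partial>?P) = (\<integral>\<^sup>+w. 1 + ennreal q * ennreal (exp ((\<Sum>i<n. c i * w i)\<^sup>2 / 4)) \<partial>?P)"
      using q by (simp add: f_def ennreal_mult flip: ennreal_1)
    also have "\<dots> = 1 + ennreal q * ennreal (sqrt 2)"
      using c by (simp add: nn_integral_add nn_integral_cmult gaussian_exp_linear_square P.emeasure_space_1)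
    finally show ?thesis
      using q by (simp add: ennreal_mult flip: ennreal_1)
  qed
  then have "(\<integral>\<^sup>+N. (\<Prod>j<p. f (\<lambda>i\<in>{..<n}. N i j)) \<partial>gaussian_noise n p) = (\<Prod>j<p. ennreal (1 + q * sqrt 2))"
    unfolding gaussian_noise_def
    using nn_integral_columns[OF prob_space_std_gaussian, of "{..<n}" "{..<p}" "\<lambda>_. f"] f by simp
  also have "\<dots> = ennreal ((1 + q * sqrt 2) ^ p)"
    using q by (simp add: ennreal_power del: ennreal_plus)
  also have "(1 + q * sqrt 2) ^ p \<le> exp (log_sparsity p s)"
  proof -
    have "(1 + q * sqrt 2) ^ p \<le> exp (q * sqrt 2) ^ p"
      using q by (intro power_mono) (auto simp: exp_ge_add_one_self)
    also have "\<dots> = exp (real p * (q * sqrt 2))"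
      by (simp add: exp_of_nat_mult)
    also have "real p * (q * sqrt 2) = real s * (sqrt 2 / exp 1)"
      using s by (simp add: q_def)
    also have "\<dots> \<le> real s * 1"
    proof (intro mult_left_mono)
      have "sqrt 2 \<le> 2"
        by (intro real_le_lsqrt) auto
      also have "(2 :: real) \<le> exp 1"
        using exp_ge_add_one_self[of "1 :: real"] by simp
      finally show "sqrt 2 / exp 1 \<le> 1" by simp
    qed simp
    also have "\<dots> \<le> log_sparsity p s"
      using log_sparsity_ge[OF s] by simp
    finally show ?thesis by simp
  qed
  finally have expectation: "(\<integral>\<^sup>+N. (\<Prod>j<p. f (\<lambda>i\<in>{..<n}. N i j)) \<partial>gaussian_noise n p)
      \<le> ennreal (exp (log_sparsity p s))"
    by (simp add: ennreal_leI)
  have f_noise: "(\<lambda>N. \<Prod>j<p. f (\<lambda>i\<in>{..<n}. N i j)) \<in> borel_measurable (gaussian_noise n p)"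
    by (intro borel_measurable_prod_ennreal measurable_compose[OF measurable_noise_column])
       (auto simp: f_def)
  have "(\<integral>\<^sup>+Y. ennreal (of_bool (rejects n p s \<eta> Y)) \<partial>cluster_model n p (\<lambda>_. 0) z)
    = (\<integral>\<^sup>+N. ennreal (of_bool (rejects n p s \<eta> (\<lambda>i\<in>{..<n}. \<lambda>j\<in>{..<p}. z i * 0 + N i j))) \<partial>gaussian_noise n p)"
  proof (rule nn_integral_cluster_model)
    have [measurable]: "Measurable.pred (data_space n p) (rejects n p s \<eta>)"
      by (rule measurable_rejects) (auto intro: measurable_data_entry)
    show "(\<lambda>Y. ennreal (of_bool (rejects n p s \<eta> Y))) \<in> borel_measurable (data_space n p)"
      by measurable
  qed
  also have "\<dots> \<le> (\<integral>\<^sup>+N. ennreal (exp (- 2 * log_sparsity p s)) * (\<Prod>j<p. f (\<lambda>i\<in>{..<n}. N i j)) \<partial>gaussian_noise n p)"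
  proof (intro nn_integral_mono)
    fix N
    let ?t = "mixture_statistic n p s \<eta> (\<lambda>i\<in>{..<n}. \<lambda>j\<in>{..<p}. z i * 0 + N i j)"
    have "of_bool (rejects n p s \<eta> (\<lambda>i\<in>{..<n}. \<lambda>j\<in>{..<p}. z i * 0 + N i j))
        \<le> exp (- 2 * log_sparsity p s) * ?t"
    proof (cases "rejects n p s \<eta> (\<lambda>i\<in>{..<n}. \<lambda>j\<in>{..<p}. z i * 0 + N i j)")
      case True
      then have "exp (- 2 * log_sparsity p s) * exp (2 * log_sparsity p s) \<le> exp (- 2 * log_sparsity p s) * ?t"
        unfolding rejects_iff[OF s(2)] by (intro mult_left_mono) auto
      then show ?thesis
        unfolding mult_exp_exp using True by simp
    next
      case False
      then show ?thesis
        by (auto simp: mixture_statistic_def intro!: mult_nonneg_nonneg prod_nonneg add_nonneg_nonneg)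
    qed
    then show "ennreal (of_bool (rejects n p s \<eta> (\<lambda>i\<in>{..<n}. \<lambda>j\<in>{..<p}. z i * 0 + N i j)))
      \<le> ennreal (exp (- 2 * log_sparsity p s)) * (\<Prod>j<p. f (\<lambda>i\<in>{..<n}. N i j))"
      unfolding statistic[symmetric] by (subst ennreal_mult'[symmetric]) (auto intro: ennreal_leI)
  qed
  also have "\<dots> = ennreal (exp (- 2 * log_sparsity p s)) * (\<integral>\<^sup>+N. (\<Prod>j<p. f (\<lambda>i\<in>{..<n}. N i j)) \<partial>gaussian_noise n p)"
    by (rule nn_integral_cmult[OF f_noise])
  also have "\<dots> \<le> ennreal (exp (- 2 * log_sparsity p s)) * ennreal (exp (log_sparsity p s))"
    by (intro mult_left_mono expectation) simp
  also have "\<dots> = ennreal (exp (- log_sparsity p s))"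
    by (simp add: mult_exp_exp flip: ennreal_mult)
  finally show ?thesis .
qed

text \<open>
  Keeping only the coordinates of a sparse direction \<open>v\<close>, and there only the exponential part of
  each factor, costs a factor \<open>(s / (e p))\<^sup>s\<close>; by the Cauchy--Schwarz inequality the remaining
  exponent dominates the squared projection on \<open>v\<close>.
\<close>

lemma mixture_statistic_large:
  assumes n: "1 \<le> n" and s: "1 \<le> s" "s < p"
    and v: "l0_norm p v \<le> s" "(\<Sum>j<p. (v j)\<^sup>2) = 1"
    and large: "12 * log_sparsity p s < (\<Sum>j<p. v j * ((\<Sum>i<n. \<eta> i * Y i j) / sqrt (real n)))\<^sup>2"
  shows "exp (2 * log_sparsity p s) < mixture_statistic n p s \<eta> Y"
proof -
  define W where "W j = (\<Sum>i<n. \<eta> i * Y i j) / sqrt (real n)" for j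
  define S where "S = {j. j < p \<and> v j \<noteq> 0}"
  define l where "l = ln (exp 1 * real p / real s)"
  define q where "q = exp (- l)"
  have S: "finite S" "S \<subseteq> {..<p}" "card S \<le> s"
    using v(1) by (auto simp: S_def l0_norm_def)
  have l: "1 \<le> l" "log_sparsity p s = real s * l"
    using log_sparsity_ge[OF s] by (auto simp: l_def log_sparsity_def)
  have F: "mixture_statistic n p s \<eta> Y = (\<Prod>j<p. 1 + q * exp ((W j)\<^sup>2 / 4))"
    unfolding mixture_statistic_def exp_ln_sparsity[OF s] q_def l_def
    by (intro prod.cong) (auto simp: W_def power_divide mult.commute)
  have restrict: "(\<Sum>j<p. v j * W j) = (\<Sum>j\<in>S. v j * W j)" "(\<Sum>j<p. (v j)\<^sup>2) = (\<Sum>j\<in>S. (v j)\<^sup>2)"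
    by (rule sum.mono_neutral_right; auto simp: S_def)+
  have "12 * log_sparsity p s < (\<Sum>j\<in>S. v j * W j)\<^sup>2"
    using large unfolding W_def[symmetric] restrict .
  also have "\<dots> \<le> (\<Sum>j\<in>S. (v j)\<^sup>2) * (\<Sum>j\<in>S. (W j)\<^sup>2)"
    by (rule Cauchy_Schwarz_ineq_sum)
  also have "\<dots> = (\<Sum>j\<in>S. (W j)\<^sup>2)"
    using v(2) restrict by simp
  finally have energy: "3 * (real s * l) < (\<Sum>j\<in>S. (W j)\<^sup>2 / 4)"
    unfolding l(2) sum_divide_distrib[symmetric] by simp
  have "2 * log_sparsity p s < (\<Sum>j\<in>S. - l + (W j)\<^sup>2 / 4)"
  proof -
    have "real (card S) * l \<le> real s * l"
      using S(3) l(1) by (intro mult_right_mono) auto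
    then show ?thesis
      using energy unfolding l(2) by (simp add: sum_subtractf)
  qed
  then have "exp (2 * log_sparsity p s) < exp (\<Sum>j\<in>S. - l + (W j)\<^sup>2 / 4)"
    by simp
  also have "\<dots> = (\<Prod>j\<in>S. q * exp ((W j)\<^sup>2 / 4))"
    using S(1) by (simp add: exp_sum q_def mult_exp_exp)
  also have "\<dots> \<le> (\<Prod>j\<in>S. 1 + q * exp ((W j)\<^sup>2 / 4))"
    by (intro prod_mono) (auto simp: q_def)
  also have "\<dots> \<le> (\<Prod>j<p. 1 + q * exp ((W j)\<^sup>2 / 4))"
    using S by (intro prod_mono2) (auto simp: q_def add_increasing2)
  finally show ?thesis unfolding F .
qed

text \<open>
  The projection on the direction of the signal is at least \<open>sqrt (24 T)\<close> plus a standard Gaussian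
  variable, where \<open>T = s ln (e p / s)\<close>. This variable is below \<open>- sqrt (2 T)\<close> with probability at
  most \<open>exp (- T)\<close>, and otherwise the projection is large enough for a rejection because
  \<open>(sqrt 24 - sqrt 2)\<^sup>2 > 12\<close>.
\<close>

lemma type_II_error:
  assumes n: "1 \<le> n" and s: "1 \<le> s" "s < p" and \<eta>: "\<And>i. i < n \<Longrightarrow> (\<eta> i)\<^sup>2 = 1"
    and sparse: "l0_norm p \<theta> \<le> s"
    and signal: "24 * log_sparsity p s \<le> (\<Sum>i<n. \<eta> i * z i)\<^sup>2 * (\<Sum>j<p. (\<theta> j)\<^sup>2) / real n"
  shows "(\<integral>\<^sup>+Y. ennreal (of_bool (\<not> rejects n p s \<eta> Y)) \<partial>cluster_model n p \<theta> z)
    \<le> ennreal (exp (- log_sparsity p s))"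
proof -
  define T where "T = log_sparsity p s"
  define c where "c i = \<eta> i / sqrt (real n)" for i
  define \<mu> where "\<mu> j = (\<Sum>i<n. c i * z i) * \<theta> j" for j
  define r where "r = sqrt (\<Sum>j<p. (\<mu> j)\<^sup>2)"
  define v where "v j = \<mu> j / r" for j
  define x where "x = sqrt (2 * T)"
  define Z where "Z N = (\<Sum>j<p. \<Sum>i<n. v j * c i * N i j)" for N :: "nat \<Rightarrow> nat \<Rightarrow> real"
  define f where "f j w = ennreal (exp (\<Sum>i<n. (- x * v j * c i) * w i))" for j and w :: "nat \<Rightarrow> real"
  have T: "0 < T"
    using log_sparsity_ge[OF s] s by (simp add: T_def)
  have x2: "x\<^sup>2 = 2 * T"
    using T by (simp add: x_def)
  have c: "(\<Sum>i<n. (c i)\<^sup>2) = 1"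
    unfolding c_def using n \<eta> by (rule sum_square_scaled_signs)
  have "(\<Sum>j<p. (\<mu> j)\<^sup>2) = (\<Sum>i<n. \<eta> i * z i)\<^sup>2 * (\<Sum>j<p. (\<theta> j)\<^sup>2) / real n"
  proof -
    have "(\<Sum>i<n. c i * z i) = (\<Sum>i<n. \<eta> i * z i) / sqrt (real n)"
      by (simp add: c_def sum_divide_distrib)
    then show ?thesis
      unfolding \<mu>_def power_mult_distrib sum_distrib_left[symmetric] by (simp add: power_divide)
  qed
  then have r2: "24 * T \<le> r\<^sup>2" and r2': "r\<^sup>2 = (\<Sum>j<p. (\<mu> j)\<^sup>2)"
    using signal by (simp_all add: r_def T_def sum_nonneg)
  have r: "sqrt (24 * T) \<le> r" "0 < r"
  proof -
    have "0 \<le> r"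
      by (simp add: r_def sum_nonneg)
    then show "sqrt (24 * T) \<le> r"
      using r2 by (intro real_le_lsqrt)
    moreover have "0 < sqrt (24 * T)"
      using T by simp
    ultimately show "0 < r" by linarith
  qed
  have v: "(\<Sum>j<p. (v j)\<^sup>2) = 1" "(\<Sum>j<p. v j * \<mu> j) = r"
  proof -
    have "(\<Sum>j<p. (v j)\<^sup>2) = (\<Sum>j<p. (\<mu> j)\<^sup>2) / r\<^sup>2"
      by (simp add: v_def power_divide sum_divide_distrib)
    then show "(\<Sum>j<p. (v j)\<^sup>2) = 1"
      using r(2) unfolding r2'[symmetric] by simp
    have "(\<Sum>j<p. v j * \<mu> j) = (\<Sum>j<p. (\<mu> j)\<^sup>2) / r"
      by (simp add: v_def power2_eq_square sum_divide_distrib)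
    then show "(\<Sum>j<p. v j * \<mu> j) = r"
      using r(2) unfolding r2'[symmetric] by (simp add: power2_eq_square)
  qed
  have v_sparse: "l0_norm p v \<le> s"
  proof -
    have "{j. j < p \<and> v j \<noteq> 0} \<subseteq> {j. j < p \<and> \<theta> j \<noteq> 0}"
      by (auto simp: v_def \<mu>_def)
    then have "card {j. j < p \<and> v j \<noteq> 0} \<le> card {j. j < p \<and> \<theta> j \<noteq> 0}"
      by (intro card_mono) auto
    then show ?thesis using sparse by (simp add: l0_norm_def)
  qed
  have accept: "Z N \<le> - x" if "\<not> rejects n p s \<eta> (\<lambda>i\<in>{..<n}. \<lambda>j\<in>{..<p}. z i * \<theta> j + N i j)" for N
  proof (rule ccontr)
    assume "\<not> Z N \<le> - x"
    have "(\<Sum>j<p. v j * ((\<Sum>i<n. \<eta> i * (z i * \<theta> j + N i j)) / sqrt (real n))) = r + Z N"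
    proof -
      have "(\<Sum>i<n. \<eta> i * (z i * \<theta> j + N i j)) / sqrt (real n) = \<mu> j + (\<Sum>i<n. c i * N i j)" for j
        unfolding \<mu>_def c_def sum_distrib_right sum_divide_distrib sum.distrib[symmetric]
        by (intro sum.cong refl) (simp add: add_divide_distrib algebra_simps)
      then have "(\<Sum>j<p. v j * ((\<Sum>i<n. \<eta> i * (z i * \<theta> j + N i j)) / sqrt (real n)))
          = (\<Sum>j<p. v j * \<mu> j) + (\<Sum>j<p. v j * (\<Sum>i<n. c i * N i j))"
        by (simp add: distrib_left sum.distrib)
      also have "(\<Sum>j<p. v j * (\<Sum>i<n. c i * N i j)) = Z N"
        by (simp add: Z_def sum_distrib_left mult.assoc)
      finally show ?thesis using v(2) by simp
    qed
    moreover have "12 * T < (r + Z N)\<^sup>2"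
    proof -
      have "12 * T < (sqrt (24 * T) - x)\<^sup>2"
      proof -
        have "sqrt (24 * T) * x = sqrt (48 * T\<^sup>2)"
          by (simp add: x_def power2_eq_square flip: real_sqrt_mult)
        also have "\<dots> = sqrt 48 * T"
          using T by (simp add: real_sqrt_mult)
        also have "sqrt 48 < (7 :: real)"
          by (intro real_less_lsqrt) auto
        finally have "sqrt (24 * T) * x < 7 * T"
          using T by simp
        then show ?thesis
          using T x2 by (simp add: power2_diff mult.commute[of x])
      qed
      also have "\<dots> \<le> (r + Z N)\<^sup>2"
      proof (rule power_mono)
        show "sqrt (24 * T) - x \<le> r + Z N"
          using r(1) \<open>\<not> Z N \<le> - x\<close> by simp
        show "0 \<le> sqrt (24 * T) - x"
          using T by (simp add: x_def)
      qed
      finally show ?thesis .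
    qed
    ultimately have "exp (2 * log_sparsity p s) < mixture_statistic n p s \<eta> (\<lambda>i j. z i * \<theta> j + N i j)"
      using n s v_sparse v(1) by (intro mixture_statistic_large[where v = v]) (simp_all add: T_def)
    then show False
      using that unfolding rejects_restrict rejects_iff[OF s(2)] by simp
  qed
  have "(\<integral>\<^sup>+N. (\<Prod>j<p. f j (\<lambda>i\<in>{..<n}. N i j)) \<partial>gaussian_noise n p)
    = (\<Prod>j<p. \<integral>\<^sup>+w. f j w \<partial>PiM {..<n} (\<lambda>_. std_gaussian))"
    unfolding gaussian_noise_def
    by (rule nn_integral_columns[OF prob_space_std_gaussian]) (auto simp: f_def)
  also have "\<dots> = (\<Prod>j<p. ennreal (exp (T * (v j)\<^sup>2)))"
  proof (intro prod.cong refl)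
    fix j
    have "(\<Sum>i<n. (- x * v j * c i)\<^sup>2) = x\<^sup>2 * (v j)\<^sup>2 * (\<Sum>i<n. (c i)\<^sup>2)"
      by (simp add: power_mult_distrib sum_distrib_left)
    then show "(\<integral>\<^sup>+w. f j w \<partial>PiM {..<n} (\<lambda>_. std_gaussian)) = ennreal (exp (T * (v j)\<^sup>2))"
      unfolding f_def gaussian_exp_linear[OF finite_lessThan] using c x2 by simp
  qed
  also have "\<dots> = ennreal (exp T)"
    using v(1) by (simp add: prod_ennreal flip: exp_sum sum_distrib_left)
  finally have mgf: "(\<integral>\<^sup>+N. (\<Prod>j<p. f j (\<lambda>i\<in>{..<n}. N i j)) \<partial>gaussian_noise n p) = ennreal (exp T)" .
  have exp_Z: "(\<Prod>j<p. f j (\<lambda>i\<in>{..<n}. N i j)) = ennreal (exp (- x * Z N))" for N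
  proof -
    have "(\<Prod>j<p. f j (\<lambda>i\<in>{..<n}. N i j)) = ennreal (exp (\<Sum>j<p. \<Sum>i<n. (- x * v j * c i) * N i j))"
      by (simp add: f_def prod_ennreal exp_sum prod_nonneg)
    also have "(\<Sum>j<p. \<Sum>i<n. (- x * v j * c i) * N i j) = - x * Z N"
      unfolding Z_def sum_distrib_left by (intro sum.cong) (auto simp: algebra_simps)
    finally show ?thesis .
  qed
  have f_noise: "(\<lambda>N. \<Prod>j<p. f j (\<lambda>i\<in>{..<n}. N i j)) \<in> borel_measurable (gaussian_noise n p)"
    by (intro borel_measurable_prod_ennreal measurable_compose[OF measurable_noise_column])
       (auto simp: f_def)
  have "(\<integral>\<^sup>+Y. ennreal (of_bool (\<not> rejects n p s \<eta> Y)) \<partial>cluster_model n p \<theta> z)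
    = (\<integral>\<^sup>+N. ennreal (of_bool (\<not> rejects n p s \<eta> (\<lambda>i\<in>{..<n}. \<lambda>j\<in>{..<p}. z i * \<theta> j + N i j))) \<partial>gaussian_noise n p)"
  proof (rule nn_integral_cluster_model)
    have [measurable]: "Measurable.pred (data_space n p) (rejects n p s \<eta>)"
      by (rule measurable_rejects) (auto intro: measurable_data_entry)
    show "(\<lambda>Y. ennreal (of_bool (\<not> rejects n p s \<eta> Y))) \<in> borel_measurable (data_space n p)"
      by measurable
  qed
  also have "\<dots> \<le> (\<integral>\<^sup>+N. ennreal (exp (- x\<^sup>2)) * (\<Prod>j<p. f j (\<lambda>i\<in>{..<n}. N i j)) \<partial>gaussian_noise n p)"
  proof (intro nn_integral_mono)
    fix N
    have "of_bool (\<not> rejects n p s \<eta> (\<lambda>i\<in>{..<n}. \<lambda>j\<in>{..<p}. z i * \<theta> j + N i j)) \<le> exp (- x\<^sup>2 + - x * Z N)"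
    proof (cases "rejects n p s \<eta> (\<lambda>i\<in>{..<n}. \<lambda>j\<in>{..<p}. z i * \<theta> j + N i j)")
      case False
      have "x * Z N \<le> x * - x"
        using accept[OF False] T by (intro mult_left_mono) (auto simp: x_def)
      then have "0 \<le> - x\<^sup>2 + - x * Z N"
        by (simp add: power2_eq_square)
      then show ?thesis using False by simp
    qed simp
    then show "ennreal (of_bool (\<not> rejects n p s \<eta> (\<lambda>i\<in>{..<n}. \<lambda>j\<in>{..<p}. z i * \<theta> j + N i j)))
      \<le> ennreal (exp (- x\<^sup>2)) * (\<Prod>j<p. f j (\<lambda>i\<in>{..<n}. N i j))"
      unfolding exp_Z exp_add by (subst ennreal_mult[symmetric]) (auto intro: ennreal_leI)
  qed
  also have "\<dots> = ennreal (exp (- x\<^sup>2)) * ennreal (exp T)"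
    unfolding mgf[symmetric] by (rule nn_integral_cmult[OF f_noise])
  also have "\<dots> = ennreal (exp (- log_sparsity p s))"
    unfolding x2 by (simp add: mult_exp_exp T_def flip: ennreal_mult)
  finally show ?thesis .
qed

section \<open>The reduction\<close>

lemma misclust_greater_iff:
  "\<delta> < misclust n \<eta> z \<longleftrightarrow>
    (\<forall>\<pi>\<in>{-1, 1}. \<delta> < 1 / real n * (\<Sum>i<n. of_bool (\<pi> * \<eta> i \<noteq> z i)))"
  unfolding misclust_def by (subst Min_gr_iff) auto

text \<open>
  An agreement of two signs contributes 1 to the inner product and a disagreement \<open>- 1\<close>. The global
  sign that the misclustering error leaves undetermined is lost in the absolute value.
\<close>

lemma misclust_le_imp_correlated:
  assumes n: "1 \<le> n" and signs: "\<eta> \<in> {..<n} \<rightarrow> {-1, 1}" "z \<in> {..<n} \<rightarrow> {-1, 1}"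
    and "misclust n \<eta> z \<le> \<delta>"
  shows "(1 - 2 * \<delta>) * real n \<le> \<bar>\<Sum>i<n. \<eta> i * z i\<bar>"
proof -
  have "\<not> \<delta> < misclust n \<eta> z"
    using assms(4) by simp
  then obtain \<pi> :: real where \<pi>: "\<pi> \<in> {-1, 1}"
    "1 / real n * (\<Sum>i<n. of_bool (\<pi> * \<eta> i \<noteq> z i)) \<le> \<delta>"
    unfolding misclust_greater_iff Ball_def not_all not_imp not_less by blast
  have "\<pi> * (\<eta> i * z i) = 1 - 2 * of_bool (\<pi> * \<eta> i \<noteq> z i)" if "i < n" for i
  proof -
    have "\<eta> i \<in> {-1, 1}" "z i \<in> {-1, 1}"
      using signs that by auto
    then show ?thesis using \<pi>(1) by auto
  qed
  then have "\<pi> * (\<Sum>i<n. \<eta> i * z i) = (\<Sum>i<n. 1 - 2 * of_bool (\<pi> * \<eta> i \<noteq> z i))"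
    unfolding sum_distrib_left by (intro sum.cong) auto
  also have "\<dots> = real n - 2 * (\<Sum>i<n. of_bool (\<pi> * \<eta> i \<noteq> z i))"
    by (simp add: sum_subtractf sum_distrib_left)
  also have "\<dots> \<ge> (1 - 2 * \<delta>) * real n"
    using \<pi>(2) n by (simp add: field_simps)
  finally have "(1 - 2 * \<delta>) * real n \<le> \<pi> * (\<Sum>i<n. \<eta> i * z i)" .
  also have "\<dots> \<le> \<bar>\<Sum>i<n. \<eta> i * z i\<bar>"
    using \<pi>(1) by auto
  finally show ?thesis .
qed

lemma label_output_eq: "label_output c n p s \<Delta> X \<omega> i = label_of (out_cell c n p s \<Delta> X \<omega> i)"
  by (simp add: label_output_def label_of_def)

lemma label_output_signs: "label_output c n p s \<Delta> X \<omega> \<in> I \<rightarrow> {-1, 1}"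
  by (auto simp: label_output_def)

lemma measurable_label_output:
  assumes "\<And>X \<omega>. \<exists>t\<le>T. \<exists>\<sigma>. exec c (init_state n p s \<Delta> X \<omega>) t \<sigma>"
  shows "(\<lambda>x. label_output c n p s \<Delta> (fst x) (snd x) i)
    \<in> borel_measurable (data_space n p \<Otimes>\<^sub>M tape_space)"
  unfolding label_output_eq
  using measurable_compose[OF measurable_out_cell[OF assms, of i], of label_of borel]
  by (simp add: split_beta')

lemma measurable_misclust_greater:
  assumes [measurable]: "\<And>i. i < n \<Longrightarrow> (\<lambda>x. \<eta> x i) \<in> borel_measurable M"
  shows "Measurable.pred M (\<lambda>x. \<delta> < misclust n (\<eta> x) z)"
proof -
  have "(\<lambda>x. 1 / real n * (\<Sum>i<n. of_bool (\<pi> * \<eta> x i \<noteq> z i) :: real)) \<in> borel_measurable M" for \<pi>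
    by measurable
  then show ?thesis
    unfolding misclust_greater_iff by (intro pred_intros_finite) auto
qed

lemma init_state_cong:
  assumes "\<And>i j. i < n \<Longrightarrow> j < p \<Longrightarrow> X i j = X' i j"
  shows "init_state n p s \<Delta> X \<omega> = init_state n p s \<Delta> X' \<omega>"
proof -
  have "X (k div p) (k mod p) = X' (k div p) (k mod p)" if "k < n * p" for k
    using that assms by (auto simp: less_mult_imp_div_less intro!: assms mod_less_divisor Nat.gr0I)
  then show ?thesis
    by (simp add: init_state_def fun_eq_iff)
qed

text \<open>
  The time bound and the output come from the same run: the clustering algorithm halts on every
  input, in particular on the first half of the data.
\<close>

lemma test_com_decision:
  assumes N: "2 \<le> N" "com_bound zhat \<le> N"
    and zhat: "\<And>X \<omega>. \<exists>t\<le>T. \<exists>\<sigma>. exec zhat (init_state n p s \<Delta> X \<omega>) t \<sigma>"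
  shows "\<exists>t \<le> 8 * (n * p) + 6 * p + 10 + T. \<exists>\<sigma>. exec (test_com N a b zhat) (init_state n p s \<Delta> X (g, u)) t \<sigma>"
    and "test_output (test_com N a b zhat) n p s \<Delta> X (g, u)
      = of_bool (rejects n p s
          (label_output zhat n p s \<Delta> (first_half n p a b X g) (sdrop (n * p) g, u))
          (second_half n p a b X g))"
proof -
  obtain t \<sigma> where t: "t \<le> T"
    "exec zhat (init_state n p s \<Delta> (first_half n p a b X g) (sdrop (n * p) g, u)) t \<sigma>"
    using zhat by blast
  have labels: "label_of (fst \<sigma> 1 i)
      = label_output zhat n p s \<Delta> (first_half n p a b X g) (sdrop (n * p) g, u) i" for i
    using out_cell_exec[OF t(2)] by (simp add: label_output_eq)
  have "exec zhat (init_state n p s \<Delta> (\<lambda>i j. a * X i j + b * g !! (i * p + j)) (sdrop (n * p) g, u)) t \<sigma>"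
    using t(2) by (subst init_state_cong[where X' = "first_half n p a b X g"]) (auto simp: first_half_def)
  from runs_test_com[OF N this]
  obtain t' \<sigma>' where t': "t' \<le> 8 * (n * p) + 6 * p + 10 + t"
    "exec (test_com N a b zhat) (init_state n p s \<Delta> X (g, u)) t' \<sigma>'"
    "fst \<sigma>' 1 0 = (if rejects n p s (\<lambda>i. label_of (fst \<sigma> 1 i))
       (\<lambda>i j. b * X i j - a * g !! (i * p + j)) then 1 else 0)"
    unfolding runs_def by blast
  show "\<exists>t \<le> 8 * (n * p) + 6 * p + 10 + T. \<exists>\<sigma>. exec (test_com N a b zhat) (init_state n p s \<Delta> X (g, u)) t \<sigma>"
    using t(1) t'(1,2) by (intro exI[of _ t'] conjI exI[of _ \<sigma>']) auto
  show "test_output (test_com N a b zhat) n p s \<Delta> X (g, u)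
      = of_bool (rejects n p s
          (label_output zhat n p s \<Delta> (first_half n p a b X g) (sdrop (n * p) g, u))
          (second_half n p a b X g))"
    unfolding test_output_def out_cell_exec[OF t'(2)] t'(3) labels second_half_def rejects_restrict
    by simp
qed

text \<open>
  Given the labels, which are independent of the second half of the data, the error bounds for
  fixed labels apply.
\<close>

lemma split_test_type_I_error:
  assumes ab: "a\<^sup>2 + b\<^sup>2 = 1" "b \<noteq> 0" and n: "1 \<le> n" and s: "1 \<le> s" "s < p"
    and zhat: "\<And>X \<omega>. \<exists>t\<le>T. \<exists>\<sigma>. exec zhat (init_state n p s \<Delta> X \<omega>) t \<sigma>"
  shows "(\<integral>\<^sup>+(X, g, u). ennreal (of_bool (rejects n p s
        (label_output zhat n p s \<Delta> (first_half n p a b X g) (sdrop (n * p) g, u))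
        (second_half n p a b X g))) \<partial>joint_law n p (\<lambda>_. 0) z)
    \<le> ennreal (exp (- log_sparsity p s))"
proof -
  define F where "F x = ennreal (of_bool (rejects n p s
      (label_output zhat n p s \<Delta> (fst (fst x)) (snd (fst x))) (snd x)))" for x
  have F: "F \<in> borel_measurable ((data_space n p \<Otimes>\<^sub>M tape_space) \<Otimes>\<^sub>M data_space n p)"
  proof -
    have [measurable]: "Measurable.pred ((data_space n p \<Otimes>\<^sub>M tape_space) \<Otimes>\<^sub>M data_space n p)
        (\<lambda>x. rejects n p s (label_output zhat n p s \<Delta> (fst (fst x)) (snd (fst x))) (snd x))"
      by (intro measurable_rejects measurable_compose[OF measurable_fst measurable_label_output[OF zhat]]
          measurable_compose[OF measurable_snd measurable_data_entry])
    show ?thesis unfolding F_def by measurable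
  qed
  have "(\<integral>\<^sup>+(X, g, u). ennreal (of_bool (rejects n p s
        (label_output zhat n p s \<Delta> (first_half n p a b X g) (sdrop (n * p) g, u))
        (second_half n p a b X g))) \<partial>joint_law n p (\<lambda>_. 0) z)
    = (\<integral>\<^sup>+x. \<integral>\<^sup>+Y. F (x, Y) \<partial>cluster_model n p (\<lambda>_. 0) z \<partial>joint_law n p (\<lambda>_. 0) z)"
    using nn_integral_sample_split[OF ab F, where \<theta> = "\<lambda>_. 0" and z = z] by (simp add: F_def)
  also have "\<dots> \<le> (\<integral>\<^sup>+x. ennreal (exp (- log_sparsity p s)) \<partial>joint_law n p (\<lambda>_. 0) z)"
  proof (rule nn_integral_mono)
    fix x
    show "(\<integral>\<^sup>+Y. F (x, Y) \<partial>cluster_model n p (\<lambda>_. 0) z) \<le> ennreal (exp (- log_sparsity p s))"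
      unfolding F_def fst_conv snd_conv
      by (rule type_I_error[OF n s]) (simp add: label_output_def)
  qed
  also have "\<dots> = ennreal (exp (- log_sparsity p s))"
    using prob_space.emeasure_space_1[OF prob_space_joint_law] by simp
  finally show ?thesis .
qed

lemma split_test_type_II_error:
  assumes ab: "a\<^sup>2 + b\<^sup>2 = 1" "b \<noteq> 0" and n: "1 \<le> n" and s: "1 \<le> s" "s < p" and \<delta>: "\<delta> < 1 / 2"
    and zhat: "\<And>X \<omega>. \<exists>t\<le>T. \<exists>\<sigma>. exec zhat (init_state n p s \<Delta> X \<omega>) t \<sigma>"
    and z: "z \<in> {..<n} \<rightarrow> {-1, 1}" and sparse: "l0_norm p \<theta> \<le> s"
    and signal: "24 * log_sparsity p s \<le> (1 - 2 * \<delta>)\<^sup>2 * real n * b\<^sup>2 * (L2_set \<theta> {..<p})\<^sup>2"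
  shows "(\<integral>\<^sup>+(X, g, u). ennreal (of_bool (\<not> rejects n p s
        (label_output zhat n p s \<Delta> (first_half n p a b X g) (sdrop (n * p) g, u))
        (second_half n p a b X g))) \<partial>joint_law n p \<theta> z)
    \<le> emeasure (joint_law n p (\<lambda>j. a * \<theta> j) z)
         {(X, \<omega>) \<in> space (joint_law n p (\<lambda>j. a * \<theta> j) z). misclust n (label_output zhat n p s \<Delta> X \<omega>) z > \<delta>}
      + ennreal (exp (- log_sparsity p s))"
proof -
  let ?J = "joint_law n p (\<lambda>j. a * \<theta> j) z"
  let ?B = "{(X, \<omega>) \<in> space ?J. misclust n (label_output zhat n p s \<Delta> X \<omega>) z > \<delta>}"
  define lab where "lab x = label_output zhat n p s \<Delta> (fst x) (snd x)" for x
  define F where "F x = ennreal (of_bool (\<not> rejects n p s (lab (fst x)) (snd x)))" for x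
  have lab: "(\<lambda>x. lab x i) \<in> borel_measurable (data_space n p \<Otimes>\<^sub>M tape_space)" for i
    unfolding lab_def by (rule measurable_label_output[OF zhat])
  have F: "F \<in> borel_measurable ((data_space n p \<Otimes>\<^sub>M tape_space) \<Otimes>\<^sub>M data_space n p)"
  proof -
    have [measurable]: "Measurable.pred ((data_space n p \<Otimes>\<^sub>M tape_space) \<Otimes>\<^sub>M data_space n p)
        (\<lambda>x. rejects n p s (lab (fst x)) (snd x))"
      by (intro measurable_rejects measurable_compose[OF measurable_fst lab]
          measurable_compose[OF measurable_snd measurable_data_entry])
    show ?thesis unfolding F_def by measurable
  qed
  have B: "?B \<in> sets ?J"
  proof -
    have "Measurable.pred ?J (\<lambda>x. \<delta> < misclust n (lab x) z)"
      using measurable_misclust_greater[OF lab] by (simp cong: measurable_cong_sets add: sets_joint_law)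
    moreover have "?B = {x \<in> space ?J. \<delta> < misclust n (lab x) z}"
      by (auto simp: lab_def)
    ultimately show ?thesis by (simp add: pred_def)
  qed
  have "(\<integral>\<^sup>+(X, g, u). ennreal (of_bool (\<not> rejects n p s
        (label_output zhat n p s \<Delta> (first_half n p a b X g) (sdrop (n * p) g, u))
        (second_half n p a b X g))) \<partial>joint_law n p \<theta> z)
    = (\<integral>\<^sup>+x. \<integral>\<^sup>+Y. F (x, Y) \<partial>cluster_model n p (\<lambda>j. b * \<theta> j) z \<partial>?J)"
    using nn_integral_sample_split[OF ab F, where \<theta> = \<theta> and z = z] by (simp add: F_def lab_def)
  also have "\<dots> \<le> (\<integral>\<^sup>+x. indicator ?B x + ennreal (exp (- log_sparsity p s)) \<partial>?J)"
  proof (rule nn_integral_mono)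
    fix x assume x: "x \<in> space ?J"
    show "(\<integral>\<^sup>+Y. F (x, Y) \<partial>cluster_model n p (\<lambda>j. b * \<theta> j) z)
        \<le> indicator ?B x + ennreal (exp (- log_sparsity p s))"
    proof (cases "x \<in> ?B")
      case True
      have "(\<integral>\<^sup>+Y. F (x, Y) \<partial>cluster_model n p (\<lambda>j. b * \<theta> j) z)
          \<le> (\<integral>\<^sup>+Y. 1 \<partial>cluster_model n p (\<lambda>j. b * \<theta> j) z)"
        by (intro nn_integral_mono) (auto simp: F_def)
      also have "\<dots> = 1"
        using prob_space.emeasure_space_1[OF prob_space_cluster_model] by simp
      finally show ?thesis
        using True by (simp add: add_increasing2)
    next
      case False
      have "misclust n (lab x) z \<le> \<delta>"
        using False x by (auto simp: lab_def)
      then have "(1 - 2 * \<delta>) * real n \<le> \<bar>\<Sum>i<n. lab x i * z i\<bar>"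
        using z n by (intro misclust_le_imp_correlated) (simp_all add: lab_def label_output_signs)
      then have "((1 - 2 * \<delta>) * real n)\<^sup>2 \<le> (\<Sum>i<n. lab x i * z i)\<^sup>2"
        using \<delta> by (subst power2_abs[symmetric], intro power_mono) auto
      then have "((1 - 2 * \<delta>) * real n)\<^sup>2 * (\<Sum>j<p. (b * \<theta> j)\<^sup>2) / real n
          \<le> (\<Sum>i<n. lab x i * z i)\<^sup>2 * (\<Sum>j<p. (b * \<theta> j)\<^sup>2) / real n"
        by (intro divide_right_mono mult_right_mono sum_nonneg) auto
      moreover have "((1 - 2 * \<delta>) * real n)\<^sup>2 * (\<Sum>j<p. (b * \<theta> j)\<^sup>2) / real n
          = (1 - 2 * \<delta>)\<^sup>2 * real n * b\<^sup>2 * (L2_set \<theta> {..<p})\<^sup>2"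
        using n by (simp add: L2_set_def sum_nonneg power_mult_distrib power2_eq_square[of "real n"]
            flip: sum_distrib_left)
      ultimately have "24 * log_sparsity p s \<le> (\<Sum>i<n. lab x i * z i)\<^sup>2 * (\<Sum>j<p. (b * \<theta> j)\<^sup>2) / real n"
        using signal by simp
      moreover have "l0_norm p (\<lambda>j. b * \<theta> j) \<le> s"
        using sparse ab(2) by (simp add: l0_norm_def)
      ultimately have "(\<integral>\<^sup>+Y. F (x, Y) \<partial>cluster_model n p (\<lambda>j. b * \<theta> j) z) \<le> ennreal (exp (- log_sparsity p s))"
        unfolding F_def fst_conv snd_conv
        by (intro type_II_error[OF n s]) (auto simp: lab_def label_output_def)
      then show ?thesis using False by simp
    qed
  qed
  also have "\<dots> = emeasure ?J ?B + ennreal (exp (- log_sparsity p s))"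
    using B prob_space.emeasure_space_1[OF prob_space_joint_law, of n p "\<lambda>j. a * \<theta> j" z]
    by (simp add: nn_integral_add)
  finally show ?thesis .
qed

text \<open>
  The probabilities of the two errors that the second half of the data can cause add up to
  at most \<open>s / p\<close> because \<open>exp (- ln (e p / s)) = s / (e p)\<close> and \<open>2 \<le> e\<close>.
\<close>

lemma error_budget:
  assumes "1 \<le> s" "s < p"
  shows "2 * exp (- log_sparsity p s) \<le> real s / real p"
proof -
  let ?l = "ln (exp 1 * real p / real s)"
  have "0 \<le> ?l"
    using log_sparsity_ge(2)[OF assms] by linarith
  then have "?l \<le> log_sparsity p s"
    unfolding log_sparsity_def using mult_right_mono[of 1 "real s" ?l] assms(1) by simp
  then have "2 * exp (- log_sparsity p s) \<le> 2 * exp (- ?l)"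
    by simp
  also have "\<dots> = 2 / exp 1 * (real s / real p)"
    unfolding exp_ln_sparsity[OF assms, symmetric] by simp
  also have "\<dots> \<le> 1 * (real s / real p)"
    using exp_ge_add_one_self[of "1 :: real"] by (intro mult_right_mono) auto
  finally show ?thesis by simp
qed

text \<open>
  The first half of the data carries the signal \<open>\<theta> / sqrt (1 + \<epsilon>\<^sup>2)\<close>. It has to be at least as strong
  as \<open>(1 - \<epsilon>\<^sup>2) \<theta>\<close>, on which the clustering algorithm is known to be accurate.
\<close>

lemma shrinkage_le:
  fixes \<epsilon> :: real
  assumes "0 < \<epsilon>" "\<epsilon> \<le> 1"
  shows "1 - \<epsilon>\<^sup>2 \<le> 1 / sqrt (1 + \<epsilon>\<^sup>2)"
proof -
  have \<epsilon>2: "0 \<le> \<epsilon>\<^sup>2" "\<epsilon>\<^sup>2 \<le> 1"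
    using assms by (auto simp: power_le_one)
  have "(1 - \<epsilon>\<^sup>2)\<^sup>2 * (1 + \<epsilon>\<^sup>2) = (1 - \<epsilon>\<^sup>2) * (1 - (\<epsilon>\<^sup>2)\<^sup>2)"
    by (simp add: power2_eq_square algebra_simps)
  also have "\<dots> \<le> 1"
    using \<epsilon>2 assms by (intro mult_le_one) (auto simp: power_le_one)
  finally have "sqrt ((1 - \<epsilon>\<^sup>2)\<^sup>2 * (1 + \<epsilon>\<^sup>2)) \<le> 1"
    by simp
  then have "(1 - \<epsilon>\<^sup>2) * sqrt (1 + \<epsilon>\<^sup>2) \<le> 1"
    using \<epsilon>2 by (simp add: real_sqrt_mult)
  moreover have "0 < sqrt (1 + \<epsilon>\<^sup>2)"
    using \<epsilon>2 by (simp add: add_pos_nonneg)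
  ultimately show ?thesis
    by (simp add: pos_le_divide_eq)
qed

theorem theorem2p4:
  fixes p s :: "nat \<Rightarrow> nat" and \<Delta> r :: "nat \<Rightarrow> real"
    and \<delta> \<alpha> \<epsilon> :: real and zhat :: com
  assumes "\<And>n. n \<ge> 1 \<Longrightarrow> 1 \<le> p n \<and> 1 \<le> s n"
    and "\<And>n. 0 \<le> r n"
    and "0 \<le> \<delta>" "\<delta> < 1/2" "0 \<le> \<alpha>" "\<alpha> \<le> 1" "0 < \<epsilon>" "\<epsilon> \<le> 1"
    and "has_runtime zhat p s \<Delta> r"
    and "\<And>n. n \<ge> 1 \<Longrightarrow>
      (SUP (\<theta>, z) \<in> param_set n (p n) (s n) (\<Delta> n).
         emeasure (joint_law n (p n) \<theta> z)
           {(X, \<omega>) \<in> space (joint_law n (p n) \<theta> z).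
              misclust n (label_output zhat n (p n) (s n) (\<Delta> n) X \<omega>) z > \<delta>})
      \<le> ennreal \<alpha>"
    and "\<And>n. n \<ge> 1 \<Longrightarrow>
      \<Delta> n > 2 * sqrt 6 * inverse (1 - 2 * \<delta>) * sqrt (1 + inverse (\<epsilon>\<^sup>2)) *
              sqrt (real (s n) * ln (exp 1 * real (p n) / real (s n)) / real n)"
  shows "\<exists>test :: com.
    has_runtime test p s \<Delta> (\<lambda>n. r n + real (p n) * real n) \<and>
    (\<forall>n\<ge>1.
      (\<integral>\<^sup>+ (X, \<omega>). ennreal (test_output test n (p n) (s n) (\<Delta> n) X \<omega>)
         \<partial>joint_law n (p n) (\<lambda>_. 0) (\<lambda>_. 1)) +
      (SUP (\<theta>, z) \<in> {(\<theta>, z). ((\<lambda>j. (1 - \<epsilon>\<^sup>2) * \<theta> j), z) \<in> param_set n (p n) (s n) (\<Delta> n)}.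
         \<integral>\<^sup>+ (X, \<omega>). ennreal (1 - test_output test n (p n) (s n) (\<Delta> n) X \<omega>)
           \<partial>joint_law n (p n) \<theta> z)
      \<le> ennreal (\<alpha> + real (s n) / real (p n)))"
proof -
  \<comment> \<open>The two halves of the data have centres \<open>a \<theta>\<close> and \<open>b \<theta>\<close>; the factor \<open>sqrt (1 + 1 / \<epsilon>\<^sup>2)\<close> in the
    bound on \<open>\<Delta>\<close> is the inverse of \<open>b\<close>.\<close>
  define a b where "a = 1 / sqrt (1 + \<epsilon>\<^sup>2)" and "b = \<epsilon> / sqrt (1 + \<epsilon>\<^sup>2)"
  have pos: "0 < 1 + \<epsilon>\<^sup>2"
    by (simp add: add_pos_nonneg)
  have ab: "a\<^sup>2 + b\<^sup>2 = 1" "b \<noteq> 0"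
    using pos assms(7) by (auto simp: a_def b_def power_divide simp flip: add_divide_distrib)
  have a: "0 < a"
    using pos by (simp add: a_def)
  have b2: "b\<^sup>2 * (1 + inverse (\<epsilon>\<^sup>2)) = 1"
  proof -
    have "1 + inverse (\<epsilon>\<^sup>2) = (1 + \<epsilon>\<^sup>2) / \<epsilon>\<^sup>2" "b\<^sup>2 = \<epsilon>\<^sup>2 / (1 + \<epsilon>\<^sup>2)"
      using pos assms(7) by (simp_all add: b_def power_divide field_simps)
    then show ?thesis
      using pos assms(7) by simp
  qed
  define test where "test = test_com (max 2 (com_bound zhat)) a b zhat"
  obtain T where T: "\<And>n X \<omega>. n \<ge> 1 \<Longrightarrow> \<exists>t\<le>T n. \<exists>\<sigma>. exec zhat (init_state n (p n) (s n) (\<Delta> n) X \<omega>) t \<sigma>"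
    and T_bigo: "(\<lambda>n. real (T n)) \<in> O(r)"
    using assms(9) unfolding has_runtime_def by blast
  have halts: "\<exists>t \<le> 8 * (n * p n) + 6 * p n + 10 + T n.
      \<exists>\<sigma>. exec test (init_state n (p n) (s n) (\<Delta> n) X \<omega>) t \<sigma>" if "n \<ge> 1" for n X \<omega>
    unfolding test_def
    using test_com_decision(1)[of "max 2 (com_bound zhat)" zhat "T n" n "p n" "s n" "\<Delta> n" a b X "fst \<omega>" "snd \<omega>"]
      T[OF that] by simp
  have decision: "test_output test n (p n) (s n) (\<Delta> n) X (g, u) = of_bool (rejects n (p n) (s n)
      (label_output zhat n (p n) (s n) (\<Delta> n) (first_half n (p n) a b X g) (sdrop (n * p n) g, u))
      (second_half n (p n) a b X g))" if "n \<ge> 1" for n X g u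
    unfolding test_def by (intro test_com_decision(2)[where T = "T n"] T that) auto
  have "has_runtime test p s \<Delta> (\<lambda>n. r n + real (p n) * real n)"
  proof -
    have "(\<lambda>n. real (8 * (n * p n) + 6 * p n + 10 + T n)) \<in> O(\<lambda>n. r n + real (p n) * real n)"
    proof -
      have "(\<lambda>n. real (8 * (n * p n) + 6 * p n + 10)) \<in> O(\<lambda>n. r n + real (p n) * real n)"
      proof (rule bigoI[where c = 24], rule eventually_at_top_linorderI[of 1])
        fix n :: nat assume n: "1 \<le> n"
        have "1 * p n \<le> n * p n"
          using n by (rule mult_le_mono1)
        then have "8 * (n * p n) + 6 * p n + 10 \<le> 24 * (n * p n)"
          using assms(1)[OF n] by linarith
        then have "real (8 * (n * p n) + 6 * p n + 10) \<le> real (24 * (n * p n))"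
          by (rule of_nat_mono)
        also have "\<dots> = 24 * (real (p n) * real n)"
          by simp
        also have "\<dots> \<le> 24 * (r n + real (p n) * real n)"
          using assms(2) by simp
        finally show "norm (real (8 * (n * p n) + 6 * p n + 10)) \<le> 24 * norm (r n + real (p n) * real n)"
          using assms(2)[of n] by simp
      qed
      moreover have "(\<lambda>n. real (T n)) \<in> O(\<lambda>n. r n + real (p n) * real n)"
        by (rule landau_o.big_trans[OF T_bigo])
           (auto intro!: landau_o.big_mono always_eventually simp: assms(2))
      ultimately have "(\<lambda>n. real (8 * (n * p n) + 6 * p n + 10) + real (T n))
          \<in> O(\<lambda>n. r n + real (p n) * real n)"
        by (rule sum_in_bigo)
      then show ?thesis
        by (simp only: of_nat_add)
    qed
    then show ?thesis
      unfolding has_runtime_def using halts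
      by (intro exI[of _ "\<lambda>n. 8 * (n * p n) + 6 * p n + 10 + T n"] conjI allI impI)
  qed
  moreover have "(\<integral>\<^sup>+ (X, \<omega>). ennreal (test_output test n (p n) (s n) (\<Delta> n) X \<omega>)
         \<partial>joint_law n (p n) (\<lambda>_. 0) (\<lambda>_. 1)) +
      (SUP (\<theta>, z) \<in> {(\<theta>, z). ((\<lambda>j. (1 - \<epsilon>\<^sup>2) * \<theta> j), z) \<in> param_set n (p n) (s n) (\<Delta> n)}.
         \<integral>\<^sup>+ (X, \<omega>). ennreal (1 - test_output test n (p n) (s n) (\<Delta> n) X \<omega>)
           \<partial>joint_law n (p n) \<theta> z)
      \<le> ennreal (\<alpha> + real (s n) / real (p n))" (is "?I + ?II \<le> _") if n: "n \<ge> 1" for n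
  proof (cases "p n \<le> s n")
    case True
    have out: "test_output test n (p n) (s n) (\<Delta> n) X \<omega> = 1" for X \<omega>
      using decision[OF n, of X "fst \<omega>" "snd \<omega>"] True by (simp add: rejects_def)
    have "?I = 1"
      unfolding out using prob_space.emeasure_space_1[OF prob_space_joint_law, of n "p n" "\<lambda>_. 0" "\<lambda>_. 1"]
      by (simp add: split_beta')
    moreover have "?II \<le> 0"
      unfolding out by (rule SUP_least) (auto simp: split_beta')
    moreover have "1 \<le> \<alpha> + real (s n) / real (p n)"
    proof -
      have "1 \<le> real (s n) / real (p n)"
        using True assms(1)[OF n] by simp
      then show ?thesis using assms(5) by simp
    qed
    ultimately show ?thesis
      by (simp add: ennreal_leI flip: ennreal_1)
  next
    case False
    let ?L = "log_sparsity (p n) (s n)"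
    have s: "1 \<le> s n" "s n < p n"
      using False assms(1)[OF n] by auto
    have "0 < ?L"
      using log_sparsity_ge(1)[OF s] s by simp
    define C where "C = 2 * sqrt 6 * inverse (1 - 2 * \<delta>) * sqrt (1 + inverse (\<epsilon>\<^sup>2)) * sqrt (?L / real n)"
    have C: "C < \<Delta> n"
      using assms(11)[OF n] by (simp add: C_def log_sparsity_def)
    have C0: "0 \<le> C"
      using assms(4) \<open>0 < ?L\<close> by (simp add: C_def)
    have C2: "C\<^sup>2 = 24 * (inverse (1 - 2 * \<delta>))\<^sup>2 * (1 + inverse (\<epsilon>\<^sup>2)) * (?L / real n)"
      using \<open>0 < ?L\<close> by (simp add: C_def power_mult_distrib)
    have "?I = (\<integral>\<^sup>+(X, g, u). ennreal (of_bool (rejects n (p n) (s n)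
          (label_output zhat n (p n) (s n) (\<Delta> n) (first_half n (p n) a b X g) (sdrop (n * p n) g, u))
          (second_half n (p n) a b X g))) \<partial>joint_law n (p n) (\<lambda>_. 0) (\<lambda>_. 1))"
      using decision[OF n] by (intro nn_integral_cong) auto
    also have "\<dots> \<le> ennreal (exp (- ?L))"
      by (rule split_test_type_I_error[OF ab n s T[OF n]])
    finally have "?I \<le> ennreal (exp (- ?L))" .
    moreover have "?II \<le> ennreal \<alpha> + ennreal (exp (- ?L))"
    proof (rule SUP_least, clarify)
      fix \<theta> z assume "((\<lambda>j. (1 - \<epsilon>\<^sup>2) * \<theta> j), z) \<in> param_set n (p n) (s n) (\<Delta> n)"
      then have z: "z \<in> {..<n} \<rightarrow> {-1, 1}" and l0: "l0_norm (p n) (\<lambda>j. (1 - \<epsilon>\<^sup>2) * \<theta> j) \<le> s n"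
        and norm: "\<Delta> n \<le> L2_set (\<lambda>j. (1 - \<epsilon>\<^sup>2) * \<theta> j) {..<p n}"
        by (auto simp: param_set_def)
      have \<epsilon>2: "0 \<le> 1 - \<epsilon>\<^sup>2"
        using assms(7,8) by (simp add: power_le_one)
      have norm': "\<Delta> n \<le> (1 - \<epsilon>\<^sup>2) * L2_set \<theta> {..<p n}"
        using norm L2_set_right_distrib[OF \<epsilon>2, of \<theta>] by simp
      \<comment> \<open>For \<open>\<epsilon> = 1\<close> no parameter is left, since \<open>\<Delta> n\<close> is positive.\<close>
      have "1 - \<epsilon>\<^sup>2 \<noteq> 0"
        using norm' C C0 by auto
      then have sparse: "l0_norm (p n) \<theta> \<le> s n"
        using l0 by (simp add: l0_norm_def)
      have "\<Delta> n \<le> a * L2_set \<theta> {..<p n}"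
        using norm' shrinkage_le[OF assms(7,8)] L2_set_nonneg[of \<theta> "{..<p n}"]
        unfolding a_def by (meson mult_right_mono order_trans)
      then have first: "((\<lambda>j. a * \<theta> j), z) \<in> param_set n (p n) (s n) (\<Delta> n)"
        using z sparse a L2_set_right_distrib[of a \<theta> "{..<p n}"]
        by (simp add: param_set_def l0_norm_def)
      have "\<Delta> n \<le> L2_set \<theta> {..<p n}"
        using norm' mult_right_mono[of "1 - \<epsilon>\<^sup>2" 1 "L2_set \<theta> {..<p n}"] by (simp add: L2_set_nonneg)
      then have "C\<^sup>2 \<le> (L2_set \<theta> {..<p n})\<^sup>2"
        using C C0 by (intro power_mono) auto
      then have "(1 - 2 * \<delta>)\<^sup>2 * real n * b\<^sup>2 * C\<^sup>2
          \<le> (1 - 2 * \<delta>)\<^sup>2 * real n * b\<^sup>2 * (L2_set \<theta> {..<p n})\<^sup>2"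
        by (intro mult_left_mono) auto
      moreover have "(1 - 2 * \<delta>)\<^sup>2 * real n * b\<^sup>2 * C\<^sup>2 = 24 * ?L"
      proof -
        have "(1 - 2 * \<delta>)\<^sup>2 * real n * b\<^sup>2 * C\<^sup>2
            = ((1 - 2 * \<delta>) * inverse (1 - 2 * \<delta>))\<^sup>2 * (b\<^sup>2 * (1 + inverse (\<epsilon>\<^sup>2))) * (real n * (24 * (?L / real n)))"
          unfolding C2 power_mult_distrib by (simp only: ac_simps)
        also have "(1 - 2 * \<delta>) * inverse (1 - 2 * \<delta>) = 1"
          using assms(4) by simp
        finally show ?thesis
          unfolding b2 using n by simp
      qed
      ultimately have signal: "24 * ?L \<le> (1 - 2 * \<delta>)\<^sup>2 * real n * b\<^sup>2 * (L2_set \<theta> {..<p n})\<^sup>2"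
        by simp
      have "(\<integral>\<^sup>+ (X, \<omega>). ennreal (1 - test_output test n (p n) (s n) (\<Delta> n) X \<omega>) \<partial>joint_law n (p n) \<theta> z)
        = (\<integral>\<^sup>+(X, g, u). ennreal (of_bool (\<not> rejects n (p n) (s n)
            (label_output zhat n (p n) (s n) (\<Delta> n) (first_half n (p n) a b X g) (sdrop (n * p n) g, u))
            (second_half n (p n) a b X g))) \<partial>joint_law n (p n) \<theta> z)"
        using decision[OF n] by (intro nn_integral_cong) (auto simp: split_beta')
      also have "\<dots> \<le> emeasure (joint_law n (p n) (\<lambda>j. a * \<theta> j) z)
           {(X, \<omega>) \<in> space (joint_law n (p n) (\<lambda>j. a * \<theta> j) z).
              misclust n (label_output zhat n (p n) (s n) (\<Delta> n) X \<omega>) z > \<delta>}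
        + ennreal (exp (- ?L))"
        by (rule split_test_type_II_error[OF ab n s assms(4) T[OF n] z sparse signal])
      also have "\<dots> \<le> ennreal \<alpha> + ennreal (exp (- ?L))"
        using order_trans[OF SUP_upper[OF first] assms(10)[OF n]] by (intro add_right_mono) simp
      finally show "(\<integral>\<^sup>+ (X, \<omega>). ennreal (1 - test_output test n (p n) (s n) (\<Delta> n) X \<omega>) \<partial>joint_law n (p n) \<theta> z)
          \<le> ennreal \<alpha> + ennreal (exp (- ?L))" .
    qed
    ultimately have "?I + ?II \<le> ennreal (exp (- ?L)) + (ennreal \<alpha> + ennreal (exp (- ?L)))"
      by (rule add_mono)
    also have "\<dots> = ennreal (\<alpha> + 2 * exp (- ?L))"
      using assms(5) by (simp flip: ennreal_plus)
    also have "\<dots> \<le> ennreal (\<alpha> + real (s n) / real (p n))"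
      using error_budget[OF s] by (intro ennreal_leI) simp
    finally show ?thesis .
  qed
  ultimately show ?thesis by blast
qed

end
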